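(* Let $t\in\{1,2,3\}$, and let $(d,\nu,\epsilon,s)$ be a quadruple of integers admissible for $t$, in the sense defined in the context (in all these cases $d=3q$ for a positive integer $q$). Let $\mathcal{B}^{(t)}_{d,\nu,\epsilon}(w)\in\mathbb{C}[w]$ be a polynomial of type $(d,\nu,\epsilon,s)$, as defined in the context, and let $\mathcal{J}_d$ be the bivariate polynomial of degree $d$ defined in the context. Then the degree $d$ surface with affine equation $$\mathcal{J}_{d}(u,v)+\frac{\mathcal{B}^{(t)}_{d,\nu,\epsilon}(w)+1}{2}=0,\qquad (u,v,w)\in\mathbb{C}^3,$$ has $$\frac{d(d-1)(s-1)}{2}+\frac{d(d-3)}{3}+1$$ singularities of type $A_\nu$.
   Context: **Critical points.** A critical point $w_0$ of a univariate polynomial $P\in\mathbb{C}[w]$ has multiplicity $\nu$ if it is a zero of order $\nu$ of $dP/dw$; its critical value is $P(w_0)$. **Type $(d,\nu,\epsilon,s)$.** A polynomial $\mathcal{B}\in\mathbb{C}[w]$ of degree $d$ is of type $(d,\nu,\epsilon,s)$ if there are distinct points $w_0,w_u,w_1,\dots,w_{s-1}\in\mathbb{C}$ with $$\frac{d\mathcal{B}(w)}{dw}=(w-w_0)^{\nu}(w-w_u)^{\epsilon}\prod_{l=1}^{s-1}(w-w_l)^{\nu},$$ $\mathcal{B}(w_l)=-1$ for $l=1,\dots,s-1$, $\mathcal{B}(w_0)=1$, and, if $\epsilon\neq 0$, $\mathcal{B}(w_u)=-1$. If $\epsilon=0$, the point $w_u$ and its factor are absent. **Admissible quadruples.** ($t=1$)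 $s=k=3m+1$, $\nu=3n+k-2$, $d=k\nu+1$, $\epsilon=0$, with integers $m\ge 1$, $n\ge 0$. ($t=2$) $s=b=3l+j+1$, $a=3m+j$, $\nu=3n+b-1$, $d=b\nu+a$, $\epsilon=a-1$, with $j\in\{0,1\}$, integers $n\ge 0$, $l\ge m$, where $m\ge 1$ if $j=0$ and $m\ge 0$ if $j=1$. ($t=3$) $s=p$, with $p\ge 4$, integers $m\ge 1$, $n\ge 0$, and $l=0$ if $m=1$, $l\in\{0,1,\dots,m-2\}$ if $m\ge 2$, in one of the following cases: (a1) $p=3m-1$, $d=3(np+m(3m-2)+l+1)$, $\nu=3(n+m)-1$, $\epsilon=3l+1$; (a2) $p=3m$, $d=3(np+3m^2+l+1)$, $\nu=3(n+m)$, $\epsilon=3l+2$; (a3) $p=3m+1$, $d=3(np+m(3m+2)+l+1)$, $\nu=3(n+m)+1$, $\epsilon=3l+1$; (b1) $p=3m-1$, $d=3(np+m(3m-1)+l+1)$, $\nu=3(n+m)$, $\epsilon=3l+2$; (b2) $p=3m$, $d=3(np+m(3m+1)+l+1)$, $\nu=3(n+m)+1$, $\epsilon=3l+2$; (b3) $p=3m+1$, $d=3(np+3m(m+1)+l+1)$, $\nu=3(n+m)+2$, $\epsilon=3l$; (c1) $p=3m-1$, $d=3(np+3m^2+l)$, $\nu=3(n+m)+1$, $\epsilon=3l$; (c2) $p=3m$, $d=3(np+m(3m+2)+l+1)$, $\nu=3(n+m)+2$, $\epsilon=3l+2$; (c3) $p=3m+1$, $d=3(np+(3m+1)(m+1)+l+1)$,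 $\nu=3(n+m+1)$, $\epsilon=3l+2$. **The polynomial $\mathcal{J}_d$.** For an integer $d\ge1$ and each integer $\mu$ put $\theta_\mu=\frac{\pi}{d}\cdot\frac{6\mu-1}{6}$ and $$L_{d,\mu}(x,y)=y+\left(\cos(2\theta_\mu)-x\right)\tan(\theta_\mu)+\sin(2\theta_\mu).$$ Define $$\hat J_{d,0}(x,y)=2\cos\left(\frac{d\pi}{2}+\frac{2\pi}{3}\right)\prod_{\mu=-\lfloor (d-2)/2\rfloor}^{\lfloor (d+1)/2\rfloor}L_{d,\mu}(x,y),\qquad \mathcal{J}_d(x,y)=\hat J_{d,0}\left(x,\frac{y}{\sqrt3}\right).$$ These are real polynomials of degree $d$, regarded also as polynomials on $\mathbb{C}^2$. **Singularities.** A singular point of a complex surface is of type $A_\nu$ if the surface is locally analytically equivalent there to $X^2+Y^2+Z^{\nu+1}=0$ at the origin. *)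

theory Defs
  imports "HOL-Analysis.Analysis" "HOL-Computational_Algebra.Computational_Algebra"
begin

text \<open>The point \<open>w l\<close> is defined for \<open>l < s\<close>. When \<open>\<epsilon> = 0\<close> the variable \<open>wu\<close> is
  unconstrained and its factor is 1, which renders the convention that this point is absent.\<close>

definition of_type :: "nat \<Rightarrow> nat \<Rightarrow> nat \<Rightarrow> nat \<Rightarrow> complex poly \<Rightarrow> bool" where
  "of_type d \<nu> \<epsilon> s B \<longleftrightarrow>
     degree B = d \<and>
     (\<exists>(w :: nat \<Rightarrow> complex) wu.
        inj_on w {..<s} \<and> (\<epsilon> \<noteq> 0 \<longrightarrow> wu \<notin> w ` {..<s}) \<and>
        pderiv B = [:- w 0, 1:] ^ \<nu> * [:- wu, 1:] ^ \<epsilon> * (\<Prod>l=1..<s. [:- w l, 1:] ^ \<nu>) \<and>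
        (\<forall>l\<in>{1..<s}. poly B (w l) = -1) \<and>
        poly B (w 0) = 1 \<and>
        (\<epsilon> \<noteq> 0 \<longrightarrow> poly B wu = -1))"

text \<open>All parameters are natural numbers; under the stated constraints none of the
  subtractions is truncated.\<close>

definition admissible1 :: "nat \<Rightarrow> nat \<Rightarrow> nat \<Rightarrow> nat \<Rightarrow> bool" where
  "admissible1 d \<nu> \<epsilon> s \<longleftrightarrow>
     (\<exists>m n k. m \<ge> 1 \<and> k = 3*m + 1 \<and>
        s = k \<and> \<nu> = 3*n + k - 2 \<and> d = k*\<nu> + 1 \<and> \<epsilon> = 0)"

definition admissible2 :: "nat \<Rightarrow> nat \<Rightarrow> nat \<Rightarrow> nat \<Rightarrow> bool" where
  "admissible2 d \<nu> \<epsilon> s \<longleftrightarrow>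
     (\<exists>j l m n a b. j \<in> {0, 1} \<and> l \<ge> m \<and> (j = 0 \<longrightarrow> m \<ge> 1) \<and>
        b = 3*l + j + 1 \<and> a = 3*m + j \<and>
        s = b \<and> \<nu> = 3*n + b - 1 \<and> d = b*\<nu> + a \<and> \<epsilon> = a - 1)"

definition admissible3 :: "nat \<Rightarrow> nat \<Rightarrow> nat \<Rightarrow> nat \<Rightarrow> bool" where
  "admissible3 d \<nu> \<epsilon> s \<longleftrightarrow>
     (\<exists>p m n l. s = p \<and> p \<ge> 4 \<and> m \<ge> 1 \<and> (if m = 1 then l = 0 else l \<le> m - 2) \<and>
       ( p = 3*m - 1 \<and> d = 3*(n*p + m*(3*m - 2) + l + 1) \<and> \<nu> = 3*(n + m) - 1 \<and> \<epsilon> = 3*l + 1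
       \<or> p = 3*m \<and> d = 3*(n*p + 3*m^2 + l + 1) \<and> \<nu> = 3*(n + m) \<and> \<epsilon> = 3*l + 2
       \<or> p = 3*m + 1 \<and> d = 3*(n*p + m*(3*m + 2) + l + 1) \<and> \<nu> = 3*(n + m) + 1 \<and> \<epsilon> = 3*l + 1
       \<or> p = 3*m - 1 \<and> d = 3*(n*p + m*(3*m - 1) + l + 1) \<and> \<nu> = 3*(n + m) \<and> \<epsilon> = 3*l + 2
       \<or> p = 3*m \<and> d = 3*(n*p + m*(3*m + 1) + l + 1) \<and> \<nu> = 3*(n + m) + 1 \<and> \<epsilon> = 3*l + 2
       \<or> p = 3*m + 1 \<and> d = 3*(n*p + 3*m*(m + 1) + l + 1) \<and> \<nu> = 3*(n + m) + 2 \<and> \<epsilon> = 3*l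
       \<or> p = 3*m - 1 \<and> d = 3*(n*p + 3*m^2 + l) \<and> \<nu> = 3*(n + m) + 1 \<and> \<epsilon> = 3*l
       \<or> p = 3*m \<and> d = 3*(n*p + m*(3*m + 2) + l + 1) \<and> \<nu> = 3*(n + m) + 2 \<and> \<epsilon> = 3*l + 2
       \<or> p = 3*m + 1 \<and> d = 3*(n*p + (3*m + 1)*(m + 1) + l + 1) \<and> \<nu> = 3*(n + m + 1) \<and> \<epsilon> = 3*l + 2))"

definition admissible :: "nat \<Rightarrow> nat \<Rightarrow> nat \<Rightarrow> nat \<Rightarrow> nat \<Rightarrow> bool" where
  "admissible t d \<nu> \<epsilon> s \<longleftrightarrow>
     t = 1 \<and> admissible1 d \<nu> \<epsilon> s \<or>
     t = 2 \<and> admissible2 d \<nu> \<epsilon> s \<or>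
     t = 3 \<and> admissible3 d \<nu> \<epsilon> s"

definition theta :: "nat \<Rightarrow> int \<Rightarrow> real" where
  "theta d \<mu> = (pi / real d) * ((6 * real_of_int \<mu> - 1) / 6)"

definition L :: "nat \<Rightarrow> int \<Rightarrow> complex \<Rightarrow> complex \<Rightarrow> complex" where
  "L d \<mu> x y =
     y + (of_real (cos (2 * theta d \<mu>)) - x) * of_real (tan (theta d \<mu>))
       + of_real (sin (2 * theta d \<mu>))"

definition J_hat :: "nat \<Rightarrow> complex \<Rightarrow> complex \<Rightarrow> complex" where
  "J_hat d x y =
     of_real (2 * cos (real d * pi / 2 + 2 * pi / 3)) *
     (\<Prod>\<mu> = - \<lfloor>(real d - 2) / 2\<rfloor> .. \<lfloor>(real d + 1) / 2\<rfloor>. L d \<mu> x y)"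

definition J :: "nat \<Rightarrow> complex \<Rightarrow> complex \<Rightarrow> complex" where
  "J d x y = J_hat d x (y / of_real (sqrt 3))"

definition total_degree_eq :: "(complex^3 \<Rightarrow> complex) \<Rightarrow> nat \<Rightarrow> bool" where
  "total_degree_eq F d \<longleftrightarrow>
     (\<exists>c :: nat \<Rightarrow> nat \<Rightarrow> nat \<Rightarrow> complex.
        (\<forall>p. F p = (\<Sum>(i, j, k) \<in> {(i, j, k). i + j + k \<le> d}.
                        c i j k * (p$1)^i * (p$2)^j * (p$3)^k)) \<and>
        (\<exists>i j k. i + j + k = d \<and> c i j k \<noteq> 0))"

definition zero_set :: "(complex^3 \<Rightarrow> complex) \<Rightarrow> (complex^3) set" where
  "zero_set F = {p. F p = 0}"

definition singular_point :: "(complex^3 \<Rightarrow> complex) \<Rightarrow> complex^3 \<Rightarrow> bool" where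
  "singular_point F p \<longleftrightarrow> F p = 0 \<and> (F has_derivative (\<lambda>_. 0)) (at p)"

text \<open>Holomorphic means differentiable with complex-linear derivative. The predicate
  \<open>has_derivative\<close> only gives real-linearity, and \<open>(*s)\<close> is multiplication by complex scalars.\<close>

definition holomorphic3_on :: "(complex^3 \<Rightarrow> complex^3) \<Rightarrow> (complex^3) set \<Rightarrow> bool" where
  "holomorphic3_on f U \<longleftrightarrow>
     (\<forall>p\<in>U. \<exists>D. (f has_derivative D) (at p) \<and> Vector_Spaces.linear (*s) (*s) D)"

text \<open>Equivalence of the germs as point sets, by an ambient biholomorphism. The \<open>A\<close> singularities
  below are reduced, so for reduced equations this is isomorphism of complex space germs.\<close>

definition locally_analytically_equivalent ::
  "(complex^3) set \<Rightarrow> complex^3 \<Rightarrow> (complex^3) set \<Rightarrow> complex^3 \<Rightarrow> bool" where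
  "locally_analytically_equivalent S p T q \<longleftrightarrow>
     (\<exists>U V f g. open U \<and> open V \<and> p \<in> U \<and> q \<in> V \<and>
        homeomorphism U V f g \<and> holomorphic3_on f U \<and> holomorphic3_on g V \<and>
        f p = q \<and> f ` (S \<inter> U) = T \<inter> V)"

definition singularity_of_type_A :: "nat \<Rightarrow> (complex^3 \<Rightarrow> complex) \<Rightarrow> complex^3 \<Rightarrow> bool" where
  "singularity_of_type_A \<nu> F p \<longleftrightarrow>
     singular_point F p \<and>
     locally_analytically_equivalent
       (zero_set F) p (zero_set (\<lambda>z. (z$1)^2 + (z$2)^2 + (z$3)^(\<nu> + 1))) 0"

end

theory Submission
  imports Defs "HOL-Complex_Analysis.Complex_Analysis"
begin

text \<open>Write a point of the \<open>(u, v)\<close>-plane through the triple \<open>x\<^sub>1 x\<^sub>2 x\<^sub>3 = 1\<close> with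
  \<open>u + i v / \<surd>3 = x\<^sub>1 + x\<^sub>2 + x\<^sub>3\<close> and \<open>u - i v / \<surd>3 = 1/x\<^sub>1 + 1/x\<^sub>2 + 1/x\<^sub>3\<close>. The lines of the arrangement
  are tangent to the deltoid, which gives
  \<open>J\<^sub>d(u, v) = (1 + Y\<^sub>1)(1 + Y\<^sub>2)(1 + Y\<^sub>3)\<close> with \<open>Y\<^sub>k = exp(2 \<pi> i / 3) x\<^sub>k\<^sup>d\<close>. Criticality forces the \<open>x\<^sub>k\<close> to be
  distinct and either two of the \<open>Y\<^sub>k\<close> to be \<open>-1\<close> (a node of the arrangement, value 0) or all three to equal
  a cube root of unity (value 8 or \<open>-1\<close>). So singular points of the surface are pairs of a node and a
  critical point of \<open>B\<close> with value \<open>-1\<close>, or of a point of value \<open>-1\<close> and \<open>w\<^sub>0\<close>; in the coordinates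
  \<open>log x\<^sub>k\<close> both kinds of critical points are explicit sums of two squares. The points over \<open>w\<^sub>u\<close> are of
  type \<open>A\<^sub>\<epsilon>\<close> with \<open>\<epsilon> < \<nu>\<close> and must be excluded: along \<open>X Y + Z\<^sup>N = 0\<close> there are pairs of points
  at distance \<open>O(t\<^sup>N)\<close>, at distance \<open>t\<^sup>2\<close> from the origin, whose tangent planes stay transversal, while on
  \<open>X Y + Z\<^sup>n = 0\<close> with \<open>n < N\<close> the tangent planes at such pairs become parallel.\<close>

text \<open>The equivalence of germs used here compares zero sets, not equations: nothing says that
  the pulled-back equation is a unit times the other one, so invariants of the local algebra are not
  at hand. Tangent planes at smooth points belong to the set itself, which is why they carry the
  comparison of types. The rates decide it: the points on the cone of exponent \<open>n\<close> that
  correspond to such a pair are O(t^N) apart, so the gradient of its equation changes by O(t^N),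
  while its size is at least a constant times t^n. The relative change is O(t), and the limiting
  planes agree. Passing to triples is locally invertible only where the three entries are distinct.
  Where two coincide, the first derivative in logarithmic coordinates does not detect critical
  points, so that locus is excluded by a separate second-order argument. Normal forms are explicit:
  only an (\<nu>+1)-st root and one square root are taken, both by the principal logarithm near
  1.\<close>

no_notation fps_nth (infixl "$" 75)

section \<open>Holomorphic maps of three variables\<close>

lemma linear_vec_complex_iff:
  fixes D :: "complex^'n \<Rightarrow> complex^'m"
  shows "Vector_Spaces.linear (*s) (*s) D \<longleftrightarrow>
    (\<forall>x y. D (x + y) = D x + D y) \<and> (\<forall>c x. D (c *s x) = c *s D x)"
proof
  assume "Vector_Spaces.linear (*s) (*s) D"
  then show "(\<forall>x y. D (x + y) = D x + D y) \<and> (\<forall>c x. D (c *s x) = c *s D x)"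
    by (simp add: Vector_Spaces.linear_def module_hom_def module_hom_axioms_def)
next
  assume *: "(\<forall>x y. D (x + y) = D x + D y) \<and> (\<forall>c x. D (c *s x) = c *s D x)"
  show "Vector_Spaces.linear (*s) (*s) D"
    using * by unfold_locales (auto simp: vec.scale_right_distrib vec.scale_left_distrib)
qed

text \<open>Additivity of \<open>D\<close> is already part of \<open>has_derivative\<close>, so only
  homogeneity over complex scalars is demanded. Working with scalar functions makes holomorphy of
  explicit maps a matter of closure rules, one component at a time.\<close>

definition cdiff :: "(complex^3 \<Rightarrow> complex) \<Rightarrow> complex^3 \<Rightarrow> bool" where
  "cdiff f p \<longleftrightarrow> (\<exists>D. (f has_derivative D) (at p) \<and> (\<forall>c h. D (c *s h) = c * D h))"

lemma cdiff_const [intro, simp]: "cdiff (\<lambda>_. c) p"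
  unfolding cdiff_def by (rule exI[of _ "\<lambda>_. 0"]) auto

lemma cdiff_nth [intro, simp]: "cdiff (\<lambda>x. x $ i) p"
  unfolding cdiff_def by (rule exI[of _ "\<lambda>h. h $ i"]) (auto intro: bounded_linear_imp_has_derivative[OF bounded_linear_vec_nth])

lemma cdiff_add [intro]: "cdiff f p \<Longrightarrow> cdiff g p \<Longrightarrow> cdiff (\<lambda>x. f x + g x) p"
  unfolding cdiff_def
  apply clarify
  subgoal for D E
    by (rule exI[of _ "\<lambda>h. D h + E h"]) (auto intro!: derivative_eq_intros simp: algebra_simps)
  done

lemma cdiff_mult [intro]: "cdiff f p \<Longrightarrow> cdiff g p \<Longrightarrow> cdiff (\<lambda>x. f x * g x) p"
  unfolding cdiff_def
  apply clarify
  subgoal for D E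
    by (rule exI[of _ "\<lambda>h. f p * E h + D h * g p"]) (auto intro!: derivative_eq_intros simp: algebra_simps)
  done

lemma cdiff_uminus [intro]: "cdiff f p \<Longrightarrow> cdiff (\<lambda>x. - f x) p"
  using cdiff_mult[of "\<lambda>_. -1" p f] by simp

lemma cdiff_diff [intro]: "cdiff f p \<Longrightarrow> cdiff g p \<Longrightarrow> cdiff (\<lambda>x. f x - g x) p"
  using cdiff_add[of f p "\<lambda>x. - g x"] cdiff_uminus by simp

lemma cdiff_power [intro]: "cdiff f p \<Longrightarrow> cdiff (\<lambda>x. f x ^ n) p"
  by (induction n) auto

lemma cdiff_prod [intro]: "(\<And>i. i \<in> I \<Longrightarrow> cdiff (f i) p) \<Longrightarrow> cdiff (\<lambda>x. \<Prod>i\<in>I. f i x) p"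
  by (induction I rule: infinite_finite_induct) auto

lemma cdiff_divide_const [intro]: "cdiff f p \<Longrightarrow> cdiff (\<lambda>x. f x / c) p"
  using cdiff_mult[of f p "\<lambda>_. inverse c"] by (simp add: divide_inverse)

lemma cdiff_compose:
  assumes "g field_differentiable at (f p)" "cdiff f p"
  shows "cdiff (\<lambda>x. g (f x)) p"
proof -
  from assms obtain g' D where g: "(g has_field_derivative g') (at (f p))"
    and D: "(f has_derivative D) (at p)" "\<And>c h. D (c *s h) = c * D h"
    unfolding cdiff_def field_differentiable_def by blast
  have "((\<lambda>x. g (f x)) has_derivative (\<lambda>h. g' * D h)) (at p)"
    using has_derivative_compose[OF D(1) g[unfolded has_field_derivative_def]] by simp
  then show ?thesis
    unfolding cdiff_def using D(2) by (intro exI[of _ "\<lambda>h. g' * D h"]) auto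
qed

lemma cdiff_exp [intro]: "cdiff f p \<Longrightarrow> cdiff (\<lambda>x. exp (f x)) p"
  by (rule cdiff_compose[of exp]) (auto intro: field_differentiable_within_exp)

lemma cdiff_poly [intro]: "cdiff f p \<Longrightarrow> cdiff (\<lambda>x. poly P (f x)) p"
  by (rule cdiff_compose[of "poly P"])
    (auto simp: field_differentiable_def intro: poly_DERIV)

lemma cdiff_Ln [intro]: "cdiff f p \<Longrightarrow> f p \<notin> \<real>\<^sub>\<le>\<^sub>0 \<Longrightarrow> cdiff (\<lambda>x. Ln (f x)) p"
  by (rule cdiff_compose[of Ln]) (auto intro: field_differentiable_at_Ln)

lemmas cdiff_intros = cdiff_const cdiff_nth cdiff_add cdiff_diff cdiff_uminus cdiff_mult cdiff_power
  cdiff_prod cdiff_exp cdiff_poly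

lemma cdiff_differentiable: "cdiff f p \<Longrightarrow> \<exists>D. (f has_derivative D) (at p)"
  by (auto simp: cdiff_def)

lemma has_derivative_vec_nth_iff:
  fixes f :: "'a::real_normed_vector \<Rightarrow> 'b::euclidean_space ^ 'n"
  shows "(f has_derivative D) (at p) \<longleftrightarrow> (\<forall>i. ((\<lambda>x. f x $ i) has_derivative (\<lambda>h. D h $ i)) (at p))"
proof
  assume *: "(f has_derivative D) (at p)"
  show "\<forall>i. ((\<lambda>x. f x $ i) has_derivative (\<lambda>h. D h $ i)) (at p)"
    using bounded_linear.has_derivative[OF bounded_linear_vec_nth *] by blast
next
  assume *: "\<forall>i. ((\<lambda>x. f x $ i) has_derivative (\<lambda>h. D h $ i)) (at p)"
  show "(f has_derivative D) (at p)"
  proof (rule has_derivative_componentwise_within[THEN iffD2], rule ballI)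
    fix b :: "'b ^ 'n" assume "b \<in> Basis"
    then obtain i c where b: "b = axis i c" by (auto simp: Basis_vec_def)
    have "((\<lambda>x. f x $ i \<bullet> c) has_derivative (\<lambda>h. D h $ i \<bullet> c)) (at p)"
      by (rule bounded_linear.has_derivative[OF bounded_linear_inner_left *[rule_format]])
    then show "((\<lambda>x. f x \<bullet> b) has_derivative (\<lambda>x. D x \<bullet> b)) (at p)"
      by (simp add: b inner_axis)
  qed
qed

lemma holomorphic3_onI:
  fixes f :: "complex^3 \<Rightarrow> complex^3"
  assumes "\<And>p i. p \<in> U \<Longrightarrow> cdiff (\<lambda>x. f x $ i) p"
  shows "holomorphic3_on f U"
  unfolding holomorphic3_on_def
proof
  fix p assume "p \<in> U"
  then have "\<forall>i. \<exists>D. ((\<lambda>x. f x $ i) has_derivative D) (at p) \<and> (\<forall>c h. D (c *s h) = c * D h)"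
    using assms by (simp add: cdiff_def)
  from choice[OF this] obtain D where D: "\<And>i. ((\<lambda>x. f x $ i) has_derivative D i) (at p)"
      "\<And>i c h. D i (c *s h) = c * D i h"
    by blast
  have "(f has_derivative (\<lambda>h. \<chi> i. D i h)) (at p)"
    using D by (simp add: has_derivative_vec_nth_iff)
  moreover have "Vector_Spaces.linear (*s) (*s) (\<lambda>h. \<chi> i. D i h)"
    unfolding linear_vec_complex_iff vec_eq_iff
    by (simp add: D(2) linear_add[OF has_derivative_linear[OF D(1)]])
  ultimately show "\<exists>D. (f has_derivative D) (at p) \<and> Vector_Spaces.linear (*s) (*s) D" by blast
qed

lemma holomorphic3_on_subset: "holomorphic3_on f U \<Longrightarrow> V \<subseteq> U \<Longrightarrow> holomorphic3_on f V"
  by (auto simp: holomorphic3_on_def)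

lemma holomorphic3_on_continuous_on: "holomorphic3_on f U \<Longrightarrow> continuous_on U f"
  unfolding holomorphic3_on_def
  by (meson continuous_at_imp_continuous_on has_derivative_continuous)

lemma holomorphic3_on_compose:
  assumes "holomorphic3_on f U" "holomorphic3_on g V" "f ` U \<subseteq> V"
  shows "holomorphic3_on (g \<circ> f) U"
  unfolding holomorphic3_on_def
proof
  fix p assume p: "p \<in> U"
  obtain D where D: "(f has_derivative D) (at p)" "Vector_Spaces.linear (*s) (*s) D"
    using assms p by (auto simp: holomorphic3_on_def)
  obtain E where E: "(g has_derivative E) (at (f p))" "Vector_Spaces.linear (*s) (*s) E"
    using assms p by (fastforce simp: holomorphic3_on_def)
  show "\<exists>D. (g \<circ> f has_derivative D) (at p) \<and> Vector_Spaces.linear (*s) (*s) D"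
    using diff_chain_at[OF D(1) E(1)] D(2) E(2)
    by (intro exI[of _ "E \<circ> D"]) (auto simp: linear_vec_complex_iff)
qed

text \<open>Brings in one-variable theory: Cauchy's estimate and uniqueness of derivatives are
  applied on complex lines.\<close>

lemma line_has_field_derivative:
  fixes f :: "complex^3 \<Rightarrow> complex"
  assumes "(f has_derivative D) (at (p + z *s h))" "\<And>c h. D (c *s h) = c * D h"
  shows "((\<lambda>z. f (p + z *s h)) has_field_derivative (D h)) (at z)"
proof -
  have "((\<lambda>z. p + z *s h) has_derivative (\<lambda>c. c *s h)) (at z)"
  proof (rule has_derivative_vec_nth_iff[THEN iffD2], rule allI)
    fix i
    have "((\<lambda>z. p $ i + z * h $ i) has_derivative (\<lambda>c. c * h $ i)) (at z)"
      by (auto intro!: derivative_eq_intros)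
    then show "((\<lambda>z. (p + z *s h) $ i) has_derivative (\<lambda>c. (c *s h) $ i)) (at z)" by simp
  qed
  from has_derivative_compose[OF this assms(1)]
  have "((\<lambda>z. f (p + z *s h)) has_derivative (\<lambda>c. D (c *s h))) (at z)" .
  moreover have "(\<lambda>c. D (c *s h)) = (*) (D h)" by (simp add: assms(2) fun_eq_iff)
  ultimately show ?thesis unfolding has_field_derivative_def by simp
qed

text \<open>Only differentiability is assumed; continuity of the derivative comes from Cauchy's estimate
  applied to the difference of two parallel restrictions to complex lines.\<close>

lemma holomorphic_derivative_continuous:
  fixes f :: "complex^3 \<Rightarrow> complex"
  assumes U: "open U" and D: "\<And>p. p \<in> U \<Longrightarrow> (f has_derivative D p) (at p)"
    "\<And>p c h. p \<in> U \<Longrightarrow> D p (c *s h) = c * D p h"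
  shows "continuous_on U (\<lambda>p. D p h)"
proof (rule continuous_at_imp_continuous_on, rule ballI)
  fix p0 assume "p0 \<in> U"
  then obtain \<rho> where \<rho>: "\<rho> > 0" "cball p0 \<rho> \<subseteq> U" using U open_contains_cball by blast
  \<comment> \<open>Discs of radius \<open>r\<close> in direction \<open>h\<close> move a point by
    at most \<open>\<rho> / 2\<close>, so they stay in the compact ball for every centre within
    \<open>\<rho> / 2\<close> of \<open>p0\<close>. The \<open>+ 1\<close> covers
    \<open>h = 0\<close>.\<close>
  define r where "r = \<rho> / 2 / (norm h + 1)"
  have r: "r > 0" using \<rho> by (auto simp: r_def intro!: divide_pos_pos add_nonneg_pos)
  have nh: "norm (z *s h) \<le> \<rho> / 2" if "norm z \<le> r" for z
  proof -
    have "norm (z *s h) = norm z * norm h"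
      unfolding norm_vec_def
      by (simp add: L2_set_def norm_mult power_mult_distrib sum_distrib_left[symmetric] real_sqrt_mult)
    also have "\<dots> \<le> r * (norm h + 1)" using that r by (intro mult_mono) auto
    also have "\<dots> = \<rho> / 2" using add_nonneg_pos[OF norm_ge_zero[of h] zero_less_one]
      unfolding r_def by (metis less_numeral_extra(3) nonzero_eq_divide_eq)
    finally show ?thesis .
  qed
  have cont: "continuous_on (cball p0 \<rho>) f"
    using D(1) \<rho>(2) by (meson continuous_at_imp_continuous_on has_derivative_continuous subsetD)
  have ucont: "uniformly_continuous_on (cball p0 \<rho>) f"
    by (rule compact_uniformly_continuous[OF cont compact_cball])
  show "isCont (\<lambda>p. D p h) p0"
    unfolding continuous_at_eps_delta
  proof (intro allI impI)
    fix e :: real assume e: "e > 0"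
    then have "e * r / 2 > 0" using r by simp
    then obtain \<delta> where \<delta>: "\<delta> > 0"
      "\<And>x y. x \<in> cball p0 \<rho> \<Longrightarrow> y \<in> cball p0 \<rho> \<Longrightarrow> dist y x < \<delta> \<Longrightarrow> dist (f y) (f x) < e * r / 2"
      using ucont unfolding uniformly_continuous_on_def by metis
    show "\<exists>d>0. \<forall>x. dist x p0 < d \<longrightarrow> dist (D x h) (D p0 h) < e"
    proof (intro exI conjI allI impI)
      show "min \<delta> (\<rho>/2) > 0" using \<delta> \<rho> by simp
      fix p assume p: "dist p p0 < min \<delta> (\<rho>/2)"
      have in1: "p + z *s h \<in> cball p0 \<rho>" if "norm z \<le> r" for z
      proof -
        have "dist p0 (p + z *s h) = norm ((p0 - p) - z *s h)" by (simp add: dist_norm algebra_simps)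
        also have "\<dots> \<le> norm (p0 - p) + norm (z *s h)" by (rule norm_triangle_ineq4)
        also have "\<dots> \<le> \<rho>" using p nh[OF that] by (simp add: dist_norm norm_minus_commute)
        finally show ?thesis by simp
      qed
      have in0: "p0 + z *s h \<in> cball p0 \<rho>" if "norm z \<le> r" for z
      proof -
        have "dist p0 (p0 + z *s h) = norm (z *s h)" by (simp add: dist_norm)
        then show ?thesis using nh[OF that] \<rho>(1) by simp
      qed
      define \<phi> where "\<phi> = (\<lambda>z. f (p + z *s h) - f (p0 + z *s h))"
      have d\<phi>: "(\<phi> has_field_derivative (D (p + z *s h) h - D (p0 + z *s h) h)) (at z)"
        if "norm z \<le> r" for z
        unfolding \<phi>_def using in1[OF that] in0[OF that] \<rho>(2)
        by (intro DERIV_diff line_has_field_derivative D) auto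
      have cont\<phi>: "continuous_on (cball 0 r) \<phi>"
        by (rule DERIV_continuous_on[of _ _ "\<lambda>z. D (p + z *s h) h - D (p0 + z *s h) h"])
          (auto intro!: DERIV_subset[OF d\<phi>])
      have hol\<phi>: "\<phi> holomorphic_on ball 0 r"
        unfolding holomorphic_on_def field_differentiable_def
        using d\<phi> by (metis (full_types) dist_0_norm less_imp_le has_field_derivative_at_within mem_ball)
      have bd: "\<phi> z \<in> ball 0 (e * r / 2)" if "z \<in> ball 0 r" for z
      proof -
        have "dist (f (p + z *s h)) (f (p0 + z *s h)) < e * r / 2"
          using that p by (intro \<delta>(2) in1 in0) (auto simp: dist_norm)
        then show ?thesis by (simp add: \<phi>_def dist_norm norm_minus_commute)
      qed
      \<comment> \<open>The two restrictions differ by less than \<open>e * r / 2\<close> on a disc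
        of radius \<open>r\<close>, so their derivatives at the centre differ by at most
        \<open>e / 2\<close>.\<close>
      have "norm ((deriv ^^ 1) \<phi> 0) \<le> (fact 1) * (e * r / 2) / r ^ 1"
        by (rule Cauchy_higher_deriv_bound[OF hol\<phi> cont\<phi> bd r]) auto
      moreover have "deriv \<phi> 0 = D p h - D p0 h"
        using DERIV_imp_deriv[OF d\<phi>[of 0]] r by simp
      ultimately have "norm (D p h - D p0 h) \<le> e / 2" using r by simp
      then show "dist (D p h) (D p0 h) < e" using e by (simp add: dist_norm)
    qed
  qed
qed

text \<open>Gives the derivative as a continuous operator-valued map, the form the inverse function
  theorem asks for. In finite dimension, continuity in each fixed direction implies continuity in
  operator norm.\<close>

lemma holomorphic3_derivative:
  assumes U: "open U" and f: "holomorphic3_on f U"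
  obtains D where "\<And>p. p \<in> U \<Longrightarrow> (f has_derivative blinfun_apply (D p)) (at p)"
    "\<And>p c h. p \<in> U \<Longrightarrow> blinfun_apply (D p) (c *s h) = c *s blinfun_apply (D p) h"
    "continuous_on U D"
proof -
  obtain E where E: "\<And>p. p \<in> U \<Longrightarrow> (f has_derivative E p) (at p)"
    "\<And>p c h. p \<in> U \<Longrightarrow> E p (c *s h) = c *s E p h"
    using f unfolding holomorphic3_on_def linear_vec_complex_iff by metis
  have ap: "blinfun_apply (Blinfun (E p)) = E p" if "p \<in> U" for p
    by (rule bounded_linear_Blinfun_apply[OF has_derivative_bounded_linear[OF E(1)[OF that]]])
  have nth: "continuous_on U (\<lambda>p. E p h $ i)" for h i
    using E by (intro holomorphic_derivative_continuous[OF U, where f = "\<lambda>x. f x $ i" and D = "\<lambda>p h. E p h $ i"])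
      (auto simp: has_derivative_vec_nth_iff)
  have "continuous_on U (\<lambda>p. \<chi> i. E p h $ i)" for h
    by (intro continuous_on_vec_lambda nth)
  then have c: "continuous_on U (\<lambda>p. blinfun_apply (Blinfun (E p)) h)" for h
    using ap by (simp cong: continuous_on_cong)
  show thesis
  proof (rule that[of "\<lambda>p. Blinfun (E p)"])
    show "continuous_on U (\<lambda>p. Blinfun (E p))"
      by (rule continuous_on_blinfun_componentwise) (rule c)
  qed (use E ap in auto)
qed

section \<open>Local biholomorphisms and germ equivalence\<close>

text \<open>The real inverse function theorem applies because an injective endomorphism of a
  finite-dimensional space is invertible. The local inverse is holomorphic because its derivative
  inverts a complex-linear map.\<close>

lemma local_biholomorphism:
  assumes U: "open U" "p \<in> U" and f: "holomorphic3_on f U"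
    and inj: "\<And>h. frechet_derivative f (at p) h = 0 \<Longrightarrow> h = 0"
  obtains U' V g where "open U'" "open V" "p \<in> U'" "f p \<in> V" "U' \<subseteq> U" "homeomorphism U' V f g"
    "holomorphic3_on f U'" "holomorphic3_on g V"
proof -
  obtain D where D: "\<And>p. p \<in> U \<Longrightarrow> (f has_derivative blinfun_apply (D p)) (at p)"
    "\<And>p c h. p \<in> U \<Longrightarrow> blinfun_apply (D p) (c *s h) = c *s blinfun_apply (D p) h"
    "continuous_on U D"
    by (rule holomorphic3_derivative[OF U(1) f]) (rule that)
  have "inj (blinfun_apply (D p))"
    unfolding linear_injective_0[OF bounded_linear.linear[OF blinfun.bounded_linear_right]]
    using inj frechet_derivative_at[OF D(1)[OF U(2)]] by simp
  then obtain g' where g': "linear g'" "g' \<circ> blinfun_apply (D p) = id"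
    using linear_injective_left_inverse[OF bounded_linear.linear[OF blinfun.bounded_linear_right]] by blast
  have "blinfun_apply (Blinfun g') = g'"
    by (rule bounded_linear_Blinfun_apply) (use g' linear_conv_bounded_linear in blast)
  then have inv: "Blinfun g' o\<^sub>L D p = id_blinfun"
    using g'(2) by (intro blinfun_eqI) (simp add: fun_eq_iff)
  obtain U' V g g2 where *: "open U'" "U' \<subseteq> U" "p \<in> U'" "open V" "f p \<in> V" "homeomorphism U' V f g"
    and g2: "\<And>y. y \<in> V \<Longrightarrow> (g has_derivative (g2 y)) (at y)"
    "\<And>y. y \<in> V \<Longrightarrow> g2 y = inv (blinfun_apply (D (g y)))"
    "\<And>y. y \<in> V \<Longrightarrow> bij (blinfun_apply (D (g y)))"
    by (rule inverse_function_theorem[OF U(1) D(1) D(3) U(2) inv]) (assumption, rule that)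
  have "holomorphic3_on g V"
    unfolding holomorphic3_on_def
  proof (intro ballI exI conjI)
    fix y assume y: "y \<in> V"
    show "(g has_derivative (g2 y)) (at y)" by (rule g2(1)[OF y])
    have gy: "g y \<in> U" using y * by (metis homeomorphism_def imageI subsetD)
    have s: "g2 y (c *s h) = c *s g2 y h" for c h
    proof -
      have "blinfun_apply (D (g y)) (c *s g2 y h) = c *s h"
        using D(2)[OF gy] g2(2,3)[OF y] by (simp add: bij_is_surj surj_f_inv_f)
      then show ?thesis
        using g2(2,3)[OF y] by (metis bij_is_inj inv_f_f)
    qed
    show "Vector_Spaces.linear (*s) (*s) (g2 y)"
      unfolding linear_vec_complex_iff
      using s linear_add[OF has_derivative_linear[OF g2(1)[OF y]]] by blast
  qed
  moreover have "holomorphic3_on f U'" by (rule holomorphic3_on_subset[OF f *(2)])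
  ultimately show thesis by (intro that[OF *(1,4,3,5,2,6)])
qed

lemma locally_analytically_equivalentI:
  assumes U: "open U" "p \<in> U" and f: "holomorphic3_on f U"
    and inj: "\<And>h. frechet_derivative f (at p) h = 0 \<Longrightarrow> h = 0"
    and eq: "\<And>x. x \<in> U \<Longrightarrow> x \<in> S \<longleftrightarrow> f x \<in> T"
  shows "locally_analytically_equivalent S p T (f p)"
proof -
  obtain U' V g where *: "open U'" "open V" "p \<in> U'" "f p \<in> V" "U' \<subseteq> U" "homeomorphism U' V f g"
    "holomorphic3_on f U'" "holomorphic3_on g V"
    by (rule local_biholomorphism[OF U f]) (erule inj, (rule that; assumption))
  have "f ` (S \<inter> U') = T \<inter> V"
    using *(5,6) eq unfolding homeomorphism_def by (auto simp: image_iff)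
  then show ?thesis unfolding locally_analytically_equivalent_def using * by blast
qed

lemma locally_analytically_equivalent_sym:
  assumes "locally_analytically_equivalent S p T q"
  shows "locally_analytically_equivalent T q S p"
proof -
  obtain U V f g where *: "open U" "open V" "p \<in> U" "q \<in> V" "homeomorphism U V f g"
    "holomorphic3_on f U" "holomorphic3_on g V" "f p = q" "f ` (S \<inter> U) = T \<inter> V"
    using assms unfolding locally_analytically_equivalent_def by blast
  have "g ` (T \<inter> V) = S \<inter> U"
  proof -
    have "g ` (f ` (S \<inter> U)) = S \<inter> U"
      using *(5) unfolding homeomorphism_def by (force simp: image_iff)
    then show ?thesis using *(9) by simp
  qed
  moreover have "g q = p" using *(3,5,8) unfolding homeomorphism_def by auto
  ultimately show ?thesis
    unfolding locally_analytically_equivalent_def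
    using *(2,1,4,3) homeomorphism_symD[OF *(5)] *(7,6) by blast
qed

lemma locally_analytically_equivalent_trans:
  assumes "locally_analytically_equivalent S p T q" "locally_analytically_equivalent T q R r"
  shows "locally_analytically_equivalent S p R r"
proof -
  obtain U V f g where *: "open U" "open V" "p \<in> U" "q \<in> V" "homeomorphism U V f g"
    "holomorphic3_on f U" "holomorphic3_on g V" "f p = q" "f ` (S \<inter> U) = T \<inter> V"
    using assms unfolding locally_analytically_equivalent_def by blast
  obtain U2 V2 f2 g2 where **: "open U2" "open V2" "q \<in> U2" "r \<in> V2" "homeomorphism U2 V2 f2 g2"
    "holomorphic3_on f2 U2" "holomorphic3_on g2 V2" "f2 q = r" "f2 ` (T \<inter> U2) = R \<inter> V2"
    using assms unfolding locally_analytically_equivalent_def by blast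
  define W where "W = V \<inter> U2"
  have W: "open W" "W \<subseteq> V" "W \<subseteq> U2" "q \<in> W" using * ** by (auto simp: W_def)
  have gg: "\<And>y. y \<in> V \<Longrightarrow> f (g y) = y \<and> g y \<in> U" "\<And>x. x \<in> U \<Longrightarrow> g (f x) = x"
    "\<And>x. x \<in> U2 \<Longrightarrow> g2 (f2 x) = x \<and> f2 x \<in> V2"
    using *(5) **(5) unfolding homeomorphism_def by auto
  have gW: "g ` W \<subseteq> U" and f2W: "f2 ` W \<subseteq> V2"
    using W gg by auto
  have fgW: "f ` g ` W = W" using gg(1) W(2) by (force simp: image_image)
  have h1: "homeomorphism (g ` W) W f g"
    by (rule homeomorphism_of_subsets[OF *(5) gW W(2) fgW])
  have h2: "homeomorphism W (f2 ` W) f2 g2"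
    using homeomorphism_of_subsets[OF **(5), of W] W f2W by blast
  have op1: "open (g ` W)"
  proof -
    have "g ` W = U \<inter> f -` W"
    proof (intro equalityI subsetI)
      fix x assume "x \<in> U \<inter> f -` W"
      then show "x \<in> g ` W" using gg(2) by (metis IntD1 IntD2 imageI vimageD)
    qed (use W(2) gg(1) gW in auto)
    then show ?thesis
      using continuous_open_preimage[of U f W] *(1,5) W(1) by (simp add: homeomorphism_def)
  qed
  have op2: "open (f2 ` W)"
  proof -
    have "f2 ` W = V2 \<inter> g2 -` W"
    proof (intro equalityI subsetI)
      fix y assume "y \<in> V2 \<inter> g2 -` W"
      then show "y \<in> f2 ` W" using **(5) unfolding homeomorphism_def by (metis IntD1 IntD2 imageI vimageD)
    qed (use W(3) gg(3) in auto)
    then show ?thesis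
      using continuous_open_preimage[of V2 g2 W] **(2,5) W(1) by (simp add: homeomorphism_def)
  qed
  have st: "x \<in> S \<longleftrightarrow> f x \<in> T" if "x \<in> U" for x
  proof
    assume "x \<in> S"
    then have "f x \<in> f ` (S \<inter> U)" using that by blast
    then show "f x \<in> T" using *(9) by simp
  next
    assume "f x \<in> T"
    moreover have "f x \<in> V" using that *(5) by (auto simp: homeomorphism_def)
    ultimately have "f x \<in> f ` (S \<inter> U)" using *(9) by simp
    then obtain x' where "x' \<in> S" "x' \<in> U" "f x = f x'" by blast
    moreover from this have "x = x'" using arg_cong[of "f x" "f x'" g] gg(2) that by metis
    ultimately show "x \<in> S" by blast
  qed
  have tr: "y \<in> T \<longleftrightarrow> f2 y \<in> R" if "y \<in> U2" for y
  proof
    assume "y \<in> T"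
    then have "f2 y \<in> f2 ` (T \<inter> U2)" using that by blast
    then show "f2 y \<in> R" using **(9) by simp
  next
    assume "f2 y \<in> R"
    then have "f2 y \<in> f2 ` (T \<inter> U2)" using **(9) gg(3) that by simp
    then obtain y' where "y' \<in> T" "y' \<in> U2" "f2 y = f2 y'" by blast
    moreover from this have "y = y'" using arg_cong[of "f2 y" "f2 y'" g2] gg(3) that by metis
    ultimately show "y \<in> T" by blast
  qed
  have wW: "g w \<in> S \<longleftrightarrow> f2 w \<in> R" "f (g w) = w" if "w \<in> W" for w
  proof -
    have w: "w \<in> V" "w \<in> U2" using that W(2,3) by auto
    show "f (g w) = w" using gg(1)[OF w(1)] by simp
    then show "g w \<in> S \<longleftrightarrow> f2 w \<in> R"
      using st[of "g w"] tr[OF w(2)] gg(1)[OF w(1)] by simp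
  qed
  have img: "(f2 \<circ> f) ` (S \<inter> g ` W) = R \<inter> f2 ` W"
  proof (intro equalityI subsetI)
    fix y assume "y \<in> (f2 \<circ> f) ` (S \<inter> g ` W)"
    then obtain w where w: "w \<in> W" "g w \<in> S" "y = f2 (f (g w))" by auto
    then show "y \<in> R \<inter> f2 ` W" unfolding w(3) wW(2)[OF w(1)] using wW(1)[OF w(1)] by blast
  next
    fix y assume "y \<in> R \<inter> f2 ` W"
    then obtain w where w: "w \<in> W" "f2 w \<in> R" "y = f2 w" by auto
    then have "g w \<in> S \<inter> g ` W" using wW(1) by blast
    moreover have "y = (f2 \<circ> f) (g w)" using w wW(2)[OF w(1)] by simp
    ultimately show "y \<in> (f2 \<circ> f) ` (S \<inter> g ` W)" by (rule rev_image_eqI)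
  qed
  show ?thesis
    unfolding locally_analytically_equivalent_def
  proof (intro exI conjI)
    show "open (g ` W)" "open (f2 ` W)" by fact+
    show "p \<in> g ` W" using *(8) W(4) gg(2)[OF *(3)] by (metis imageI)
    show "r \<in> f2 ` W" using **(8) W(4) by auto
    show "homeomorphism (g ` W) (f2 ` W) (f2 \<circ> f) (g \<circ> g2)" by (rule homeomorphism_compose[OF h1 h2])
    show "holomorphic3_on (f2 \<circ> f) (g ` W)"
      by (rule holomorphic3_on_compose[OF holomorphic3_on_subset[OF *(6) gW] **(6)]) (use fgW W(3) in simp)
    show "holomorphic3_on (g \<circ> g2) (f2 ` W)"
      by (rule holomorphic3_on_compose[OF holomorphic3_on_subset[OF **(7) f2W] *(7)])
        (use h2 W(2) in \<open>simp add: homeomorphism_def\<close>)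
    show "(f2 \<circ> f) p = r" using *(8) **(8) by simp
  qed (rule img)
qed

section \<open>The singularities of type A are pairwise inequivalent\<close>

text \<open>Near \<open>p\<close> the derivative has norm at most \<open>norm (D p) + 1\<close>, and
  the mean value inequality on a ball does the rest. Applied to both directions of an equivalence it
  makes distances comparable up to constants.\<close>

lemma holomorphic3_locally_lipschitz:
  assumes U: "open U" "p \<in> U" and f: "holomorphic3_on f U"
  obtains K r where "K > 0" "r > 0" "ball p r \<subseteq> U"
    "\<And>x y. x \<in> ball p r \<Longrightarrow> y \<in> ball p r \<Longrightarrow> norm (f x - f y) \<le> K * norm (x - y)"
proof -
  obtain D where D: "\<And>p. p \<in> U \<Longrightarrow> (f has_derivative blinfun_apply (D p)) (at p)"
    "\<And>p c h. p \<in> U \<Longrightarrow> blinfun_apply (D p) (c *s h) = c *s blinfun_apply (D p) h"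
    "continuous_on U D"
    by (rule holomorphic3_derivative[OF U(1) f]) (rule that)
  have "isCont D p" using D(3) U continuous_on_eq_continuous_at by blast
  then obtain d where d: "d > 0" "\<And>x. dist x p < d \<Longrightarrow> dist (D x) (D p) < 1"
    unfolding continuous_at_eps_delta by (meson zero_less_one)
  obtain e where e: "e > 0" "ball p e \<subseteq> U" using U open_contains_ball by blast
  define r where "r = min d e"
  have r: "r > 0" "ball p r \<subseteq> U" using d e by (auto simp: r_def)
  have bd: "onorm (blinfun_apply (D x)) \<le> norm (D p) + 1" if "x \<in> ball p r" for x
  proof -
    have "dist (D x) (D p) < 1" using that by (intro d(2)) (auto simp: r_def dist_commute)
    then have "norm (D x) \<le> norm (D p) + 1"
      using norm_triangle_ineq2[of "D x" "D p"] by (simp add: dist_norm)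
    then show ?thesis by (simp add: norm_blinfun.rep_eq)
  qed
  have "norm (f x - f y) \<le> (norm (D p) + 1) * norm (x - y)" if "x \<in> ball p r" "y \<in> ball p r" for x y
  proof (rule differentiable_bound[of "ball p r" f "\<lambda>x. blinfun_apply (D x)"])
    show "(f has_derivative blinfun_apply (D x)) (at x within ball p r)" if "x \<in> ball p r" for x
      using D(1)[of x] r(2) that has_derivative_at_withinI by blast
  qed (use that bd in auto)
  moreover have "norm (D p) + 1 > 0" by (simp add: add_nonneg_pos)
  ultimately show thesis using that r by blast
qed

text \<open>The index is the exponent, so type A_\<nu> corresponds to
  \<open>A_cone (\<nu> + 1)\<close>. The product form makes the surface a cyclic quotient of the
  plane.\<close>

definition A_cone :: "nat \<Rightarrow> (complex^3) set" where
  "A_cone n = {p. p$1 * p$2 + p$3 ^ n = 0}"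

text \<open>The linear coordinates \<open>X + \<i> Y\<close> and \<open>X - \<i> Y\<close> factor
  the sum of two squares.\<close>

lemma A_normal_form_equivalent:
  "locally_analytically_equivalent
     (zero_set (\<lambda>z. (z$1)^2 + (z$2)^2 + (z$3)^n)) 0 (A_cone n) 0"
proof -
  define f :: "complex^3 \<Rightarrow> complex^3" where
    "f = (\<lambda>p. vector [p$1 + \<i> * p$2, p$1 - \<i> * p$2, p$3])"
  have lin: "linear f"
    by (rule linearI) (auto simp: f_def vec_eq_iff forall_3 algebra_simps)
  then have "(f has_derivative f) (at 0)"
    by (simp add: linear_conv_bounded_linear bounded_linear_imp_has_derivative)
  then have fr: "frechet_derivative f (at 0) = f" by (metis frechet_derivative_at)
  have "holomorphic3_on f UNIV"
  proof (rule holomorphic3_onI)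
    show "cdiff (\<lambda>x. f x $ i) p" for p i
      using exhaust_3[of i] by (auto simp: f_def intro!: cdiff_intros)
  qed
  moreover have "h = 0" if "f h = 0" for h
    using that by (auto simp: f_def vec_eq_iff forall_3 algebra_simps)
  moreover have "x \<in> zero_set (\<lambda>z. (z$1)^2 + (z$2)^2 + (z$3)^n) \<longleftrightarrow> f x \<in> A_cone n" for x
    by (simp add: f_def A_cone_def zero_set_def algebra_simps power2_eq_square)
  ultimately have "locally_analytically_equivalent
     (zero_set (\<lambda>z. (z$1)^2 + (z$2)^2 + (z$3)^n)) 0 (A_cone n) (f 0)"
    by (intro locally_analytically_equivalentI[of UNIV]) (auto simp: fr)
  then show ?thesis using linear_0[OF lin] by simp
qed

lemma complex_root_exists: "n > 0 \<Longrightarrow> \<exists>a::complex. a ^ n = c"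
  by (metis exp_Ln exp_of_nat_mult of_nat_0_eq_iff less_numeral_extra(3) nonzero_mult_div_cancel_left
      power_0_left times_divide_eq_right zero_power)

text \<open>This is the quotient map of the plane by the cyclic group of order \<open>n\<close>.
  Where \<open>a\<close> is nonzero, \<open>b\<close> has to be the third coordinate divided by
  \<open>a\<close>; where \<open>a = 0\<close> the third coordinate vanishes and \<open>b\<close> is
  a root of minus the second.\<close>

lemma A_cone_param:
  assumes "p \<in> A_cone n" "n > 0"
  obtains a b where "p = vector [a ^ n, - (b ^ n), a * b]"
proof -
  obtain a where a: "a ^ n = p$1" using complex_root_exists[OF assms(2)] by blast
  show thesis
  proof (cases "a = 0")
    case True
    obtain b where b: "b ^ n = - p$2" using complex_root_exists[OF assms(2)] by blast
    have "p$1 = 0" using True a assms(2) by (metis zero_power)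
    then have "p$3 = 0" using assms by (auto simp: A_cone_def)
    then have "p = vector [a ^ n, - (b ^ n), a * b]"
      using a b True assms by (simp add: vec_eq_iff forall_3)
    then show ?thesis by (rule that)
  next
    case False
    have e: "a ^ n * p$2 = - (p$3 ^ n)" using assms a by (simp add: A_cone_def add_eq_0_iff)
    have "- ((p$3 / a) ^ n) = p$2"
      using False e by (simp add: power_divide field_simps)
    then have "p = vector [a ^ n, - ((p$3 / a) ^ n), a * (p$3 / a)]"
      using a False by (simp add: vec_eq_iff forall_3)
    then show ?thesis by (rule that)
  qed
qed

text \<open>The gradient of the equation is, up to a factor, the only covector annihilating the two
  velocity vectors of \<open>(a, b) \<mapsto> (a\<^sup>n, - b\<^sup>n, a b)\<close>, so the pulled back gradient is
  proportional to it.\<close>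

lemma A_cone_conormal:
  assumes U: "open U" "p \<in> U" "p \<in> A_cone n" "n \<ge> 1"
    and f: "(f has_derivative D) (at p)" "\<And>c h. D (c *s h) = c *s D h"
    and sub: "\<And>x. x \<in> U \<Longrightarrow> x \<in> A_cone n \<Longrightarrow> f x \<in> A_cone N"
  defines "G \<equiv> \<lambda>x. vector [x$2, x$1, of_nat n * x$3 ^ (n - 1)] :: complex^3"
  defines "c \<equiv> \<lambda>j. f p $ 2 * D (axis j 1) $ 1 + f p $ 1 * D (axis j 1) $ 2
                     + of_nat N * f p $ 3 ^ (N - 1) * D (axis j 1) $ 3"
  shows "c i * G p $ j = c j * G p $ i"
proof -
  \<comment> \<open>\<open>C\<close> is the differential at \<open>p\<close> of the pulled-back
    equation of \<open>A_cone N\<close>, with components \<open>c j\<close>. It kills the velocity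
    of every curve through \<open>p\<close> inside \<open>A_cone n\<close>, since the pulled-back
    equation vanishes along the curve near \<open>p\<close>.\<close>
  define C where "C = (\<lambda>h. f p $ 2 * D h $ 1 + f p $ 1 * D h $ 2
                     + of_nat N * f p $ 3 ^ (N - 1) * D h $ 3)"
  have linD: "linear D" using f(1) by (rule has_derivative_linear)
  have C0: "C v = 0"
    if \<phi>: "(\<phi> has_derivative (\<lambda>t. t *s v)) (at (0::complex))" "\<phi> 0 = p" "\<And>t. \<phi> t \<in> A_cone n" for \<phi> v
  proof -
    have 1: "((\<lambda>t. f (\<phi> t)) has_derivative (\<lambda>t. D (t *s v))) (at 0)"
      using has_derivative_compose[OF \<phi>(1)] f(1) \<phi>(2) by simp
    have nth: "((\<lambda>t. f (\<phi> t) $ i) has_derivative (\<lambda>t. D (t *s v) $ i)) (at 0)" for i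
      by (rule has_derivative_vec_nth_iff[THEN iffD1, OF 1, rule_format])
    have 2: "((\<lambda>t. f (\<phi> t) $ 1 * f (\<phi> t) $ 2 + f (\<phi> t) $ 3 ^ N) has_derivative (\<lambda>t. C (t *s v))) (at 0)"
      by (rule has_derivative_eq_rhs, (rule derivative_intros nth)+)
        (auto simp: C_def \<phi>(2) algebra_simps fun_eq_iff)
    have "\<forall>\<^sub>F t in nhds 0. \<phi> t \<in> U"
      using has_derivative_continuous[OF \<phi>(1)] U \<phi>(2)
      by (auto simp: continuous_within dest!: topological_tendstoD intro!: eventually_nhds_conv_at[THEN iffD2])
    then have "\<forall>\<^sub>F t in nhds 0. f (\<phi> t) $ 1 * f (\<phi> t) $ 2 + f (\<phi> t) $ 3 ^ N = 0"
      by eventually_elim (use sub \<phi>(3) in \<open>auto simp: A_cone_def\<close>)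
    then have ev: "\<forall>\<^sub>F t in nhds 0. 0 = f (\<phi> t) $ 1 * f (\<phi> t) $ 2 + f (\<phi> t) $ 3 ^ N"
      by eventually_elim simp
    have "((\<lambda>t. f (\<phi> t) $ 1 * f (\<phi> t) $ 2 + f (\<phi> t) $ 3 ^ N) has_derivative (\<lambda>t. 0)) (at 0)"
      by (rule has_derivative_transform_eventually[OF has_derivative_const])
        (use ev eventually_nhds_x_imp_x[OF ev] in \<open>auto simp: eventually_nhds_conv_at\<close>)
    from has_derivative_unique[OF 2 this] have "C (1 *s v) = 0" by metis
    then show ?thesis by simp
  qed
  have CC: "C h = h$1 * c 1 + h$2 * c 2 + h$3 * c 3" for h
  proof -
    have "h = h$1 *s axis 1 1 + h$2 *s axis 2 1 + h$3 *s axis 3 1"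
      by (simp add: vec_eq_iff forall_3 axis_def)
    then have "D h = h$1 *s D (axis 1 1) + h$2 *s D (axis 2 1) + h$3 *s D (axis 3 1)"
      using linear_add[OF linD] f(2) by metis
    then show ?thesis by (simp add: C_def c_def algebra_simps)
  qed
  obtain a b where ab: "p = vector [a ^ n, - (b ^ n), a * b]" using A_cone_param U by (metis less_eq_Suc_le One_nat_def)
  obtain k where k: "n = Suc k" using U(4) by (cases n) auto
  then have k': "n - Suc 0 = k" by simp
  have "C (vector [of_nat n * a ^ k, 0, b]) = 0"
  proof (rule C0)
    show "((\<lambda>t. vector [(a + t) ^ n, - (b ^ n), (a + t) * b] :: complex^3) has_derivative
      (\<lambda>t. t *s vector [of_nat n * a ^ k, 0, b])) (at (0::complex))"
      by (rule has_derivative_vec_nth_iff[THEN iffD2], unfold forall_3)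
        (auto simp: k' fun_eq_iff algebra_simps intro!: derivative_eq_intros)
  qed (auto simp: ab A_cone_def power_mult_distrib)
  then have e1: "of_nat n * a ^ k * c 1 + b * c 3 = 0" by (simp add: CC)
  have "C (vector [0, - (of_nat n * b ^ k), a]) = 0"
  proof (rule C0)
    show "((\<lambda>t. vector [a ^ n, - ((b + t) ^ n), a * (b + t)] :: complex^3) has_derivative
      (\<lambda>t. t *s vector [0, - (of_nat n * b ^ k), a])) (at (0::complex))"
      by (rule has_derivative_vec_nth_iff[THEN iffD2], unfold forall_3)
        (auto simp: k' fun_eq_iff algebra_simps intro!: derivative_eq_intros)
  qed (auto simp: ab A_cone_def power_mult_distrib)
  then have e2: "a * c 3 = of_nat n * b ^ k * c 2" by (simp add: CC algebra_simps)
  have n0: "of_nat n \<noteq> (0::complex)" using U(4) by simp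
  \<comment> \<open>The minors of \<open>c\<close> against the gradient come from \<open>e1\<close>
    and \<open>e2\<close> by multiplying with powers of \<open>a\<close> and \<open>b\<close>;
    nothing is divided by \<open>a\<close> or \<open>b\<close>, so vanishing parameters form no
    separate case.\<close>
  have "of_nat n * (c 1 * a ^ n + c 2 * b ^ n) = a * (of_nat n * a ^ k * c 1) + b * (of_nat n * b ^ k * c 2)"
    by (simp add: k algebra_simps)
  also have "\<dots> = a * (of_nat n * a ^ k * c 1 + b * c 3)" unfolding e2[symmetric] by (simp add: algebra_simps)
  finally have r12: "c 1 * a ^ n + c 2 * b ^ n = 0" using n0 e1 by simp
  have "c 1 * (of_nat n * (a * b) ^ k) + c 3 * b ^ n = b ^ k * (of_nat n * a ^ k * c 1 + b * c 3)"
    by (simp add: k power_mult_distrib algebra_simps)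
  then have r13: "c 1 * (of_nat n * (a * b) ^ k) + c 3 * b ^ n = 0" using e1 by simp
  have "c 2 * (of_nat n * (a * b) ^ k) = a ^ k * (of_nat n * b ^ k * c 2)"
    by (simp add: power_mult_distrib algebra_simps)
  then have r23: "c 2 * (of_nat n * (a * b) ^ k) = c 3 * a ^ n" unfolding e2[symmetric] by (simp add: k algebra_simps)
  have "c 1 * G p $ 2 = c 2 * G p $ 1" "c 1 * G p $ 3 = c 3 * G p $ 1" "c 2 * G p $ 3 = c 3 * G p $ 2"
    using r12 r13 r23 by (simp_all add: G_def ab k add_eq_0_iff2)
  then show ?thesis using exhaust_3[of i] exhaust_3[of j] by auto
qed

text \<open>Let \<open>a\<close> and \<open>b\<close> be the first two rows of the derivative of
  \<open>f\<close> at 0. The conormals at the two points of a pair, divided by \<open>t^N\<close>,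
  pull back to \<open>u\<close> and \<open>v\<close>, which tend to \<open>b - a\<close> and
  \<open>2 b - a / 2\<close>. On \<open>A_cone n\<close> they are proportional to nearly parallel
  gradients, so the limits are proportional, and hence so are \<open>a\<close> and \<open>b\<close>,
  against surjectivity of the derivative.\<close>

lemma A_cone_inequiv:
  assumes n: "2 \<le> n" "n < N"
  shows "\<not> locally_analytically_equivalent (A_cone n) 0 (A_cone N) 0"
proof
  assume "locally_analytically_equivalent (A_cone n) 0 (A_cone N) 0"
  then obtain U V f g where *: "open U" "open V" "0 \<in> U" "0 \<in> V" "homeomorphism U V f g"
    "holomorphic3_on f U" "holomorphic3_on g V" "f 0 = 0" "f ` (A_cone n \<inter> U) = A_cone N \<inter> V"
    unfolding locally_analytically_equivalent_def by blast
  have gg: "\<And>y. y \<in> V \<Longrightarrow> f (g y) = y" "\<And>y. y \<in> V \<Longrightarrow> g y \<in> U" "\<And>x. x \<in> U \<Longrightarrow> g (f x) = x"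
    "\<And>x. x \<in> U \<Longrightarrow> f x \<in> V"
    using *(5) unfolding homeomorphism_def by auto
  have g0: "g 0 = 0" using gg(3)[OF *(3)] *(8) by simp
  have sub: "f x \<in> A_cone N" if "x \<in> U" "x \<in> A_cone n" for x
    using *(9) that by blast
  have sub': "g y \<in> A_cone n" if y: "y \<in> V" "y \<in> A_cone N" for y
  proof -
    have "y \<in> f ` (A_cone n \<inter> U)" using *(9) y by blast
    then obtain x where x: "x \<in> A_cone n" "x \<in> U" "y = f x" by blast
    then show ?thesis using gg(3)[OF x(2)] by simp
  qed
  obtain D where D: "\<And>p. p \<in> U \<Longrightarrow> (f has_derivative blinfun_apply (D p)) (at p)"
    "\<And>p c h. p \<in> U \<Longrightarrow> blinfun_apply (D p) (c *s h) = c *s blinfun_apply (D p) h"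
    "continuous_on U D"
    by (rule holomorphic3_derivative[OF *(1,6)]) (rule that)
  have Dcont: "isCont D 0" using D(3) *(1,3) continuous_on_eq_continuous_at by blast
  have gcont: "isCont g 0"
    using holomorphic3_on_continuous_on[OF *(7)] *(2,4) continuous_on_eq_continuous_at by blast
  \<comment> \<open>Divided by \<open>t^N\<close>, the gradients of \<open>A_cone N\<close> at
    \<open>P t\<close> and \<open>Q t\<close> tend to \<open>(-1, 1, 0)\<close> and
    \<open>(-1/2, 2, 0)\<close>: their third entry is of order \<open>t^(N-2)\<close>, and
    \<open>N\<close> is at least 3.\<close>
  define P :: "real \<Rightarrow> complex^3" where
    "P = (\<lambda>t. vector [of_real (t ^ N), - of_real (t ^ N), of_real (t ^ 2)])"
  define Q :: "real \<Rightarrow> complex^3" where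
    "Q = (\<lambda>t. vector [2 * of_real (t ^ N), - (of_real (t ^ N) / 2), of_real (t ^ 2)])"
  have PA: "P t \<in> A_cone N" "Q t \<in> A_cone N" for t
    by (auto simp: A_cone_def P_def Q_def power2_eq_square power_mult_distrib)
  let ?F = "at_right (0::real)"
  have pow0: "((\<lambda>t. complex_of_real (t ^ k)) \<longlongrightarrow> 0) ?F" if "k > 0" for k
  proof -
    have "((\<lambda>t. complex_of_real (t ^ k)) \<longlongrightarrow> complex_of_real (0 ^ k)) ?F"
      by (intro tendsto_intros)
    then show ?thesis using that by (simp add: zero_power)
  qed
  have N0: "N > 0" using n by simp
  have lP: "(P \<longlongrightarrow> 0) ?F"
  proof (rule vec_tendstoI)
    show "((\<lambda>t. P t $ i) \<longlongrightarrow> 0 $ i) ?F" for i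
      using exhaust_3[of i] tendsto_minus[OF pow0[OF N0]] pow0[OF N0] pow0[of 2] by (auto simp: P_def)
  qed
  have lQ: "(Q \<longlongrightarrow> 0) ?F"
  proof (rule vec_tendstoI)
    have "((\<lambda>t. 2 * complex_of_real (t ^ N)) \<longlongrightarrow> 2 * 0) ?F"
      "((\<lambda>t. - (complex_of_real (t ^ N) / 2)) \<longlongrightarrow> - (0 / 2)) ?F"
      by (intro tendsto_intros pow0[OF N0]; simp)+
    then show "((\<lambda>t. Q t $ i) \<longlongrightarrow> 0 $ i) ?F" for i
      using exhaust_3[of i] pow0[of 2] by (auto simp: Q_def)
  qed
  define p where "p = (\<lambda>t. g (P t))"
  define q where "q = (\<lambda>t. g (Q t))"
  have lp: "(p \<longlongrightarrow> 0) ?F" and lq: "(q \<longlongrightarrow> 0) ?F"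
    using isCont_tendsto_compose[OF gcont lP] isCont_tendsto_compose[OF gcont lQ] g0
    by (auto simp: p_def q_def)
  have lDp: "((\<lambda>t. D (p t)) \<longlongrightarrow> D 0) ?F" and lDq: "((\<lambda>t. D (q t)) \<longlongrightarrow> D 0) ?F"
    by (rule isCont_tendsto_compose[OF Dcont lp], rule isCont_tendsto_compose[OF Dcont lq])
  define a where "a = (\<lambda>j. blinfun_apply (D 0) (axis j 1) $ 1)"
  define b where "b = (\<lambda>j. blinfun_apply (D 0) (axis j 1) $ 2)"
  define u where "u = (\<lambda>t j. - blinfun_apply (D (p t)) (axis j 1) $ 1 + blinfun_apply (D (p t)) (axis j 1) $ 2
     + of_nat N * of_real (t ^ (N - 2)) * blinfun_apply (D (p t)) (axis j 1) $ 3)"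
  define v where "v = (\<lambda>t j. - blinfun_apply (D (q t)) (axis j 1) $ 1 / 2 + 2 * blinfun_apply (D (q t)) (axis j 1) $ 2
     + of_nat N * of_real (t ^ (N - 2)) * blinfun_apply (D (q t)) (axis j 1) $ 3)"
  have t0: "((\<lambda>t. complex_of_real (t ^ (N - 2))) \<longlongrightarrow> 0) ?F" using pow0[of "N - 2"] n by simp
  have lu: "((\<lambda>t. u t j) \<longlongrightarrow> b j - a j) ?F" for j
  proof -
    have "((\<lambda>t. u t j) \<longlongrightarrow> - a j + b j + of_nat N * 0 * blinfun_apply (D 0) (axis j 1) $ 3) ?F"
      unfolding u_def a_def b_def by (intro tendsto_intros lDp t0)
    then show ?thesis by simp
  qed
  have lv: "((\<lambda>t. v t j) \<longlongrightarrow> 2 * b j - a j / 2) ?F" for j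
  proof -
    have "((\<lambda>t. v t j) \<longlongrightarrow> - a j / 2 + 2 * b j + of_nat N * 0 * blinfun_apply (D 0) (axis j 1) $ 3) ?F"
      unfolding v_def a_def b_def by (intro tendsto_intros lDq t0) simp_all
    then show ?thesis by simp
  qed
  define G where "G = (\<lambda>x::complex^3. vector [x$2, x$1, of_nat n * x$3 ^ (n - 1)] :: complex^3)"
  obtain K r where Kr: "K > 0" "r > 0" "ball 0 r \<subseteq> V"
    "\<And>x y. x \<in> ball 0 r \<Longrightarrow> y \<in> ball 0 r \<Longrightarrow> norm (g x - g y) \<le> K * norm (x - y)"
    by (rule holomorphic3_locally_lipschitz[OF *(2,4,7)]) (rule that)
  obtain K' r' where Kr': "K' > 0" "r' > 0" "ball 0 r' \<subseteq> U"
    "\<And>x y. x \<in> ball 0 r' \<Longrightarrow> y \<in> ball 0 r' \<Longrightarrow> norm (f x - f y) \<le> K' * norm (x - y)"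
    by (rule holomorphic3_locally_lipschitz[OF *(1,3,6)]) (rule that)
  \<comment> \<open>Chosen for the bound \<open>m t \<ge> \<kappa> * t ^ n\<close>; the two entries
    of the minimum serve the cases where the third coordinate of \<open>p t\<close> is large or
    small compared with \<open>t^2 / (2 * K')\<close>.\<close>
  define \<kappa> where "\<kappa> = min (sqrt ((1 / (2 * K')) ^ n)) (1 / (4 * K'))"
  have \<kappa>: "\<kappa> > 0" using Kr' by (simp add: \<kappa>_def)
  have ev: "\<forall>\<^sub>F t in ?F. t < 1 \<and> P t \<in> ball 0 r \<and> Q t \<in> ball 0 r \<and> p t \<in> ball 0 (min 1 r') \<and> q t \<in> ball 0 (min 1 r')"
  proof -
    have B: "\<forall>\<^sub>F t in ?F. h t \<in> ball 0 s" if "(h \<longlongrightarrow> 0) ?F" "s > 0" for h :: "real \<Rightarrow> complex^3" and s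
      using tendstoD[OF that] by (simp add: dist_commute)
    have "\<forall>\<^sub>F t in ?F. t < 1" by (rule eventually_at_right_real[THEN eventually_mono, of 0 1]) auto
    then show ?thesis
      using B[OF lP Kr(2)] B[OF lQ Kr(2)] B[OF lp, of "min 1 r'"] B[OF lq, of "min 1 r'"] Kr'(2)
      by (simp add: eventually_conj_iff)
  qed
  have pos: "\<forall>\<^sub>F t in ?F. 0 < t" by (simp add: eventually_at_right_less)
  define m where "m = (\<lambda>t. max (norm (p t $ 1)) (norm (p t $ 2)))"
  have fact: "m t \<ge> \<kappa> * t ^ n \<and> norm (p t - q t) \<le> 2 * K * t ^ N \<and>
      (\<forall>i j. u t i * G (p t) $ j = u t j * G (p t) $ i) \<and> (\<forall>i j. v t i * G (q t) $ j = v t j * G (q t) $ i)"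
    if t: "0 < t" "t < 1" "P t \<in> ball 0 r" "Q t \<in> ball 0 r" "p t \<in> ball 0 (min 1 r')" "q t \<in> ball 0 (min 1 r')" for t
  proof -
    have V: "P t \<in> V" "Q t \<in> V" using t Kr(3) by auto
    have U: "p t \<in> U" "q t \<in> U" using t Kr'(3) by auto
    have f: "f (p t) = P t" "f (q t) = Q t" using gg(1) V by (auto simp: p_def q_def)
    have A: "p t \<in> A_cone n" "q t \<in> A_cone n" using sub' V PA by (auto simp: p_def q_def)
    have "t ^ (2 * (N - 1)) = t ^ N * t ^ (N - 2)"
    proof -
      have "2 * (N - 1) = N + (N - 2)" using n by simp
      then show ?thesis by (simp only: power_add)
    qed
    from arg_cong[OF this, of complex_of_real]
    have tN: "(complex_of_real t)\<^sup>2 ^ (N - Suc 0) = complex_of_real t ^ N * complex_of_real t ^ (N - 2)"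
      by (simp add: power_mult[symmetric])
    \<comment> \<open>The third coordinate of \<open>P t\<close> is \<open>t^2\<close>, so the
      Lipschitz bound for \<open>f\<close> keeps \<open>p t\<close> at distance at least
      \<open>t^2 / K'\<close> from 0.\<close>
    have "norm (P t) = norm (f (p t) - f 0)" using f *(8) by simp
    also have "\<dots> \<le> K' * norm (p t)" using Kr'(4)[of "p t" 0] t Kr'(2) by simp
    finally have 1: "norm (P t) \<le> K' * norm (p t)" .
    have "t\<^sup>2 = norm (P t $ 3)" by (simp add: P_def norm_power)
    also have "\<dots> \<le> norm (P t)" by (rule Finite_Cartesian_Product.norm_nth_le)
    also have "\<dots> \<le> K' * norm (p t)" by (rule 1)
    also have "norm (p t) \<le> norm (p t $ 1) + norm (p t $ 2) + norm (p t $ 3)"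
      unfolding norm_vec_def using L2_set_le_sum[of UNIV "\<lambda>i. norm (p t $ i)"] by (simp add: sum_3)
    also have "\<dots> \<le> 2 * m t + norm (p t $ 3)" by (simp add: m_def)
    finally have 2: "t\<^sup>2 / K' \<le> 2 * m t + norm (p t $ 3)" using Kr'(1) by (simp add: field_simps)
    have m0: "m t \<ge> 0" by (simp add: m_def le_max_iff_disj)
    have "m t \<ge> \<kappa> * t ^ n"
    proof (cases "norm (p t $ 3) \<ge> t\<^sup>2 / (2 * K')")
      case True
      \<comment> \<open>On the cone the first two coordinates multiply in absolute value to the
        \<open>n\<close>-th power of the third, so the larger of them is at least the square root of
        that power.\<close>
      have "(t\<^sup>2 / (2 * K')) ^ n \<le> norm (p t $ 3) ^ n"
        using True Kr'(1) by (intro power_mono) auto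
      also have "\<dots> = norm (p t $ 1) * norm (p t $ 2)"
        using A(1) by (simp add: A_cone_def add_eq_0_iff2 norm_power[symmetric] norm_mult[symmetric])
      also have "\<dots> \<le> m t * m t" by (intro mult_mono) (auto simp: m_def le_max_iff_disj)
      finally have "(t\<^sup>2 / (2 * K')) ^ n \<le> (m t)\<^sup>2" by (simp add: power2_eq_square)
      moreover have "(t\<^sup>2 / (2 * K')) ^ n = (sqrt ((1 / (2 * K')) ^ n) * t ^ n)\<^sup>2"
        using Kr'(1) by (simp add: power_mult_distrib power_divide power_mult[symmetric] mult.commute)
      ultimately have "sqrt ((1 / (2 * K')) ^ n) * t ^ n \<le> m t"
        using power2_le_imp_le[OF _ m0] by simp
      moreover have "\<kappa> * t ^ n \<le> sqrt ((1 / (2 * K')) ^ n) * t ^ n"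
        using t by (intro mult_right_mono) (auto simp: \<kappa>_def)
      ultimately show ?thesis by linarith
    next
      case False
      then have "t\<^sup>2 / (4 * K') \<le> m t" using 2 Kr'(1) by (simp add: field_simps)
      moreover have "t ^ n \<le> t\<^sup>2" using t n by (intro power_decreasing) auto
      then have "\<kappa> * t ^ n \<le> 1 / (4 * K') * t\<^sup>2"
        using Kr'(1) t by (intro mult_mono) (auto simp: \<kappa>_def)
      ultimately show ?thesis by simp
    qed
    moreover have "norm (p t - q t) \<le> 2 * K * t ^ N"
    proof -
      have "norm (p t - q t) \<le> K * norm (P t - Q t)" unfolding p_def q_def using t by (intro Kr(4))
      also have "norm (P t - Q t) \<le> norm ((P t - Q t) $ 1) + norm ((P t - Q t) $ 2) + norm ((P t - Q t) $ 3)"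
        unfolding norm_vec_def using L2_set_le_sum[of UNIV "\<lambda>i. norm ((P t - Q t) $ i)"] by (simp add: sum_3)
      also have "\<dots> \<le> 2 * t ^ N"
      proof -
        have "P t $ 1 - Q t $ 1 = - of_real (t ^ N)" "P t $ 2 - Q t $ 2 = - of_real (t ^ N / 2)" "P t $ 3 - Q t $ 3 = 0"
          by (auto simp: P_def Q_def)
        then show ?thesis using t by (simp add: norm_power norm_divide)
      qed
      finally show ?thesis using Kr(1) by simp
    qed
    moreover have "u t i * G (p t) $ j = u t j * G (p t) $ i" for i j
    proof -
      have "complex_of_real (t ^ N) * u t i = f (p t) $ 2 * blinfun_apply (D (p t)) (axis i 1) $ 1 + f (p t) $ 1 * blinfun_apply (D (p t)) (axis i 1) $ 2
             + of_nat N * f (p t) $ 3 ^ (N - 1) * blinfun_apply (D (p t)) (axis i 1) $ 3" for i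
        by (simp add: f P_def u_def tN algebra_simps)
      then have "complex_of_real (t ^ N) * u t i * G (p t) $ j = complex_of_real (t ^ N) * u t j * G (p t) $ i"
        using A_cone_conormal[OF *(1) U(1) A(1) _ D(1)[OF U(1)] D(2)[OF U(1)] sub, of i j] n
        by (simp add: G_def)
      then show ?thesis using t by simp
    qed
    moreover have "v t i * G (q t) $ j = v t j * G (q t) $ i" for i j
    proof -
      have "complex_of_real (t ^ N) * v t i = f (q t) $ 2 * blinfun_apply (D (q t)) (axis i 1) $ 1 + f (q t) $ 1 * blinfun_apply (D (q t)) (axis i 1) $ 2
             + of_nat N * f (q t) $ 3 ^ (N - 1) * blinfun_apply (D (q t)) (axis i 1) $ 3" for i
        by (simp add: f Q_def v_def tN algebra_simps)
      then have "complex_of_real (t ^ N) * v t i * G (q t) $ j = complex_of_real (t ^ N) * v t j * G (q t) $ i"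
        using A_cone_conormal[OF *(1) U(2) A(2) _ D(1)[OF U(2)] D(2)[OF U(2)] sub, of i j] n
        by (simp add: G_def)
      then show ?thesis using t by simp
    qed
    ultimately show ?thesis by blast
  qed
  \<comment> \<open>The componentwise Lipschitz constant \<open>n^2\<close> of the gradient of
    \<open>A_cone n\<close> on the unit ball, times the factor \<open>2 * K\<close> of the distance,
    over the factor \<open>\<kappa>\<close> in the lower bound of the gradient.\<close>
  define C where "C = real n * real n * (2 * K) / \<kappa>"
  have Gdiff: "norm (G (p t) $ i - G (q t) $ i) \<le> real n * real n * norm (p t - q t)"
    if t: "p t \<in> ball 0 (min 1 r')" "q t \<in> ball 0 (min 1 r')" for t i
  proof -
    have 1: "norm (p t $ k - q t $ k) \<le> norm (p t - q t)" for k
      using Finite_Cartesian_Product.norm_nth_le[of "p t - q t" k] by simp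
    have nn: "1 \<le> real n * real n" using n by (metis One_nat_def Suc_leD mult_le_mono nat_mult_1 numeral_2_eq_2 of_nat_1 of_nat_le_iff of_nat_mult)
    have 2: "norm (p t - q t) \<le> real n * real n * norm (p t - q t)"
      using mult_right_mono[OF nn norm_ge_zero[of "p t - q t"]] by simp
    have le1: "norm (p t $ 3) \<le> 1" "norm (q t $ 3) \<le> 1"
      using t Finite_Cartesian_Product.norm_nth_le[of "p t" 3] Finite_Cartesian_Product.norm_nth_le[of "q t" 3] by auto
    have "norm (of_nat n * p t $ 3 ^ (n - 1) - of_nat n * q t $ 3 ^ (n - 1))
        = real n * norm (p t $ 3 ^ (n - 1) - q t $ 3 ^ (n - 1))"
      unfolding right_diff_distrib[symmetric] by (simp add: norm_mult)
    also have "\<dots> \<le> real n * (real (n - 1) * norm (p t $ 3 - q t $ 3))"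
      by (intro mult_left_mono norm_power_diff le1) auto
    also have "\<dots> \<le> real n * (real n * norm (p t - q t))"
      by (intro mult_left_mono mult_mono 1) auto
    finally have 3: "norm (of_nat n * p t $ 3 ^ (n - 1) - of_nat n * q t $ 3 ^ (n - 1)) \<le> real n * real n * norm (p t - q t)"
      by (simp add: mult.assoc)
    show ?thesis using exhaust_3[of i] order_trans[OF 1 2] 3 by (auto simp: G_def)
  qed
  have key: "norm (u t i * v t j - u t j * v t i) \<le>
      (norm (u t 1) + norm (u t 2)) * (norm (v t i) + norm (v t j)) * (C * t)"
    if t: "0 < t" "t < 1" "P t \<in> ball 0 r" "Q t \<in> ball 0 r" "p t \<in> ball 0 (min 1 r')" "q t \<in> ball 0 (min 1 r')" for t i j
  proof -
    define E where "E = real n * real n * (2 * K * t ^ N)"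
    define W where "W = u t i * v t j - u t j * v t i"
    have f1: "m t \<ge> \<kappa> * t ^ n" and f2: "norm (p t - q t) \<le> 2 * K * t ^ N"
      and f3: "\<And>i j. u t i * G (p t) $ j = u t j * G (p t) $ i" and f4: "\<And>i j. v t i * G (q t) $ j = v t j * G (q t) $ i"
      using fact[OF t] by auto
    have Gd: "norm (G (p t) $ k - G (q t) $ k) \<le> E" for k
      unfolding E_def by (rule order_trans[OF Gdiff[OF t(5,6)]]) (intro mult_left_mono f2, simp)
    have E0: "E \<ge> 0" using Kr(1) t(1) by (simp add: E_def)
    have bd: "norm (G (p t) $ k) * norm W \<le> norm (u t k) * ((norm (v t i) + norm (v t j)) * E)" for k
    proof -
      \<comment> \<open>Proportionality of \<open>u\<close> to the gradient at \<open>p t\<close>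
        and of \<open>v\<close> to that at \<open>q t\<close> rewrites the minor so that only
        differences of the two gradients remain.\<close>
      have "G (p t) $ k * W = v t j * (u t i * G (p t) $ k) - v t i * (u t j * G (p t) $ k)"
        by (simp add: W_def algebra_simps)
      also have "\<dots> = u t k * (v t j * G (p t) $ i - v t i * G (p t) $ j)"
        unfolding f3[of i k] f3[of j k] by (simp add: algebra_simps)
      also have "\<dots> = u t k * (v t j * (G (p t) $ i - G (q t) $ i) - v t i * (G (p t) $ j - G (q t) $ j))"
        using f4[of i j] by (simp add: algebra_simps)
      finally have "norm (G (p t) $ k) * norm W =
        norm (u t k) * norm (v t j * (G (p t) $ i - G (q t) $ i) - v t i * (G (p t) $ j - G (q t) $ j))"
        by (metis norm_mult)
      also have "\<dots> \<le> norm (u t k) * (norm (v t j) * E + norm (v t i) * E)"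
        by (intro mult_left_mono norm_ge_zero order_trans[OF norm_triangle_ineq4] add_mono)
          (auto simp: norm_mult intro!: mult_left_mono Gd)
      finally show ?thesis by (simp add: algebra_simps)
    qed
    have "m t = norm (G (p t) $ 1) \<or> m t = norm (G (p t) $ 2)"
      by (auto simp: m_def G_def max_def)
    then have "m t * norm W \<le> (norm (u t 1) + norm (u t 2)) * ((norm (v t i) + norm (v t j)) * E)"
    proof
      assume "m t = norm (G (p t) $ 1)"
      then have "m t * norm W \<le> norm (u t 1) * ((norm (v t i) + norm (v t j)) * E)" using bd[of 1] by simp
      also have "\<dots> \<le> (norm (u t 1) + norm (u t 2)) * ((norm (v t i) + norm (v t j)) * E)"
        using E0 by (intro mult_right_mono mult_nonneg_nonneg) simp_all
      finally show ?thesis .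
    next
      assume "m t = norm (G (p t) $ 2)"
      then have "m t * norm W \<le> norm (u t 2) * ((norm (v t i) + norm (v t j)) * E)" using bd[of 2] by simp
      also have "\<dots> \<le> (norm (u t 1) + norm (u t 2)) * ((norm (v t i) + norm (v t j)) * E)"
        using E0 by (intro mult_right_mono mult_nonneg_nonneg) simp_all
      finally show ?thesis .
    qed
    moreover have "\<kappa> * t ^ n * norm W \<le> m t * norm W" by (intro mult_right_mono f1) auto
    ultimately have le: "\<kappa> * t ^ n * norm W \<le> (norm (u t 1) + norm (u t 2)) * ((norm (v t i) + norm (v t j)) * E)"
      by linarith
    have "t ^ N \<le> t ^ Suc n" using t n by (intro power_decreasing) auto
    then have "real n * real n * (2 * K) * t ^ N \<le> real n * real n * (2 * K) * t ^ Suc n"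
      using Kr(1) by (intro mult_left_mono) auto
    then have "E \<le> \<kappa> * t ^ n * (C * t)"
      using \<kappa> by (simp add: E_def C_def mult_ac)
    then have "(norm (u t 1) + norm (u t 2)) * ((norm (v t i) + norm (v t j)) * E) \<le>
      (norm (u t 1) + norm (u t 2)) * ((norm (v t i) + norm (v t j)) * (\<kappa> * t ^ n * (C * t)))"
      by (intro mult_left_mono) auto
    with le have "\<kappa> * t ^ n * norm W \<le> \<kappa> * t ^ n *
      ((norm (u t 1) + norm (u t 2)) * (norm (v t i) + norm (v t j)) * (C * t))"
      by (simp add: mult_ac)
    then show ?thesis using \<kappa> t(1) by (simp add: W_def)
  qed
  have W0: "a i * b j = a j * b i" for i j
  proof -
    have "((\<lambda>t. u t i * v t j - u t j * v t i) \<longlongrightarrow>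
        (b i - a i) * (2 * b j - a j / 2) - (b j - a j) * (2 * b i - a i / 2)) ?F"
      by (intro tendsto_intros lu lv)
    moreover have "((\<lambda>t. u t i * v t j - u t j * v t i) \<longlongrightarrow> 0) ?F"
    proof (rule Lim_null_comparison)
      show "\<forall>\<^sub>F t in ?F. norm (u t i * v t j - u t j * v t i) \<le>
        (norm (u t 1) + norm (u t 2)) * (norm (v t i) + norm (v t j)) * (C * t)"
        using ev pos by eventually_elim (intro key, auto)
      have "((\<lambda>t. (norm (u t 1) + norm (u t 2)) * (norm (v t i) + norm (v t j)) * (C * t)) \<longlongrightarrow>
        (norm (b 1 - a 1) + norm (b 2 - a 2)) * (norm (2 * b i - a i / 2) + norm (2 * b j - a j / 2)) * (C * 0)) ?F"
        by (intro tendsto_intros lu lv)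
      then show "((\<lambda>t. (norm (u t 1) + norm (u t 2)) * (norm (v t i) + norm (v t j)) * (C * t)) \<longlongrightarrow> 0) ?F"
        by simp
    qed
    ultimately have "(b i - a i) * (2 * b j - a j / 2) - (b j - a j) * (2 * b i - a i / 2) = 0"
      by (rule tendsto_unique[rotated]) simp
    \<comment> \<open>Up to sign, the minor of the limits is that of \<open>a\<close> and
      \<open>b\<close> times the determinant of \<open>(-1, 1)\<close> and \<open>(-1/2, 2)\<close>,
      which is \<open>-3/2\<close>.\<close>
    then have "3 / 2 * (a i * b j - a j * b i) = 0" by (simp add: field_simps)
    then show ?thesis by simp
  qed
  obtain Dg where Dg: "(g has_derivative Dg) (at 0)"
    using *(4,7) unfolding holomorphic3_on_def by blast
  have surj: "\<exists>h. blinfun_apply (D 0) h = y" for y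
  proof -
    have "((\<lambda>x. f (g x)) has_derivative (\<lambda>x. blinfun_apply (D 0) (Dg x))) (at 0)"
      using has_derivative_compose[OF Dg] D(1)[OF *(3)] g0 by simp
    moreover have "((\<lambda>x. f (g x)) has_derivative (\<lambda>x. x)) (at 0)"
      by (rule has_derivative_transform_within_open[OF has_derivative_ident *(2,4)]) (simp add: gg(1))
    ultimately have "(\<lambda>x. blinfun_apply (D 0) (Dg x)) = (\<lambda>x. x)" by (rule has_derivative_unique)
    then show ?thesis by metis
  qed
  have ex: "blinfun_apply (D 0) h $ i = (\<Sum>j\<in>UNIV. h $ j * blinfun_apply (D 0) (axis j 1) $ i)" for h i
  proof -
    have "blinfun_apply (D 0) (\<Sum>j\<in>UNIV. h $ j *s axis j 1) = (\<Sum>j\<in>UNIV. h $ j *s blinfun_apply (D 0) (axis j 1))"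
      by (simp only: blinfun.sum_right D(2)[OF *(3)])
    then show ?thesis unfolding basis_expansion by simp
  qed
  obtain h where "blinfun_apply (D 0) h = axis 1 1" using surj by blast
  then have h: "(\<Sum>j\<in>UNIV. h $ j * a j) = 1" "(\<Sum>j\<in>UNIV. h $ j * b j) = 0"
    unfolding a_def b_def ex[symmetric] by (auto simp: axis_def)
  obtain h' where "blinfun_apply (D 0) h' = axis 2 1" using surj by blast
  then have h': "(\<Sum>j\<in>UNIV. h' $ j * a j) = 0" "(\<Sum>j\<in>UNIV. h' $ j * b j) = 1"
    unfolding a_def b_def ex[symmetric] by (auto simp: axis_def)
  \<comment> \<open>Pairing the proportionality with a preimage of the second basis vector kills
    \<open>a\<close>, yet \<open>a\<close> pairs to 1 with a preimage of the first.\<close>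
  have "a i = 0" for i
  proof -
    have "a i * (\<Sum>j\<in>UNIV. h' $ j * b j) = b i * (\<Sum>j\<in>UNIV. h' $ j * a j)"
      unfolding sum_distrib_left using W0[of i] by (intro sum.cong) (auto simp: algebra_simps)
    then show ?thesis using h' by simp
  qed
  then show False using h(1) by simp
qed

section \<open>The folding polynomial in deltoid coordinates\<close>

text \<open>Both sides are monic of degree \<open>n\<close> in \<open>T\<close> and share their
  \<open>n\<close> roots.\<close>

lemma prod_nth_roots_linear:
  fixes c T :: complex
  assumes "c \<noteq> 0" "n > 0"
  shows "(\<Prod>x | x ^ n = c. T - x) = T ^ n - c"
proof -
  let ?R = "{x::complex. x ^ n = c}"
  have card: "card ?R = n" by (rule card_nth_roots[OF assms])
  then have fin: "finite ?R" using assms card.infinite by force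
  have deg: "degree (\<Prod>x\<in>?R. [:- x, 1:]) = n"
    by (subst degree_prod_sum_eq) (auto simp: card)
  have lc: "lead_coeff (\<Prod>x\<in>?R. [:- x, 1:]) = 1" by (simp add: lead_coeff_prod)
  have "(\<Prod>x\<in>?R. [:- x, 1:]) = monom 1 n - [:c:]"
  proof (rule poly_eqI_degree_lead_coeff[where n = n and A = ?R])
    show "coeff (\<Prod>x\<in>?R. [:- x, 1:]) n = coeff (monom 1 n - [:c:]) n"
      using lc assms by (simp add: deg coeff_pCons split: nat.splits)
    show "degree (monom 1 n - [:c:]) \<le> n" by (intro degree_diff_le degree_monom_le) auto
    fix z assume "z \<in> ?R"
    then show "poly (\<Prod>x\<in>?R. [:- x, 1:]) z = poly (monom 1 n - [:c:]) z"
      using fin by (auto simp: poly_prod poly_monom)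
  qed (use deg card in auto)
  from arg_cong[OF this, of "\<lambda>p. poly p T"] show ?thesis
    by (simp add: poly_prod poly_monom)
qed

text \<open>A primitive sixth root of unity. The points \<open>cis (- 2 * theta d \<mu>)\<close> are
  the \<open>d\<close>-th roots of \<open>om\<close>; its square is the factor exp(2 pi i / 3) in
  the \<open>Y\<close>'s, and \<open>om ^ 3 = -1\<close> turns \<open>Y = -1\<close> into
  \<open>x ^ d = om\<close>.\<close>

definition om :: complex where "om = cis (pi / 3)"

lemma om_powers: "om ^ 3 = -1" "om ^ 6 = 1" "om \<noteq> 0" "om ^ 2 = om - 1"
proof -
  show "om ^ 3 = -1" unfolding om_def Complex.DeMoivre by simp
  then show "om ^ 6 = 1" using power_mult[of om 3 2] by simp
  show "om \<noteq> 0" by (simp add: om_def)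
  have "(om + 1) * (om ^ 2 - om + 1) = 0" using \<open>om ^ 3 = -1\<close> by (simp add: algebra_simps power3_eq_cube power2_eq_square)
  moreover have "om + 1 \<noteq> 0"
  proof
    assume "om + 1 = 0"
    then have "Re om = -1" by (simp add: complex_eq_iff)
    then show False by (simp add: om_def cos_60)
  qed
  ultimately have "om ^ 2 - om + 1 = 0" by (metis mult_eq_0_iff)
  then show "om ^ 2 = om - 1" by algebra
qed

text \<open>Says that -1 is not a \<open>d\<close>-th root of \<open>om\<close>: hence no
  \<open>tan\<close> in \<open>L\<close> is evaluated at a pole, and \<open>(-1) ^ d - om\<close>
  may be cancelled.\<close>

lemma om_ne_pm1_power: "om \<noteq> (-1) ^ n"
proof -
  have "om \<noteq> 1" using om_powers(4) by auto
  moreover have "om \<noteq> -1"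
  proof
    assume "om = -1"
    from om_powers(4) have "(-1) ^ 2 = (-1::complex) - 1" unfolding \<open>om = -1\<close> .
    then show False by simp
  qed
  ultimately show ?thesis by (cases "even n") auto
qed

text \<open>The angles \<open>- 2 * theta d \<mu>\<close> are spaced by 2 pi / d, \<open>d\<close>
  times each of them is pi / 3 modulo 2 pi, and for either parity of \<open>d\<close> the range
  consists of \<open>d\<close> consecutive integers.\<close>

lemma theta_roots:
  assumes "d > 0"
  shows "bij_betw (\<lambda>\<mu>. cis (- 2 * theta d \<mu>)) {- \<lfloor>(real d - 2) / 2\<rfloor> .. \<lfloor>(real d + 1) / 2\<rfloor>} {x. x ^ d = om}"
proof -
  let ?I = "{- \<lfloor>(real d - 2) / 2\<rfloor> .. \<lfloor>(real d + 1) / 2\<rfloor>}"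
  let ?f = "\<lambda>\<mu>. cis (- 2 * theta d \<mu>)"
  have card: "card ?I = d"
  proof (cases "even d")
    case True
    then obtain k where k: "d = 2 * k" by blast
    have "\<lfloor>(real d - 2) / 2\<rfloor> = int k - 1" "\<lfloor>(real d + 1) / 2\<rfloor> = int k"
      by (rule floor_unique; simp add: k field_simps)+
    then show ?thesis by (simp add: k)
  next
    case False
    then obtain k where k: "d = 2 * k + 1" using oddE by blast
    have "\<lfloor>(real d - 2) / 2\<rfloor> = int k - 1" "\<lfloor>(real d + 1) / 2\<rfloor> = int k + 1"
      by (rule floor_unique; simp add: k field_simps)+
    then show ?thesis by (simp add: k)
  qed
  have inj: "inj_on ?f ?I"
  proof (rule inj_onI)
    fix \<mu> \<mu>' assume I: "\<mu> \<in> ?I" "\<mu>' \<in> ?I" and eq: "?f \<mu> = ?f \<mu>'"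
    have "sin (- 2 * theta d \<mu>) = sin (- 2 * theta d \<mu>')" "cos (- 2 * theta d \<mu>) = cos (- 2 * theta d \<mu>')"
      using eq by (metis cis.sel)+
    then obtain n :: int where "- 2 * theta d \<mu> = - 2 * theta d \<mu>' + 2 * pi * n"
      using sin_cos_eq_iff by blast
    then have "2 * pi * (real_of_int (\<mu>' - \<mu>) / d) = 2 * pi * n"
      using assms by (simp add: theta_def field_simps)
    then have "real_of_int (\<mu>' - \<mu>) / d = n" by (simp only: mult_cancel_left) simp
    then have "real_of_int (\<mu>' - \<mu>) = real_of_int (n * int d)" using assms by (simp add: field_simps)
    then have e: "\<mu>' - \<mu> = n * int d" by linarith
    have "\<bar>\<mu>' - \<mu>\<bar> < int d"
    proof -
      have "card ?I = nat (\<lfloor>(real d + 1) / 2\<rfloor> - - \<lfloor>(real d - 2) / 2\<rfloor> + 1)" by simp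
      then have "int d = \<lfloor>(real d + 1) / 2\<rfloor> - - \<lfloor>(real d - 2) / 2\<rfloor> + 1" using card assms by linarith
      then show ?thesis using I by auto
    qed
    then have lt: "\<bar>n\<bar> * int d < int d" unfolding e by (simp add: abs_mult)
    have "n = 0"
    proof (rule ccontr)
      assume "n \<noteq> 0"
      then have "1 * int d \<le> \<bar>n\<bar> * int d" by (intro mult_right_mono) auto
      then show False using lt by simp
    qed
    then show "\<mu> = \<mu>'" using e by simp
  qed
  have sub: "?f ` ?I \<subseteq> {x. x ^ d = om}"
  proof clarify
    fix \<mu> :: int
    have "real d * (- 2 * theta d \<mu>) = pi / 3 + 2 * pi * real_of_int (- \<mu>)"
      using assms by (simp add: theta_def field_simps)
    then have "cis (- 2 * theta d \<mu>) ^ d = cis (pi / 3) * cis (2 * pi * real_of_int (- \<mu>))"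
      unfolding Complex.DeMoivre by (simp add: cis_mult)
    then show "cis (- 2 * theta d \<mu>) ^ d = om" by (subst (asm) cis_multiple_2pi) (auto simp: om_def)
  qed
  have card2: "card {x. x ^ d = om} = d" using assms om_powers by (intro card_nth_roots)
  then have "finite {x. x ^ d = om}" using assms card.infinite by force
  then have "?f ` ?I = {x. x ^ d = om}"
    using sub card card2 card_image[OF inj] by (intro card_subset_eq) auto
  then show ?thesis using inj by (simp add: bij_betw_def)
qed

lemma prod_L_roots:
  assumes "d > 0"
  shows "(\<Prod>\<mu> = - \<lfloor>(real d - 2) / 2\<rfloor> .. \<lfloor>(real d + 1) / 2\<rfloor>. T - cis (- 2 * theta d \<mu>)) = T ^ d - om"
  using prod.reindex_bij_betw[OF theta_roots[OF assms], of "\<lambda>x. T - x"]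
    prod_nth_roots_linear[of om d T] om_powers assms by simp

text \<open>On the real torus \<open>|x\<^sub>k| = 1\<close>, \<open>x\<^sub>1 x\<^sub>2 x\<^sub>3 = 1\<close>, these are the real coordinates of \<open>x\<^sub>1 + x\<^sub>2 + x\<^sub>3\<close>,
  the second one rescaled to absorb the substitution \<open>y / \<surd>3\<close>.\<close>

definition dx :: "complex \<Rightarrow> complex \<Rightarrow> complex \<Rightarrow> complex" where
  "dx x1 x2 x3 = ((x1 + x2 + x3) + (1 / x1 + 1 / x2 + 1 / x3)) / 2"

definition dy :: "complex \<Rightarrow> complex \<Rightarrow> complex \<Rightarrow> complex" where
  "dy x1 x2 x3 = of_real (sqrt 3) * (((x1 + x2 + x3) - (1 / x1 + 1 / x2 + 1 / x3)) / (2 * \<i>))"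

lemma deltoid_perm:
  "dx x2 x1 x3 = dx x1 x2 x3" "dx x1 x3 x2 = dx x1 x2 x3" "dx x2 x3 x1 = dx x1 x2 x3"
  "dy x2 x1 x3 = dy x1 x2 x3" "dy x1 x3 x2 = dy x1 x2 x3" "dy x2 x3 x1 = dy x1 x2 x3"
  by (simp_all add: dx_def dy_def algebra_simps)

text \<open>The line consists of the triples that contain \<open>X\<close>. Clearing the denominator
  cos(theta) of the tangent and a power of cis(theta) turns its equation into the monic cubic with
  roots \<open>x1\<close>, \<open>x2\<close>, \<open>x3\<close>, evaluated at
  \<open>X\<close>.\<close>

lemma L_roots:
  assumes "x1 * x2 * x3 = 1" "cos (theta d \<mu>) \<noteq> 0"
  defines "X \<equiv> cis (- 2 * theta d \<mu>)"
  shows "L d \<mu> (dx x1 x2 x3) (dy x1 x2 x3 / of_real (sqrt 3)) * (1 + X) * X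
     = \<i> * ((X - x1) * (X - x2) * (X - x3))"
proof -
  define t where "t = cis (theta d \<mu>)"
  define z where "z = x1 + x2 + x3"
  define z' where "z' = 1 / x1 + 1 / x2 + 1 / x3"
  have x0: "x1 \<noteq> 0" "x2 \<noteq> 0" "x3 \<noteq> 0" using assms(1) by auto
  have z'2: "z' = x2 * x3 + x1 * x3 + x1 * x2"
    using assms(1) x0 by (simp add: z'_def field_simps)
  have t0: "t \<noteq> 0" by (simp add: t_def)
  define r where "r = cis (- theta d \<mu>)"
  have tr: "t * r = 1" by (simp add: t_def r_def cis_mult)
  define co si co2 si2 tn where defs: "co = complex_of_real (cos (theta d \<mu>))" "si = complex_of_real (sin (theta d \<mu>))"
    "co2 = complex_of_real (cos (2 * theta d \<mu>))" "si2 = complex_of_real (sin (2 * theta d \<mu>))"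
    "tn = complex_of_real (tan (theta d \<mu>))"
  have X: "X = r ^ 2" by (simp add: X_def r_def Complex.DeMoivre)
  have c: "co = (t + r) / 2" "si = - \<i> * (t - r) / 2" "co2 = (t ^ 2 + r ^ 2) / 2" "si2 = - \<i> * (t ^ 2 - r ^ 2) / 2"
    unfolding defs t_def r_def Complex.DeMoivre by (simp_all add: complex_eq_iff)
  have tan: "tn * co = si"
    unfolding defs of_real_mult[symmetric] tan_def using assms(2) by simp
  have tX: "(1 + X) * t = 2 * co"
    using arg_cong[OF tr, of "\<lambda>y. y * r"] by (simp add: X c algebra_simps power2_eq_square)
  have dy: "dy x1 x2 x3 / of_real (sqrt 3) = - \<i> * (z - z') / 2"
    unfolding dy_def z_def[symmetric] z'_def[symmetric] by (simp add: field_simps)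
  have dx: "dx x1 x2 x3 = (z + z') / 2" by (simp add: dx_def z_def z'_def)
  have eq: "(y + (a - b) * tn + s) * (2 * co) = 2 * (co * (y + s)) + 2 * (a - b) * (tn * co)" for y a b s
    by (simp add: algebra_simps)
  have "L d \<mu> (dx x1 x2 x3) (dy x1 x2 x3 / of_real (sqrt 3)) * ((1 + X) * t) =
     (- \<i> * (z - z') / 2 + (co2 - (z + z') / 2) * tn + si2) * (2 * co)"
    unfolding tX L_def dx dy defs ..
  also have "\<dots> = 2 * (co * (- \<i> * (z - z') / 2 + si2)) + 2 * (co2 - (z + z') / 2) * (tn * co)"
    by (rule eq)
  also have "\<dots> = \<i> * (r ^ 3 - z * r + z' * t - t ^ 3)"
    unfolding tan unfolding c by (simp add: field_simps) (simp add: algebra_simps power2_eq_square power3_eq_cube)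
  also have "\<dots> = \<i> * t ^ 3 * (X ^ 3 - z * X ^ 2 + z' * X - 1)"
  proof -
    have "t ^ 3 * (X ^ 3 - z * X ^ 2 + z' * X - 1) = (t * r) ^ 3 * r ^ 3 - z * (t * r) ^ 3 * r + z' * (t * r) ^ 2 * t - t ^ 3"
      by (simp add: X algebra_simps power2_eq_square power3_eq_cube)
    then show ?thesis by (simp add: tr)
  qed
  also have "X ^ 3 - z * X ^ 2 + z' * X - 1 = (X - x1) * (X - x2) * (X - x3)"
    unfolding z'2 z_def assms(1)[symmetric] by (simp add: algebra_simps power2_eq_square power3_eq_cube)
  finally have e: "L d \<mu> (dx x1 x2 x3) (dy x1 x2 x3 / of_real (sqrt 3)) * ((1 + X) * t) =
    \<i> * t ^ 3 * ((X - x1) * (X - x2) * (X - x3))" .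
  have Xt: "X * t ^ 3 = t"
  proof -
    have "X * t ^ 3 = (t * r) ^ 2 * t" by (simp add: X power2_eq_square power3_eq_cube)
    then show ?thesis by (simp add: tr)
  qed
  have "t * (L d \<mu> (dx x1 x2 x3) (dy x1 x2 x3 / of_real (sqrt 3)) * (1 + X) * X) =
    t * (\<i> * ((X - x1) * (X - x2) * (X - x3)))"
    using arg_cong[OF e, of "\<lambda>y. X * y"] Xt by (metis (no_types, opaque_lifting) mult.assoc mult.commute)
  then show ?thesis using t0 by simp
qed

text \<open>In this form the prefactor cancels against the product of \<open>(1 + X) * X\<close>
  over all \<open>d\<close>-th roots \<open>X\<close> of \<open>om\<close> and the factors
  \<open>\<i>\<close> from \<open>L_roots\<close>.\<close>

lemma J_hat_prefactor: "complex_of_real (2 * cos (real d * pi / 2 + 2 * pi / 3)) = \<i> ^ d * (om ^ 2 + (-1) ^ d * om ^ 4)"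
proof -
  let ?w = "real d * pi / 2 + 2 * pi / 3"
  have 1: "cis ?w = \<i> ^ d * om ^ 2"
  proof -
    have "\<i> ^ d = cis (real d * (pi / 2))" by (simp only: cis_pi_half[symmetric] Complex.DeMoivre)
    moreover have "om ^ 2 = cis (2 * pi / 3)" by (simp add: om_def Complex.DeMoivre)
    ultimately show ?thesis by (simp add: cis_mult)
  qed
  have "complex_of_real (2 * cos w) = cis w + 1 / cis w" for w
    by (simp add: complex_eq_iff flip: inverse_eq_divide)
  then have "complex_of_real (2 * cos ?w) = cis ?w + 1 / cis ?w" .
  also have "1 / cis ?w = (-1) ^ d * \<i> ^ d * om ^ 4"
  proof -
    have "((-1) ^ d * \<i> ^ d * om ^ 4) * (\<i> ^ d * om ^ 2) = ((-1) * \<i> * \<i>) ^ d * om ^ 6"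
      by (simp only: power_mult_distrib) (simp add: power_add[symmetric] mult_ac)
    also have "\<dots> = 1" by (simp add: om_powers)
    finally show ?thesis unfolding 1 using om_powers(3) by (simp add: field_simps)
  qed
  finally show ?thesis unfolding 1 by (simp add: algebra_simps)
qed

text \<open>Multiply \<open>L_roots\<close> over all lines. Up to sign every resulting product is a
  value of \<open>T ^ d - om\<close>: at \<open>T = x1, x2, x3\<close> on the right, at
  \<open>T = -1\<close> and \<open>T = 0\<close> on the left.\<close>

lemma J_deltoid:
  assumes "d > 0" "x1 * x2 * x3 = 1"
  shows "J d (dx x1 x2 x3) (dy x1 x2 x3) = (1 + om ^ 2 * x1 ^ d) * (1 + om ^ 2 * x2 ^ d) * (1 + om ^ 2 * x3 ^ d)"
proof -
  define I where "I = {- \<lfloor>(real d - 2) / 2\<rfloor> .. \<lfloor>(real d + 1) / 2\<rfloor>}"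
  let ?X = "\<lambda>\<mu>. cis (- 2 * theta d \<mu>)"
  define e :: complex where "e = (-1) ^ d"
  have e2: "e * e = 1" by (simp add: e_def flip: power_mult_distrib)
  have card: "card I = d"
    using bij_betw_same_card[OF theta_roots[OF assms(1), folded I_def]] card_nth_roots[of om d] om_powers(3) assms(1) by simp
  have pr: "(\<Prod>\<mu>\<in>I. ?X \<mu> - T) = e * (T ^ d - om)" for T
  proof -
    have "(\<Prod>\<mu>\<in>I. ?X \<mu> - T) = (\<Prod>\<mu>\<in>I. (-1) * (T - ?X \<mu>))" by simp
    also have "\<dots> = e * (T ^ d - om)"
      unfolding prod.distrib prod_L_roots[OF assms(1), folded I_def] by (simp add: e_def card)
    finally show ?thesis .
  qed
  have cos0: "cos (theta d \<mu>) \<noteq> 0" if "\<mu> \<in> I" for \<mu>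
  proof
    assume "cos (theta d \<mu>) = 0"
    then have "?X \<mu> = -1" by (simp add: complex_eq_iff cos_double sin_double)
      (metis add_0 power2_eq_square mult_zero_left sin_cos_squared_add3)
    moreover have "?X \<mu> ^ d = om" using theta_roots[OF assms(1), folded I_def] that by (auto simp: bij_betw_def)
    ultimately show False using om_ne_pm1_power by metis
  qed
  define P where "P = (\<Prod>\<mu>\<in>I. L d \<mu> (dx x1 x2 x3) (dy x1 x2 x3 / of_real (sqrt 3)))"
  define R where "R = (x1 ^ d - om) * (x2 ^ d - om) * (x3 ^ d - om)"
  have "(\<Prod>\<mu>\<in>I. L d \<mu> (dx x1 x2 x3) (dy x1 x2 x3 / of_real (sqrt 3)) * (1 + ?X \<mu>) * ?X \<mu>)
    = (\<Prod>\<mu>\<in>I. \<i> * ((?X \<mu> - x1) * (?X \<mu> - x2) * (?X \<mu> - x3)))"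
    by (intro prod.cong refl L_roots assms cos0)
  then have "P * (\<Prod>\<mu>\<in>I. ?X \<mu> - (-1)) * (\<Prod>\<mu>\<in>I. ?X \<mu> - 0) =
     \<i> ^ d * ((\<Prod>\<mu>\<in>I. ?X \<mu> - x1) * (\<Prod>\<mu>\<in>I. ?X \<mu> - x2) * (\<Prod>\<mu>\<in>I. ?X \<mu> - x3))"
    by (simp add: prod.distrib P_def card add.commute)
  then have "P * (e * (e - om)) * (e * (0 - om)) = \<i> ^ d * ((e * (x1 ^ d - om)) * (e * (x2 ^ d - om)) * (e * (x3 ^ d - om)))"
    unfolding pr using assms(1) by (simp add: e_def zero_power)
  also have "\<dots> = \<i> ^ d * e * R * (e * e)" by (simp add: R_def algebra_simps)
  also have "P * (e * (e - om)) * (e * (0 - om)) = P * (e - om) * (- om) * (e * e)" by (simp add: algebra_simps)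
  finally have PR: "P * (e - om) * (- om) = \<i> ^ d * e * R" unfolding e2 by simp
  have ne: "e - om \<noteq> 0" using om_ne_pm1_power[of d] by (auto simp: e_def)
  have "\<i> ^ d * \<i> ^ d = e" by (simp add: e_def flip: power_mult_distrib)
  have om4: "om ^ 4 = - om" using om_powers(1) power_add[of om 3 1] by simp
  have "\<i> ^ d * (om ^ 2 + e * om ^ 4) * P * ((e - om) * (- om)) = (\<i> ^ d * \<i> ^ d) * e * (om ^ 2 + e * om ^ 4) * R"
  proof -
    have "\<i> ^ d * (om ^ 2 + e * om ^ 4) * P * ((e - om) * (- om)) = \<i> ^ d * (om ^ 2 + e * om ^ 4) * (P * (e - om) * (- om))"
      by (simp only: mult_ac)
    then show ?thesis unfolding PR by (simp only: mult_ac)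
  qed
  also have "\<dots> = (e * e) * (om ^ 2 + e * om ^ 4) * R" unfolding \<open>\<i> ^ d * \<i> ^ d = e\<close> by simp
  also have "\<dots> = R * ((e - om) * (- om))" unfolding e2 om4 by (simp add: algebra_simps power2_eq_square)
  finally have "\<i> ^ d * (om ^ 2 + e * om ^ 4) * P = R" using ne om_powers(3) by simp
  then have "J d (dx x1 x2 x3) (dy x1 x2 x3) = R"
    unfolding J_def J_hat_def J_hat_prefactor I_def[symmetric] P_def[symmetric] e_def .
  \<comment> \<open>Giving \<open>om ^ 2\<close> to each of the three factors turns every
    \<open>- om\<close> into \<open>- om ^ 3 = 1\<close>.\<close>
  also have "R = om ^ 6 * R" by (simp add: om_powers)
  also have "\<dots> = (om ^ 2 * x1 ^ d - om ^ 3) * (om ^ 2 * x2 ^ d - om ^ 3) * (om ^ 2 * x3 ^ d - om ^ 3)"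
    unfolding R_def by algebra
  finally show ?thesis by (simp add: om_powers(1) add.commute)
qed

text \<open>The triple consists of the roots of \<open>T^3 - z T^2 + z' T - 1\<close>: one exists by
  the fundamental theorem of algebra, and the quadratic formula supplies the other two.\<close>

lemma deltoid_surj:
  obtains x1 x2 x3 where "x1 * x2 * x3 = 1" "u = dx x1 x2 x3" "v = dy x1 x2 x3"
proof -
  define y where "y = v / of_real (sqrt 3)"
  define z where "z = u + \<i> * y"
  define z' where "z' = u - \<i> * y"
  have "\<exists>x. poly [:-1, z', -z, 1:] x = 0"
    by (rule Fundamental_Theorem_Algebra.fundamental_theorem_of_algebra) (simp add: constant_degree)
  then obtain x1 where x1: "x1 ^ 3 - z * x1 ^ 2 + z' * x1 - 1 = 0"
    by (auto simp: algebra_simps power2_eq_square power3_eq_cube)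
  then have x0: "x1 \<noteq> 0" by auto
  define s where "s = csqrt ((z - x1) ^ 2 - 4 / x1)"
  have s: "s ^ 2 = (z - x1) ^ 2 - 4 / x1" by (simp add: s_def)
  define x2 where "x2 = (z - x1 + s) / 2"
  define x3 where "x3 = (z - x1 - s) / 2"
  have "x2 * x3 = ((z - x1) ^ 2 - s ^ 2) / 4" by (simp add: x2_def x3_def field_simps power2_eq_square)
  then have p23: "x2 * x3 = 1 / x1" by (simp add: s)
  then have p: "x1 * x2 * x3 = 1" using x0 by (simp add: mult.assoc)
  then have ne: "x2 \<noteq> 0" "x3 \<noteq> 0" by auto
  have s1: "x1 + x2 + x3 = z" by (simp add: x2_def x3_def field_simps)
  have "1 / x1 + 1 / x2 + 1 / x3 = x2 * x3 + x1 * (x2 + x3)"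
    using p x0 ne by (simp add: field_simps)
  also have "x2 + x3 = z - x1" using s1 by (simp add: algebra_simps)
  also have "x2 * x3 + x1 * (z - x1) = 1 / x1 + x1 * (z - x1)" unfolding p23 ..
  also have "\<dots> = z'" using x0 x1 by (simp add: field_simps power2_eq_square power3_eq_cube)
  finally have s2: "1 / x1 + 1 / x2 + 1 / x3 = z'" .
  have "u = dx x1 x2 x3" unfolding dx_def s1 s2 by (simp add: z_def z'_def)
  moreover have "v = dy x1 x2 x3" unfolding dy_def s1 s2 by (simp add: z_def z'_def y_def)
  ultimately show thesis using that p by blast
qed

text \<open>Equal coordinates mean equal elementary symmetric functions, hence one cubic with both
  triples as roots.\<close>

lemma deltoid_eqD:
  assumes "x1 * x2 * x3 = 1" "y1 * y2 * y3 = 1" "dx x1 x2 x3 = dx y1 y2 y3" "dy x1 x2 x3 = dy y1 y2 y3"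
  shows "y1 \<in> {x1, x2, x3}" "y2 \<in> {x1, x2, x3}" "y3 \<in> {x1, x2, x3}"
proof -
  have ne: "x1 \<noteq> 0" "x2 \<noteq> 0" "x3 \<noteq> 0" "y1 \<noteq> 0" "y2 \<noteq> 0" "y3 \<noteq> 0" using assms(1,2) by auto
  have a: "(x1 + x2 + x3) + (1 / x1 + 1 / x2 + 1 / x3) = (y1 + y2 + y3) + (1 / y1 + 1 / y2 + 1 / y3)"
  proof -
    have "p = q" if "p / 2 = q / 2" for p q :: complex using that by simp
    from this[OF assms(3)[unfolded dx_def]] show ?thesis .
  qed
  have b: "(x1 + x2 + x3) - (1 / x1 + 1 / x2 + 1 / x3) = (y1 + y2 + y3) - (1 / y1 + 1 / y2 + 1 / y3)"
    using assms(4) by (simp add: dy_def)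
  have s: "x1 + x2 + x3 = y1 + y2 + y3" "1 / x1 + 1 / x2 + 1 / x3 = 1 / y1 + 1 / y2 + 1 / y3"
  proof -
    have "p = p' \<and> q = q'" if "p + q = p' + q'" "p - q = p' - q'" for p q p' q' :: complex
      using that by (simp add: complex_eq_iff)
    from this[OF a b] show "x1 + x2 + x3 = y1 + y2 + y3" "1 / x1 + 1 / x2 + 1 / x3 = 1 / y1 + 1 / y2 + 1 / y3"
      by auto
  qed
  have "x2 * x3 + x1 * x3 + x1 * x2 = y2 * y3 + y1 * y3 + y1 * y2"
  proof -
    have "1 / x1 + 1 / x2 + 1 / x3 = x2 * x3 + x1 * x3 + x1 * x2"
      using assms(1) ne by (simp add: field_simps)
    moreover have "1 / y1 + 1 / y2 + 1 / y3 = y2 * y3 + y1 * y3 + y1 * y2"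
      using assms(2) ne by (simp add: field_simps)
    ultimately show ?thesis using s(2) by simp
  qed
  then have "(T - x1) * (T - x2) * (T - x3) = (T - y1) * (T - y2) * (T - y3)" for T
    using s(1) assms(1,2) by algebra
  from this[of y1] this[of y2] this[of y3]
  show "y1 \<in> {x1, x2, x3}" "y2 \<in> {x1, x2, x3}" "y3 \<in> {x1, x2, x3}" by auto
qed

section \<open>Counting the nodes and the extremal points\<close>

lemma card_image_const_fibers:
  assumes "finite A" "\<And>a. a \<in> A \<Longrightarrow> card {b \<in> A. f b = f a} = k"
  shows "card A = k * card (f ` A)"
proof -
  have "card A = (\<Sum>y\<in>f ` A. card {b \<in> A. f b = y})"
    using sum.image_gen[OF assms(1), of "\<lambda>_. 1 :: nat" f] by simp
  also have "\<dots> = (\<Sum>y\<in>f ` A. k)" using assms(2) by (intro sum.cong) auto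
  finally show ?thesis by simp
qed

text \<open>An ordered pair encodes an ordered triple of product 1, so points of the plane are
  counted as pairs divided by the number of orderings.\<close>

definition deltoid_point :: "complex \<times> complex \<Rightarrow> complex \<times> complex" where
  "deltoid_point = (\<lambda>(x1, x2). (dx x1 x2 (1 / (x1 * x2)), dy x1 x2 (1 / (x1 * x2))))"

lemma deltoid_point_perm:
  assumes "x1 * x2 * x3 = (1::complex)"
  shows "deltoid_point (x1, x2) = (dx x1 x2 x3, dy x1 x2 x3)" "deltoid_point (x1, x3) = (dx x1 x2 x3, dy x1 x2 x3)"
    "deltoid_point (x2, x1) = (dx x1 x2 x3, dy x1 x2 x3)" "deltoid_point (x2, x3) = (dx x1 x2 x3, dy x1 x2 x3)"
    "deltoid_point (x3, x1) = (dx x1 x2 x3, dy x1 x2 x3)" "deltoid_point (x3, x2) = (dx x1 x2 x3, dy x1 x2 x3)"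
proof -
  have ne: "x1 \<noteq> 0" "x2 \<noteq> 0" "x3 \<noteq> 0" using assms by auto
  have "1 / (x1 * x2) = x3" "1 / (x1 * x3) = x2" "1 / (x2 * x1) = x3"
    "1 / (x2 * x3) = x1" "1 / (x3 * x1) = x2" "1 / (x3 * x2) = x1"
    using assms ne by (simp_all add: field_simps)
  then show "deltoid_point (x1, x2) = (dx x1 x2 x3, dy x1 x2 x3)" "deltoid_point (x1, x3) = (dx x1 x2 x3, dy x1 x2 x3)"
    "deltoid_point (x2, x1) = (dx x1 x2 x3, dy x1 x2 x3)" "deltoid_point (x2, x3) = (dx x1 x2 x3, dy x1 x2 x3)"
    "deltoid_point (x3, x1) = (dx x1 x2 x3, dy x1 x2 x3)" "deltoid_point (x3, x2) = (dx x1 x2 x3, dy x1 x2 x3)"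
    by (simp_all add: deltoid_point_def) (simp_all add: dx_def dy_def algebra_simps)
qed

lemma finite_nth_roots: "c \<noteq> 0 \<Longrightarrow> n > 0 \<Longrightarrow> finite {x::complex. x ^ n = c}"
  using card_nth_roots[of c n] card.infinite by force

text \<open>The product relation gives the third entry the value \<open>Y = 1\<close>, so it differs
  from the other two without a separate condition.\<close>

definition nodes :: "nat \<Rightarrow> (complex \<times> complex) set" where
  "nodes d = {(dx x1 x2 x3, dy x1 x2 x3) | x1 x2 x3.
     x1 * x2 * x3 = 1 \<and> x1 \<noteq> x2 \<and> x1 ^ d = om \<and> x2 ^ d = om}"

text \<open>For \<open>c = 1\<close> and \<open>c = om\<^sup>2\<close> the common value \<open>om\<^sup>2 c\<close> of the \<open>Y\<^sub>k\<close> is a primitive cube root of unity,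
  so the folding polynomial takes the value \<open>-1\<close>; the remaining choice \<open>c = om\<^sup>4\<close> gives the value 8.\<close>

definition centers :: "nat \<Rightarrow> (complex \<times> complex) set" where
  "centers d = {(dx x1 x2 x3, dy x1 x2 x3) | x1 x2 x3 c.
     x1 * x2 * x3 = 1 \<and> x1 \<noteq> x2 \<and> x1 \<noteq> x3 \<and> x2 \<noteq> x3 \<and> c \<in> {1, om ^ 2} \<and>
     x1 ^ d = c \<and> x2 ^ d = c \<and> x3 ^ d = c}"

text \<open>A node comes from exactly two of the \<open>d * (d - 1)\<close> ordered pairs of
  distinct roots, a pair and its swap: the third entry is no \<open>d\<close>-th root of
  \<open>om\<close> because \<open>om ^ 3\<close> is not 1.\<close>

lemma card_nodes:
  assumes "d > 0"
  shows "finite (nodes d)" "2 * card (nodes d) = d * (d - 1)"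
proof -
  let ?R = "{x. x ^ d = om}"
  define A where "A = {(x, y). x \<in> ?R \<and> y \<in> ?R \<and> x \<noteq> y}"
  have cR: "card ?R = d" and fR: "finite ?R"
    using card_nth_roots finite_nth_roots om_powers assms by auto
  have A: "A = ?R \<times> ?R - (\<lambda>x. (x, x)) ` ?R" by (auto simp: A_def)
  have finA: "finite A" using fR by (auto simp: A)
  have cA: "card A = d * d - d"
    unfolding A using fR cR
    by (subst card_Diff_subset) (auto simp: card_cartesian_product card_image inj_on_def)
  have img: "nodes d = deltoid_point ` A"
  proof (intro equalityI subsetI)
    fix p assume "p \<in> nodes d"
    then obtain x1 x2 x3 where *: "p = (dx x1 x2 x3, dy x1 x2 x3)" "x1 * x2 * x3 = 1" "x1 \<noteq> x2" "x1 ^ d = om" "x2 ^ d = om"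
      by (auto simp: nodes_def)
    then have "p = deltoid_point (x1, x2)" using deltoid_point_perm(1)[OF *(2)] by simp
    then show "p \<in> deltoid_point ` A" using * by (auto simp: A_def)
  next
    fix p assume "p \<in> deltoid_point ` A"
    then obtain x1 x2 where *: "p = deltoid_point (x1, x2)" "x1 ^ d = om" "x2 ^ d = om" "x1 \<noteq> x2" by (auto simp: A_def)
    then have "x1 \<noteq> 0" "x2 \<noteq> 0" using om_powers assms by (auto simp: zero_power)
    then have 1: "x1 * x2 * (1 / (x1 * x2)) = 1" by simp
    show "p \<in> nodes d" unfolding nodes_def using * 1 deltoid_point_perm(1)[OF 1] by blast
  qed
  have "card {b \<in> A. deltoid_point b = deltoid_point a} = 2" if "a \<in> A" for a
  proof -
    obtain x1 x2 where a: "a = (x1, x2)" by fastforce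
    have x: "x1 ^ d = om" "x2 ^ d = om" "x1 \<noteq> x2" using that by (auto simp: A_def a)
    define x3 where "x3 = 1 / (x1 * x2)"
    have nz: "x1 \<noteq> 0" "x2 \<noteq> 0" using x om_powers assms by (auto simp: zero_power)
    then have p: "x1 * x2 * x3 = 1" by (simp add: x3_def)
    have x3: "x3 ^ d \<noteq> om"
    proof
      assume "x3 ^ d = om"
      then have "om * om * om = (x1 * x2 * x3) ^ d" using x by (simp add: power_mult_distrib)
      then show False using om_powers(1) p by (simp add: power3_eq_cube)
    qed
    have "{b \<in> A. deltoid_point b = deltoid_point a} = {(x1, x2), (x2, x1)}"
    proof (intro equalityI subsetI)
      fix b assume b: "b \<in> {b \<in> A. deltoid_point b = deltoid_point a}"
      obtain y1 y2 where bb: "b = (y1, y2)" by fastforce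
      have y: "y1 ^ d = om" "y2 ^ d = om" "y1 \<noteq> y2" using b by (auto simp: A_def bb)
      have "y1 \<noteq> 0" "y2 \<noteq> 0" using y om_powers assms by (auto simp: zero_power)
      then have py: "y1 * y2 * (1 / (y1 * y2)) = 1" by simp
      have "dx x1 x2 x3 = dx y1 y2 (1 / (y1 * y2))" "dy x1 x2 x3 = dy y1 y2 (1 / (y1 * y2))"
        using b by (auto simp: deltoid_point_def bb a x3_def)
      from deltoid_eqD[OF p py this] have "y1 \<in> {x1, x2, x3}" "y2 \<in> {x1, x2, x3}" by auto
      then show "b \<in> {(x1, x2), (x2, x1)}" using y x3 by (auto simp: bb)
    next
      fix b assume "b \<in> {(x1, x2), (x2, x1)}"
      then show "b \<in> {b \<in> A. deltoid_point b = deltoid_point a}" using x deltoid_point_perm(1,3)[OF p] by (auto simp: A_def a)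
    qed
    then show ?thesis using x by simp
  qed
  from card_image_const_fibers[OF finA this] have "card A = 2 * card (nodes d)" by (simp add: img)
  then show "2 * card (nodes d) = d * (d - 1)" using cA by (simp add: diff_mult_distrib2)
  show "finite (nodes d)" using finA by (simp add: img)
qed

text \<open>Inclusion-exclusion: each of the three coincidences in
  \<open>(x, y, 1 / (x * y))\<close> concerns \<open>d\<close> of the \<open>d * d\<close> pairs,
  and any two of them imply the third, at the pairs \<open>(x, x)\<close> with
  \<open>x ^ 3 = 1\<close>. The condition \<open>c ^ 3 = 1\<close> keeps \<open>1 / (x * x)\<close>
  among the roots.\<close>

lemma card_distinct_root_triples:
  fixes c :: complex
  assumes "d > 0" "c ^ 3 = 1"
  defines "A \<equiv> {(x, y). x ^ d = c \<and> y ^ d = c \<and> x \<noteq> y \<and> x * x * y \<noteq> 1 \<and> x * y * y \<noteq> 1}"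
  shows "finite A" "card A + 3 * d = d * d + 2 * card {x. x ^ 3 = 1 \<and> x ^ d = c}"
proof -
  let ?R = "{x. x ^ d = c}"
  let ?T = "{x. x ^ 3 = 1 \<and> x ^ d = c}"
  have c0: "c \<noteq> 0" using assms(2) by auto
  have cR: "card ?R = d" and fR: "finite ?R"
    using card_nth_roots finite_nth_roots c0 assms by auto
  have x0: "x \<noteq> 0" if "x \<in> ?R" for x using that c0 assms(1) by (auto simp: zero_power)
  have fT: "finite ?T" by (rule finite_subset[OF _ fR]) auto
  have TR: "?T \<subseteq> ?R" by auto
  have inv: "1 / (x * x) \<in> ?R" if "x \<in> ?R" for x
  proof -
    have "c * (c * c) = 1" using assms(2) by (simp add: power3_eq_cube mult.assoc)
    then have "1 / (c * c) = c" using c0 by (simp add: field_simps)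
    then show ?thesis using that by (simp add: power_divide power_mult_distrib)
  qed
  let ?B = "?R - ?T"
  have cB: "card ?B = d - card ?T" using cR card_Diff_subset[OF fT TR] by simp
  have cub: "x * (x * x) \<noteq> 1" "x \<noteq> 0" if "x \<in> ?B" for x using that x0[of x] by (auto simp: power3_eq_cube mult.assoc)
  \<comment> \<open>\<open>D0\<close> holds the triple coincidences; \<open>D1\<close>,
    \<open>D2\<close>, \<open>D3\<close> hold the pairs with exactly one.\<close>
  define D0 where "D0 = (\<lambda>x. (x, x)) ` ?T"
  define D1 where "D1 = (\<lambda>x. (x, x)) ` ?B"
  define D2 where "D2 = (\<lambda>x. (x, 1 / (x * x))) ` ?B"
  define D3 where "D3 = (\<lambda>x. (1 / (x * x), x)) ` ?B"
  have cards: "card D0 = card ?T" "card D1 = d - card ?T" "card D2 = d - card ?T" "card D3 = d - card ?T"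
    unfolding D0_def D1_def D2_def D3_def cB[symmetric] by (intro card_image; auto simp: inj_on_def)+
  have fins: "finite D0" "finite D1" "finite D2" "finite D3"
    using fR fT by (auto simp: D0_def D1_def D2_def D3_def)
  have sub: "D0 \<subseteq> ?R \<times> ?R" "D1 \<subseteq> ?R \<times> ?R" "D2 \<subseteq> ?R \<times> ?R" "D3 \<subseteq> ?R \<times> ?R"
    unfolding D0_def D1_def D2_def D3_def using inv by auto
  have ne1: "1 / (x * x) \<noteq> x" if "x \<in> ?B" for x using cub[OF that] by (simp add: field_simps)
  have ne2: "\<not> (y = 1 / (x * x) \<and> x = 1 / (y * y))" if "x \<in> ?B" for x y
  proof
    assume "y = 1 / (x * x) \<and> x = 1 / (y * y)"
    then have e: "x * x * y = 1" "x * (y * y) = 1" using cub[OF that] by (auto simp: field_simps)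
    then have "x * y * (x - y) = 0" by (simp add: algebra_simps)
    then have "x = y" using e by auto
    then show False using e cub[OF that] by (simp add: mult.assoc)
  qed
  have disj: "D0 \<inter> D1 = {}" "(D0 \<union> D1) \<inter> D2 = {}" "(D0 \<union> D1 \<union> D2) \<inter> D3 = {}" "A \<inter> (D0 \<union> D1 \<union> D2 \<union> D3) = {}"
  proof -
    show "D0 \<inter> D1 = {}" by (auto simp: D0_def D1_def)
    have eq: "fst p = snd p" if "p \<in> D0 \<union> D1" for p using that by (auto simp: D0_def D1_def)
    have neq: "fst p \<noteq> snd p" if "p \<in> D2 \<union> D3" for p
    proof -
      from that obtain x where x: "x \<in> ?B" "p = (x, 1 / (x * x)) \<or> p = (1 / (x * x), x)"
        unfolding D2_def D3_def by blast
      then show ?thesis using ne1[OF x(1)] by (metis fst_conv snd_conv)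
    qed
    show "(D0 \<union> D1) \<inter> D2 = {}" using eq neq by blast
    have "False" if "p \<in> D2" "p \<in> D3" for p
    proof -
      from that obtain x y where xy: "x \<in> ?B" "p = (x, 1 / (x * x))" "p = (1 / (y * y), y)"
        unfolding D2_def D3_def by blast
      then have "y = 1 / (x * x) \<and> x = 1 / (y * y)" by (metis prod.inject)
      then show False using ne2[OF xy(1)] by blast
    qed
    then show "(D0 \<union> D1 \<union> D2) \<inter> D3 = {}" using eq neq by blast
    have "(x, 1 / (x * x)) \<notin> A" "(1 / (x * x), x) \<notin> A" if "x \<in> ?B" for x
    proof -
      have "x * x * (1 / (x * x)) = 1" "1 / (x * x) * x * x = 1" using cub(2)[OF that] by simp_all
      then show "(x, 1 / (x * x)) \<notin> A" "(1 / (x * x), x) \<notin> A"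
        unfolding A_def mem_Collect_eq case_prod_conv by blast+
    qed
    then have "A \<inter> (D2 \<union> D3) = {}" unfolding D2_def D3_def by blast
    moreover have "A \<inter> (D0 \<union> D1) = {}" by (auto simp: A_def D0_def D1_def)
    ultimately show "A \<inter> (D0 \<union> D1 \<union> D2 \<union> D3) = {}" by blast
  qed
  have un: "?R \<times> ?R = A \<union> (D0 \<union> D1 \<union> D2 \<union> D3)"
  proof (intro equalityI subsetI)
    fix p assume "p \<in> ?R \<times> ?R"
    then obtain x y where p: "p = (x, y)" "x \<in> ?R" "y \<in> ?R" by auto
    have 1: "p \<in> D0 \<union> D1" if "x = y" using that p by (auto simp: D0_def D1_def)
    have 2: "p \<in> D2" if "x \<noteq> y" "x * x * y = 1"
    proof -
      have "y = 1 / (x * x)" using that x0[OF p(2)] by (simp add: field_simps)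
      moreover have "x ^ 3 \<noteq> 1"
        using that x0[OF p(2)] by (metis (no_types, lifting) mult_cancel_left mult_zero_left no_zero_divisors power3_eq_cube)
      ultimately show ?thesis using p by (auto simp: D2_def)
    qed
    have 3: "p \<in> D3" if "x \<noteq> y" "x * y * y = 1"
    proof -
      have "x = 1 / (y * y)" using that x0[OF p(3)] by (simp add: field_simps)
      moreover have "y ^ 3 \<noteq> 1"
        using that x0[OF p(3)] by (metis (no_types, lifting) mult.assoc mult_cancel_right no_zero_divisors power3_eq_cube)
      ultimately show ?thesis using p by (auto simp: D3_def)
    qed
    show "p \<in> A \<union> (D0 \<union> D1 \<union> D2 \<union> D3)" using 1 2 3 p by (auto simp: A_def)
  qed (use sub in \<open>auto simp: A_def\<close>)
  show finA: "finite A" by (rule finite_subset[of _ "?R \<times> ?R"]) (use fR in \<open>auto simp: A_def\<close>)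
  have "card (?R \<times> ?R) = card A + (card D0 + card D1 + card D2 + card D3)"
    unfolding un using disj fins finA by (simp add: card_Un_disjoint)
  then have "d * d = card A + (card ?T + 3 * (d - card ?T))"
    by (simp add: card_cartesian_product cR cards)
  moreover have "card ?T \<le> d" using card_mono[OF fR TR] cR by simp
  ultimately show "card A + 3 * d = d * d + 2 * card ?T" by simp
qed

text \<open>The preceding count for \<open>c = 1\<close> and \<open>c = om ^ 2\<close>, divided by
  the six orderings of a triple. As 3 divides \<open>d\<close>, all three cube roots of unity solve
  \<open>x ^ d = 1\<close> and none solves \<open>x ^ d = om ^ 2\<close>, so the corrections add up
  to 6 before the division.\<close>

lemma card_centers:
  assumes "d = 3 * k" "k > 0"
  shows "finite (centers d)" "3 * card (centers d) + 3 * d = d * d + 3"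
proof -
  define A where "A = (\<lambda>c::complex. {(x, y). x ^ d = c \<and> y ^ d = c \<and> x \<noteq> y \<and> x * x * y \<noteq> 1 \<and> x * y * y \<noteq> 1})"
  have d: "d > 0" using assms by simp
  have om2: "om ^ 2 \<noteq> 1" "(om ^ 2) ^ 3 = 1"
  proof -
    show "(om ^ 2) ^ 3 = 1" using om_powers(2) by (simp flip: power_mult)
    show "om ^ 2 \<noteq> 1"
    proof
      assume "om ^ 2 = 1"
      then have "om = (-1) ^ 0 \<or> om = (-1) ^ 1" by (simp add: power2_eq_1_iff)
      then show False using om_ne_pm1_power by metis
    qed
  qed
  have card1: "finite (A 1)" "card (A 1) + 3 * d = d * d + 2 * card {x::complex. x ^ 3 = 1 \<and> x ^ d = 1}"
    unfolding A_def by (rule card_distinct_root_triples[OF d]; simp)+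
  have card2: "finite (A (om ^ 2))" "card (A (om ^ 2)) + 3 * d = d * d + 2 * card {x::complex. x ^ 3 = 1 \<and> x ^ d = om ^ 2}"
    unfolding A_def by (rule card_distinct_root_triples[OF d om2(2)])+
  have T1: "{x::complex. x ^ 3 = 1 \<and> x ^ d = 1} = {x. x ^ 3 = 1}" using assms by (auto simp: power_mult)
  have T2: "{x::complex. x ^ 3 = 1 \<and> x ^ d = om ^ 2} = {}" using assms om2(1) by (auto simp: power_mult)
  define B where "B = A 1 \<union> A (om ^ 2)"
  have disj: "A 1 \<inter> A (om ^ 2) = {}" using om2(1) by (auto simp: A_def)
  have finB: "finite B" using card1(1) card2(1) by (simp add: B_def)
  have "card B = card (A 1) + card (A (om ^ 2))"
    unfolding B_def using card1(1) card2(1) disj by (intro card_Un_disjoint) auto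
  moreover have "card (A 1) + 3 * d = d * d + 2 * 3"
    using card1(2) card_nth_roots[of 1 3] by (simp add: T1)
  moreover have "card (A (om ^ 2)) + 3 * d = d * d" using card2(2) by (simp add: T2)
  ultimately have cB: "card B + 6 * d = 2 * (d * d) + 6" by simp
  have third: "x1 * x2 * x3 = 1 \<and> x3 ^ d = c \<and> x1 \<noteq> x3 \<and> x2 \<noteq> x3" if
    "(x1, x2) \<in> A c" "c \<in> {1, om ^ 2}" "x3 = 1 / (x1 * x2)" for x1 x2 x3 c
  proof -
    have x: "x1 ^ d = c" "x2 ^ d = c" "x1 \<noteq> x2" "x1 * x1 * x2 \<noteq> 1" "x1 * x2 * x2 \<noteq> 1" using that(1) by (auto simp: A_def)
    have c: "c ^ 3 = 1" "c \<noteq> 0" using that(2) om2 om_powers(3) by auto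
    have nz: "x1 \<noteq> 0" "x2 \<noteq> 0" using x c(2) d by (auto simp: zero_power)
    have p: "x1 * x2 * x3 = 1" using nz that(3) by simp
    have "c * c * x3 ^ d = (x1 * x2 * x3) ^ d" using x by (simp add: power_mult_distrib)
    then have "c * c * x3 ^ d = c * c * c" using p c(1) by (simp add: power3_eq_cube)
    then have "x3 ^ d = c" using c(2) by simp
    moreover have "x1 \<noteq> x3" using p x by (auto simp: mult_ac)
    moreover have "x2 \<noteq> x3" using p x by (auto simp: mult_ac)
    ultimately show ?thesis using p by blast
  qed
  have memA: "(x1, x2) \<in> A c" if "x1 * x2 * x3 = 1" "x1 \<noteq> x2" "x1 \<noteq> x3" "x2 \<noteq> x3" "x1 ^ d = c" "x2 ^ d = c" for x1 x2 x3 c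
  proof -
    have nz: "x1 \<noteq> 0" "x2 \<noteq> 0" using that by auto
    have "x1 * x1 * x2 \<noteq> 1"
    proof
      assume "x1 * x1 * x2 = 1"
      then have "x1 * x2 * x1 = x1 * x2 * x3" using that(1) by (simp add: mult_ac)
      then show False using nz that(3) by simp
    qed
    moreover have "x1 * x2 * x2 \<noteq> 1"
    proof
      assume "x1 * x2 * x2 = 1"
      then have "x1 * x2 * x2 = x1 * x2 * x3" using that(1) by simp
      then show False using nz that(4) by simp
    qed
    ultimately show ?thesis using that by (simp add: A_def)
  qed
  have img: "centers d = deltoid_point ` B"
  proof (intro equalityI subsetI)
    fix p assume "p \<in> centers d"
    then obtain x1 x2 x3 c where *: "p = (dx x1 x2 x3, dy x1 x2 x3)" "x1 * x2 * x3 = 1" "x1 \<noteq> x2" "x1 \<noteq> x3" "x2 \<noteq> x3"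
      "c \<in> {1, om ^ 2}" "x1 ^ d = c" "x2 ^ d = c" unfolding centers_def by blast
    have "(x1, x2) \<in> B" using memA[OF *(2-5,7,8)] *(6) by (auto simp: B_def)
    moreover have "p = deltoid_point (x1, x2)" using deltoid_point_perm(1)[OF *(2)] *(1) by simp
    ultimately show "p \<in> deltoid_point ` B" by blast
  next
    fix p assume "p \<in> deltoid_point ` B"
    then obtain x1 x2 where "(x1, x2) \<in> B" and p: "p = deltoid_point (x1, x2)" by auto
    then obtain c where c: "(x1, x2) \<in> A c" "c \<in> {1, om ^ 2}" by (auto simp: B_def)
    from third[OF c refl] deltoid_point_perm(1)[of x1 x2 "1 / (x1 * x2)"] c
    show "p \<in> centers d" unfolding centers_def p A_def by blast
  qed
  have "card {b \<in> B. deltoid_point b = deltoid_point a} = 6" if aB: "a \<in> B" for a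
  proof -
    obtain x1 x2 where a: "a = (x1, x2)" by fastforce
    then obtain c where c: "(x1, x2) \<in> A c" "c \<in> {1, om ^ 2}" using aB by (auto simp: B_def)
    define x3 where "x3 = 1 / (x1 * x2)"
    have x: "x1 ^ d = c" "x2 ^ d = c" "x1 \<noteq> x2" using c(1) by (auto simp: A_def)
    have p: "x1 * x2 * x3 = 1" and y: "x3 ^ d = c" "x1 \<noteq> x3" "x2 \<noteq> x3" using third[OF c x3_def] by auto
    have "{b \<in> B. deltoid_point b = deltoid_point a} = {(x1, x2), (x1, x3), (x2, x1), (x2, x3), (x3, x1), (x3, x2)}"
    proof (intro equalityI subsetI)
      fix b assume b: "b \<in> {b \<in> B. deltoid_point b = deltoid_point a}"
      obtain y1 y2 where bb: "b = (y1, y2)" by fastforce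
      have "(y1, y2) \<in> B" using b by (simp add: bb)
      then obtain c' where c': "(y1, y2) \<in> A c'" "c' \<in> {1, om ^ 2}" by (auto simp: B_def)
      have py: "y1 * y2 * (1 / (y1 * y2)) = 1" using third[OF c' refl] by blast
      have "dx x1 x2 x3 = dx y1 y2 (1 / (y1 * y2))" "dy x1 x2 x3 = dy y1 y2 (1 / (y1 * y2))"
        using b by (auto simp: deltoid_point_def bb a x3_def)
      from deltoid_eqD[OF p py this] have "y1 \<in> {x1, x2, x3}" "y2 \<in> {x1, x2, x3}" by auto
      moreover have "y1 \<noteq> y2" using c' by (auto simp: A_def)
      ultimately show "b \<in> {(x1, x2), (x1, x3), (x2, x1), (x2, x3), (x3, x1), (x3, x2)}" by (auto simp: bb)
    next
      fix b assume b: "b \<in> {(x1, x2), (x1, x3), (x2, x1), (x2, x3), (x3, x1), (x3, x2)}"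
      have "b \<in> A c"
        using b x y memA[of x1 x2 x3] memA[of x1 x3 x2] memA[of x2 x1 x3] memA[of x2 x3 x1] memA[of x3 x1 x2] memA[of x3 x2 x1] p
        by (auto simp: mult_ac)
      then have "b \<in> B" using c(2) by (auto simp: B_def)
      moreover have "deltoid_point b = deltoid_point a" using b deltoid_point_perm[OF p] by (auto simp: a)
      ultimately show "b \<in> {b \<in> B. deltoid_point b = deltoid_point a}" by blast
    qed
    then show ?thesis using x y by simp
  qed
  from card_image_const_fibers[OF finB this] have "card B = 6 * card (centers d)" by (simp add: img)
  then show "3 * card (centers d) + 3 * d = d * d + 3" using cB by simp
  show "finite (centers d)" using finB by (simp add: img)
qed

section \<open>Critical points\<close>

lemma cdiff_J: "cdiff (\<lambda>p. J d (p $ 1) (p $ 2)) p"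
  unfolding J_def J_hat_def L_def by (intro cdiff_intros cdiff_divide_const)

lemma critical_triple_cases:
  fixes Y1 Y2 Y3 :: complex
  assumes "Y1 * Y2 * Y3 = 1" "(1 + Y2) * (Y1 - Y3) = 0" "(1 + Y1) * (Y2 - Y3) = 0"
  shows "(Y1 = Y2 \<and> Y2 = Y3 \<and> Y1 ^ 3 = 1) \<or> (Y1 = -1 \<and> Y2 = -1 \<and> Y3 = 1) \<or>
    (Y1 = -1 \<and> Y3 = -1 \<and> Y2 = 1) \<or> (Y2 = -1 \<and> Y3 = -1 \<and> Y1 = 1)"
proof -
  have m: "y = -1" if "1 + y = 0" for y :: complex using that by (metis add_eq_0_iff)
  from assms(2,3) have "Y2 = -1 \<or> Y1 = Y3" "Y1 = -1 \<or> Y2 = Y3"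
    using m by (metis mult_eq_0_iff right_minus_eq)+
  then show ?thesis using assms(1) by (auto simp: power3_eq_cube)
qed

text \<open>Differentiate along the curve \<open>(x\<^sub>1 e\<^sup>t, x\<^sub>2, x\<^sub>3 e\<^sup>-\<^sup>t)\<close>.\<close>

lemma critical_point_equation:
  fixes F :: "complex^3 \<Rightarrow> complex"
  assumes d: "d > 0" and F: "\<And>p. F p = J d (p$1) (p$2) + g (p$3)"
    and x: "x1 * x2 * x3 = 1" and p: "p $ 1 = dx x1 x2 x3" "p $ 2 = dy x1 x2 x3"
    and crit: "(F has_derivative (\<lambda>_. 0)) (at p)"
  shows "(1 + om ^ 2 * x2 ^ d) * (om ^ 2 * x1 ^ d - om ^ 2 * x3 ^ d) = 0"
proof -
  define z where "z = (\<lambda>t. x1 * exp t + x2 + x3 * exp (- t))"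
  define z' where "z' = (\<lambda>t. exp (- t) / x1 + 1 / x2 + exp t / x3)"
  define \<gamma> :: "complex \<Rightarrow> complex^3" where
    "\<gamma> = (\<lambda>t. vector [(z t + z' t) / 2, of_real (sqrt 3) * ((z t - z' t) / (2 * \<i>)), p $ 3])"
  have ne: "x1 \<noteq> 0" "x2 \<noteq> 0" "x3 \<noteq> 0" using x by auto
  have dxy: "dx (x1 * exp t) x2 (x3 * exp (- t)) = \<gamma> t $ 1" "dy (x1 * exp t) x2 (x3 * exp (- t)) = \<gamma> t $ 2" for t
    using ne by (auto simp: dx_def dy_def \<gamma>_def z_def z'_def exp_minus field_simps)
  have \<gamma>0: "\<gamma> 0 = p" using dxy[of 0] p by (simp add: vec_eq_iff forall_3 \<gamma>_def)
  obtain D where D: "(\<gamma> has_derivative D) (at 0)"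
  proof -
    have dz: "(z has_field_derivative (x1 - x3)) (at 0)" "(z' has_field_derivative (1 / x3 - 1 / x1)) (at 0)"
      unfolding z_def z'_def by (auto intro!: derivative_eq_intros simp: ne)
    define a b where ab: "a = ((x1 - x3) + (1 / x3 - 1 / x1)) / 2"
      "b = of_real (sqrt 3) * (((x1 - x3) - (1 / x3 - 1 / x1)) / (2 * \<i>))"
    have "((\<lambda>t. \<gamma> t $ 1) has_derivative (*) a) (at 0)" "((\<lambda>t. \<gamma> t $ 2) has_derivative (*) b) (at 0)"
      unfolding has_field_derivative_def[symmetric] \<gamma>_def vector_3 ab
      by (intro DERIV_add DERIV_diff DERIV_cdivide DERIV_cmult dz)+
    moreover have "((\<lambda>t. \<gamma> t $ 3) has_derivative (\<lambda>t. 0)) (at 0)" by (simp add: \<gamma>_def)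
    ultimately have "(\<gamma> has_derivative (\<lambda>t. vector [a * t, b * t, 0])) (at 0)"
      by (intro has_derivative_vec_nth_iff[THEN iffD2]) (simp add: forall_3)
    then show thesis by (rule that)
  qed
  define Y1 Y2 Y3 where Y: "Y1 = om ^ 2 * x1 ^ d" "Y2 = om ^ 2 * x2 ^ d" "Y3 = om ^ 2 * x3 ^ d"
  have "((\<lambda>t. F (\<gamma> t)) has_derivative (\<lambda>_. 0)) (at 0)"
    using has_derivative_compose[OF D] crit \<gamma>0 by simp
  then have "((\<lambda>t. F (\<gamma> t)) has_field_derivative 0) (at 0)" unfolding has_field_derivative_def lambda_zero .
  \<comment> \<open>Along the curve \<open>Y1\<close> and \<open>Y3\<close> are multiplied by
    inverse exponentials, while \<open>Y2\<close> and the third coordinate stay fixed.\<close>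
  moreover have "F (\<gamma> t) = (1 + Y1 * exp (of_nat d * t)) * (1 + Y2) * (1 + Y3 * exp (- (of_nat d * t))) + g (p $ 3)" for t
  proof -
    have "x1 * exp t * x2 * (x3 * exp (- t)) = (x1 * x2 * x3) * (exp t * exp (- t))" by (simp only: mult_ac)
    then have "x1 * exp t * x2 * (x3 * exp (- t)) = 1" using x by (simp add: exp_minus)
    from J_deltoid[OF d this] show ?thesis
      unfolding F dxy by (simp add: Y \<gamma>_def power_mult_distrib exp_of_nat_mult[symmetric] mult.assoc)
  qed
  ultimately have "((\<lambda>t. (1 + Y1 * exp (of_nat d * t)) * (1 + Y2) * (1 + Y3 * exp (- (of_nat d * t))) + g (p $ 3))
     has_field_derivative 0) (at 0)" by simp
  moreover have "((\<lambda>t. (1 + Y1 * exp (of_nat d * t)) * (1 + Y2) * (1 + Y3 * exp (- (of_nat d * t))) + g (p $ 3))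
     has_field_derivative (of_nat d * ((1 + Y2) * (Y1 - Y3)))) (at 0)"
    by (auto intro!: derivative_eq_intros simp: algebra_simps)
  ultimately have "of_nat d * ((1 + Y2) * (Y1 - Y3)) = 0" using DERIV_unique by blast
  then show ?thesis using d by (simp add: Y)
qed

text \<open>At a point of the branch curve the folding map has a quadratic branch point: with
  \<open>c = e\<^sup>s + e\<^sup>-\<^sup>s - 2\<close> the triple \<open>(x e\<^sup>s, x e\<^sup>-\<^sup>s, x\<^sub>3)\<close> moves linearly in \<open>c\<close>.\<close>

lemma critical_point_confluent:
  fixes F :: "complex^3 \<Rightarrow> complex"
  assumes d: "d > 0" and F: "\<And>p. F p = J d (p$1) (p$2) + g (p$3)"
    and x: "x * x * x3 = 1" and p: "p $ 1 = dx x x x3" "p $ 2 = dy x x x3"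
    and crit: "(F has_derivative (\<lambda>_. 0)) (at p)"
  shows "om ^ 2 * x3 ^ d = -1"
proof (rule ccontr)
  define Y Y3 where Y: "Y = om ^ 2 * x ^ d" "Y3 = om ^ 2 * x3 ^ d"
  assume "om ^ 2 * x3 ^ d \<noteq> -1"
  then have Y3: "1 + Y3 \<noteq> 0" by (simp add: Y add_eq_0_iff)
  have ne: "x \<noteq> 0" "x3 \<noteq> 0" using x by auto
  define K where "K = Y * (1 + Y3)"
  have K: "K \<noteq> 0" using Y3 ne om_powers(3) by (simp add: K_def Y)
  \<comment> \<open>Since \<open>exp s + exp (- s) = 2 + c\<close>, splitting the double entry
    \<open>x\<close> into \<open>x * exp s\<close> and \<open>x * exp (- s)\<close> adds
    \<open>c\<close> times \<open>v\<close> to the point.\<close>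
  define v :: "complex^3" where
    "v = vector [(x + 1 / x) / 2, of_real (sqrt 3) * ((x - 1 / x) / (2 * \<i>)), 0]"
  have der: "((\<lambda>c. F (p + c *s v)) has_field_derivative 0) (at 0)"
    using line_has_field_derivative[of F "\<lambda>_. 0" p 0 v] crit by simp
  define c where "c = (\<lambda>s. exp s + exp (- s) - 2 :: real)"
  have val: "F (p + of_real (c s) *s v) - F p = K * of_real (c (real d * s))" for s
  proof -
    let ?e = "exp (of_real s) :: complex" and ?f = "exp (- of_real s) :: complex"
    have ef: "?e * ?f = 1" by (simp add: exp_minus)
    have cs: "complex_of_real (c s) = ?e + ?f - 2" by (simp add: c_def exp_of_real[symmetric])
    have cd: "complex_of_real (c (real d * s)) = ?e ^ d + ?f ^ d - 2"
      by (simp add: c_def exp_of_real[symmetric] exp_of_nat_mult[symmetric])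
    have "1 / (x * ?e) = ?f / x" "1 / (x * ?f) = ?e / x" by (simp_all add: exp_minus field_simps)
    then have "dx (x * ?e) (x * ?f) x3 = (p + of_real (c s) *s v) $ 1" "dy (x * ?e) (x * ?f) x3 = (p + of_real (c s) *s v) $ 2"
      by (simp_all add: p v_def dx_def dy_def cs add_divide_distrib diff_divide_distrib algebra_simps)
    moreover have "(x * ?e) * (x * ?f) * x3 = 1" using x ef by (simp add: mult_ac)
    ultimately have J1: "J d ((p + of_real (c s) *s v) $ 1) ((p + of_real (c s) *s v) $ 2) = (1 + Y * ?e ^ d) * (1 + Y * ?f ^ d) * (1 + Y3)"
      using J_deltoid[OF d, of "x * ?e" "x * ?f" x3] by (simp add: Y power_mult_distrib mult.assoc)
    have J2: "J d (p $ 1) (p $ 2) = (1 + Y) * (1 + Y) * (1 + Y3)"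
      using J_deltoid[OF d x] by (simp add: p Y)
    have g3: "(p + of_real (c s) *s v) $ 3 = p $ 3" by (simp add: v_def)
    have alg: "(1 + Y * a) * (1 + Y * b) * (1 + Y3) - (1 + Y) * (1 + Y) * (1 + Y3) = Y * (1 + Y3) * (a + b - 2)"
      if "a * b = 1" for a b :: complex
    proof -
      have "(1 + Y * a) * (1 + Y * b) * (1 + Y3) - (1 + Y) * (1 + Y) * (1 + Y3)
        = Y * (1 + Y3) * (a + b - 2) + Y * Y * (1 + Y3) * (a * b - 1)"
        by (simp add: algebra_simps)
      then show ?thesis by (simp add: that)
    qed
    have "?e ^ d * ?f ^ d = 1" by (simp add: ef flip: power_mult_distrib)
    then have eq: "(1 + Y * ?e ^ d) * (1 + Y * ?f ^ d) * (1 + Y3) - (1 + Y) * (1 + Y) * (1 + Y3) = K * (?e ^ d + ?f ^ d - 2)"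
      using alg unfolding K_def by blast
    show ?thesis unfolding F cd J1 J2 g3 eq[symmetric] by (rule add_diff_cancel_right)
  qed
  have cpos: "c s > 0" if "s > 0" for s
  proof -
    have "c s = (exp (s / 2) - exp (- s / 2))\<^sup>2"
      by (simp add: c_def power2_eq_square algebra_simps exp_add[symmetric])
    moreover have "exp (s / 2) - exp (- s / 2) \<noteq> 0" using that by simp
    ultimately show ?thesis by simp
  qed
  \<comment> \<open>By \<open>val\<close> the difference quotient along \<open>v\<close> is
    \<open>K * c (d * s) / c s\<close>. This bound keeps its norm at least \<open>norm K\<close>, so
    the derivative cannot vanish.\<close>
  have mono: "c (real d * s) \<ge> c s" if "s > 0" for s
  proof -
    have "cosh s \<le> cosh (real d * s)"
      using that d by (subst cosh_real_nonneg_le_iff) (auto simp: mult_le_cancel_right1)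
    then show ?thesis by (simp add: cosh_def c_def)
  qed
  have "(\<lambda>c. (F (p + c *s v) - F p) / c) \<midarrow>0\<rightarrow> 0"
    using der unfolding DERIV_def by simp
  moreover have "filterlim (\<lambda>s. complex_of_real (c s)) (at 0) (at_right 0)"
  proof (rule filterlim_atI)
    have "((\<lambda>s. complex_of_real (c s)) \<longlongrightarrow> of_real (exp 0 + exp (- 0) - 2)) (at_right 0)"
      unfolding c_def by (intro tendsto_intros)
    then show "((\<lambda>s. complex_of_real (c s)) \<longlongrightarrow> 0) (at_right 0)" by simp
    have "\<forall>\<^sub>F s::real in at_right 0. 0 < s" by (simp add: eventually_at_right_less)
    then show "\<forall>\<^sub>F s in at_right 0. complex_of_real (c s) \<noteq> 0"
      by eventually_elim (use cpos in force)
  qed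
  ultimately have "((\<lambda>s. (F (p + of_real (c s) *s v) - F p) / of_real (c s)) \<longlongrightarrow> 0) (at_right 0)"
    by (rule filterlim_compose)
  then have "\<forall>\<^sub>F s in at_right 0. norm ((F (p + of_real (c s) *s v) - F p) / of_real (c s)) < norm K"
    using K by (auto dest: tendstoD[where e = "norm K"])
  moreover have "\<forall>\<^sub>F s::real in at_right 0. 0 < s" by (simp add: eventually_at_right_less)
  ultimately have "\<forall>\<^sub>F s::real in at_right 0. False"
  proof eventually_elim
    case (elim s)
    have "norm ((F (p + of_real (c s) *s v) - F p) / of_real (c s)) = norm K * (c (real d * s) / c s)"
      using cpos[OF elim(2)] mono[OF elim(2)] by (simp add: val norm_mult norm_divide)
    also have "\<dots> \<ge> norm K * 1"
      using cpos[OF elim(2)] mono[OF elim(2)] by (intro mult_left_mono) auto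
    finally show False using elim(1) by simp
  qed
  then show False by simp
qed

text \<open>If two entries coincided, their \<open>Y\<close> values would agree and
  \<open>critical_point_confluent\<close> would make the remaining one -1, which fits none of the
  cases of \<open>critical_triple_cases\<close>. Relabelling moves the entry with
  \<open>Y = 1\<close> to the third place.\<close>

lemma singular_point_triple:
  fixes F :: "complex^3 \<Rightarrow> complex"
  assumes d: "d > 0" and F: "\<And>p. F p = J d (p$1) (p$2) + g (p$3)"
    and crit: "(F has_derivative (\<lambda>_. 0)) (at p)"
  obtains x1 x2 x3 where "x1 * x2 * x3 = 1" "p $ 1 = dx x1 x2 x3" "p $ 2 = dy x1 x2 x3"
    "x1 \<noteq> x2" "x1 \<noteq> x3" "x2 \<noteq> x3"
    "(om ^ 2 * x1 ^ d = om ^ 2 * x2 ^ d \<and> om ^ 2 * x2 ^ d = om ^ 2 * x3 ^ d \<and> (om ^ 2 * x1 ^ d) ^ 3 = 1) \<or>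
      (om ^ 2 * x1 ^ d = -1 \<and> om ^ 2 * x2 ^ d = -1 \<and> om ^ 2 * x3 ^ d = 1)"
proof -
  obtain x1 x2 x3 where x: "x1 * x2 * x3 = 1" and p: "p $ 1 = dx x1 x2 x3" "p $ 2 = dy x1 x2 x3"
    by (rule deltoid_surj)
  define Y where "Y = (\<lambda>x. om ^ 2 * x ^ d)"
  have prod: "Y x1 * Y x2 * Y x3 = 1"
  proof -
    have "Y x1 * Y x2 * Y x3 = om ^ 6 * (x1 * x2 * x3) ^ d"
      by (simp add: Y_def power_mult_distrib)
    then show ?thesis by (simp add: om_powers x)
  qed
  have 1: "(1 + Y x2) * (Y x1 - Y x3) = 0"
    unfolding Y_def by (rule critical_point_equation[OF d F x p crit])
  have 2: "(1 + Y x1) * (Y x2 - Y x3) = 0"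
    unfolding Y_def by (rule critical_point_equation[OF d F _ _ _ crit]) (use x p deltoid_perm(1,4)[of x1 x2 x3] in \<open>simp_all add: mult_ac\<close>)
  note cases = critical_triple_cases[OF prod 1 2]
  have neg: "(1::complex) \<noteq> -1" "(-1::complex) ^ 3 \<noteq> 1" by simp_all
  have c12: "x1 \<noteq> x2"
  proof
    assume e: "x1 = x2"
    have "Y x3 = -1" unfolding Y_def
      by (rule critical_point_confluent[OF d F _ _ _ crit, of x1]) (use x p e in auto)
    with cases neg show False unfolding e by metis
  qed
  have c13: "x1 \<noteq> x3"
  proof
    assume e: "x1 = x3"
    have "Y x2 = -1" unfolding Y_def
    proof (rule critical_point_confluent[OF d F _ _ _ crit])
      show "x1 * x1 * x2 = 1" using x unfolding e by (simp only: mult_ac)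
      show "p $ 1 = dx x1 x1 x2" "p $ 2 = dy x1 x1 x2"
        using p deltoid_perm(2,5)[of x1 x2 x1] unfolding e by (simp_all only:)
    qed
    with cases neg show False unfolding e by metis
  qed
  have c23: "x2 \<noteq> x3"
  proof
    assume e: "x2 = x3"
    have "Y x1 = -1" unfolding Y_def
    proof (rule critical_point_confluent[OF d F _ _ _ crit])
      show "x2 * x2 * x1 = 1" using x unfolding e by (simp only: mult_ac)
      show "p $ 1 = dx x2 x2 x1" "p $ 2 = dy x2 x2 x1"
        using p deltoid_perm(3,6)[of x2 x2 x1] unfolding e by (simp_all only:)
    qed
    with cases neg show False unfolding e by metis
  qed
  have perm0: "x1 * x3 * x2 = 1" "x2 * x3 * x1 = 1" using x by (simp_all only: mult_ac)
  have perm: "p $ 1 = dx x1 x3 x2" "p $ 2 = dy x1 x3 x2"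
     "p $ 1 = dx x2 x3 x1" "p $ 2 = dy x2 x3 x1"
    unfolding deltoid_perm(2,5)[of x1 x3 x2] deltoid_perm(3,6)[of x2 x3 x1]
    by (rule p)+
  from cases consider "(Y x1 = Y x2 \<and> Y x2 = Y x3 \<and> Y x1 ^ 3 = 1) \<or> (Y x1 = -1 \<and> Y x2 = -1 \<and> Y x3 = 1)"
    | "Y x1 = -1 \<and> Y x3 = -1 \<and> Y x2 = 1" | "Y x2 = -1 \<and> Y x3 = -1 \<and> Y x1 = 1" by blast
  then show thesis
  proof cases
    case 1
    then show thesis using that[OF x p c12 c13 c23] by (simp add: Y_def)
  next
    case 2
    then show thesis using that[OF perm0(1) perm(1,2) c13 c12 c23[symmetric]] by (simp add: Y_def)
  next
    case 3
    then show thesis using that[OF perm0(2) perm(3,4) c23 c12[symmetric] c13[symmetric]] by (simp add: Y_def)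
  qed
qed

lemma singular_point_fibre:
  fixes F :: "complex^3 \<Rightarrow> complex"
  assumes F: "\<And>p. F p = J d (p$1) (p$2) + (poly B (p$3) + 1) / 2"
    and crit: "(F has_derivative (\<lambda>_. 0)) (at p)"
  shows "poly (pderiv B) (p $ 3) = 0"
proof -
  have 1: "((\<lambda>c. F (p + c *s axis 3 1)) has_field_derivative 0) (at 0)"
    using line_has_field_derivative[of F "\<lambda>_. 0" p 0 "axis 3 1"] crit by simp
  have "((\<lambda>c. J d (p$1) (p$2) + (poly B (p$3 + c) + 1) / 2) has_field_derivative (poly (pderiv B) (p $ 3) / 2)) (at 0)"
    by (auto intro!: derivative_eq_intros DERIV_chain2[OF poly_DERIV])
  then have "((\<lambda>c. F (p + c *s axis 3 1)) has_field_derivative (poly (pderiv B) (p $ 3) / 2)) (at 0)"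
    by (simp add: F axis_def)
  from DERIV_unique[OF 1 this] show ?thesis by simp
qed

section \<open>Local normal forms\<close>

lemma vec3_derivative:
  fixes f :: "complex^3 \<Rightarrow> complex^3"
  assumes "((\<lambda>x. f x $ 1) has_derivative D1) (at p)" "((\<lambda>x. f x $ 2) has_derivative D2) (at p)"
    "((\<lambda>x. f x $ 3) has_derivative D3) (at p)"
  shows "(f has_derivative (\<lambda>h. vector [D1 h, D2 h, D3 h])) (at p)"
  by (rule has_derivative_vec_nth_iff[THEN iffD2]) (simp add: forall_3 assms)

lemma nth_has_derivative: "((\<lambda>x::complex^3. x $ i) has_derivative (\<lambda>h. h $ i)) (at p)"
  by (rule bounded_linear_imp_has_derivative[OF bounded_linear_vec_nth])

lemma has_derivative_exp_complex:
  fixes g :: "'a::real_normed_vector \<Rightarrow> complex"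
  assumes "(g has_derivative g') (at x)"
  shows "((\<lambda>x. exp (g x)) has_derivative (\<lambda>h. exp (g x) * g' h)) (at x)"
  by (rule has_derivative_compose[OF assms DERIV_exp[unfolded has_field_derivative_def]])

text \<open>Around \<open>q\<close>, \<open>\<Phi>\<close> carries the pulled-back surface to the
  surface and \<open>k\<close> carries it to the normal form; joining the two equivalences avoids
  writing down an inverse map.\<close>

lemma singularity_of_type_A_from_coordinates:
  fixes F :: "complex^3 \<Rightarrow> complex"
  assumes U: "open U" "q \<in> U" and \<Phi>: "holomorphic3_on \<Phi> U" and k: "holomorphic3_on k U"
    and D\<Phi>: "(\<Phi> has_derivative D\<Phi>) (at q)" "\<And>h. D\<Phi> h = 0 \<Longrightarrow> h = 0"
    and Dk: "(k has_derivative Dk) (at q)" "\<And>h. Dk h = 0 \<Longrightarrow> h = 0" "k q = 0"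
    and eq: "\<And>s. s \<in> U \<Longrightarrow> F (\<Phi> s) = (k s $ 1)^2 + (k s $ 2)^2 + (k s $ 3)^(\<nu> + 1)"
    and \<nu>: "\<nu> \<ge> 1" and F: "(F has_derivative D) (at (\<Phi> q))"
  shows "singularity_of_type_A \<nu> F (\<Phi> q)"
proof -
  let ?T = "zero_set (\<lambda>z. (z$1)^2 + (z$2)^2 + (z$3)^(\<nu> + 1))"
  have fr: "frechet_derivative \<Phi> (at q) = D\<Phi>" "frechet_derivative k (at q) = Dk"
    using frechet_derivative_at[OF D\<Phi>(1)] frechet_derivative_at[OF Dk(1)] by simp_all
  have 1: "locally_analytically_equivalent (\<Phi> -` zero_set F) q (zero_set F) (\<Phi> q)"
    by (rule locally_analytically_equivalentI[OF U \<Phi>]) (simp_all add: fr D\<Phi>(2))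
  have 2: "locally_analytically_equivalent (\<Phi> -` zero_set F) q ?T (k q)"
    by (rule locally_analytically_equivalentI[OF U k]) (simp_all add: fr Dk(2) zero_set_def eq)
  have equiv: "locally_analytically_equivalent (zero_set F) (\<Phi> q) ?T 0"
    using locally_analytically_equivalent_trans[OF locally_analytically_equivalent_sym[OF 1] 2] Dk(3) by simp
  have F0: "F (\<Phi> q) = 0" using eq[OF U(2)] Dk(3) by (simp add: zero_power)
  have comp: "((\<lambda>s. F (\<Phi> s)) has_derivative (\<lambda>h. D (D\<Phi> h))) (at q)"
    by (rule has_derivative_compose[OF D\<Phi>(1) F])
  have kn: "((\<lambda>s. k s $ i) has_derivative (\<lambda>h. Dk h $ i)) (at q)" for i
    by (rule has_derivative_vec_nth_iff[THEN iffD1, OF Dk(1), rule_format])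
  have "((\<lambda>s. (k s $ 1)^2 + (k s $ 2)^2 + (k s $ 3)^(\<nu> + 1)) has_derivative (\<lambda>h. 0)) (at q)"
    by (rule has_derivative_eq_rhs, (rule derivative_intros kn)+) (use Dk(3) \<nu> in \<open>auto simp: zero_power\<close>)
  then have "((\<lambda>s. F (\<Phi> s)) has_derivative (\<lambda>h. 0)) (at q)"
    by (rule has_derivative_transform_within_open[OF _ U]) (simp add: eq)
  \<comment> \<open>The derivative of \<open>F\<close> vanishes on the range of
    \<open>D\<Phi>\<close>, which is the whole space because \<open>D\<Phi>\<close> is
    injective.\<close>
  from has_derivative_unique[OF comp this] have D0: "D (D\<Phi> h) = 0" for h by metis
  have lin: "linear D\<Phi>" by (rule has_derivative_linear[OF D\<Phi>(1)])
  have "inj D\<Phi>" unfolding linear_injective_0[OF lin] using D\<Phi>(2) by blast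
  then have "surj D\<Phi>" by (rule linear_injective_imp_surjective[OF lin]) (rule refl)
  then have "D = (\<lambda>_. 0)" using D0 by (metis surjD ext)
  then have "singular_point F (\<Phi> q)" using F F0 by (simp add: singular_point_def)
  then show ?thesis using equiv by (simp add: singularity_of_type_A_def)
qed

text \<open>Logarithmic coordinates around a triple: the three exponents sum to 0, which preserves
  the product.\<close>

definition fold_map :: "complex \<Rightarrow> complex \<Rightarrow> complex \<Rightarrow> complex^3 \<Rightarrow> complex^3" where
  "fold_map x1 x2 x3 s = vector
     [dx (x1 * exp (s$1)) (x2 * exp (s$2)) (x3 * exp (- (s$1 + s$2))),
      dy (x1 * exp (s$1)) (x2 * exp (s$2)) (x3 * exp (- (s$1 + s$2))), s$3]"

lemma fold_map_holomorphic: "holomorphic3_on (fold_map x1 x2 x3) UNIV"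
proof (rule holomorphic3_onI)
  fix p i
  have e: "1 / (x * exp y) = exp (- y) / x" for x y :: complex by (simp add: exp_minus field_simps)
  show "cdiff (\<lambda>s. fold_map x1 x2 x3 s $ i) p"
    using exhaust_3[of i]
    by (elim disjE; simp only: fold_map_def vector_3 dx_def dy_def e; intro cdiff_intros cdiff_divide_const)
qed

lemma fold_map_J:
  assumes "d > 0" "x1 * x2 * x3 = 1"
  shows "J d (fold_map x1 x2 x3 s $ 1) (fold_map x1 x2 x3 s $ 2) =
    (1 + om ^ 2 * x1 ^ d * exp (of_nat d * s$1)) * (1 + om ^ 2 * x2 ^ d * exp (of_nat d * s$2)) *
    (1 + om ^ 2 * x3 ^ d * exp (- (of_nat d * (s$1 + s$2))))"
proof -
  have "x1 * exp (s$1) * (x2 * exp (s$2)) * (x3 * exp (- (s$1 + s$2)))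
     = (x1 * x2 * x3) * (exp (s$1) * exp (s$2) * exp (- (s$1 + s$2)))" by (simp only: mult_ac)
  also have "\<dots> = 1" using assms(2) by (simp add: exp_add[symmetric])
  finally have "x1 * exp (s$1) * (x2 * exp (s$2)) * (x3 * exp (- (s$1 + s$2))) = 1" .
  note J = J_deltoid[OF assms(1) this]
  have e: "exp y ^ d = exp (of_nat d * y)" for y :: complex by (rule exp_of_nat_mult[symmetric])
  show ?thesis
    unfolding fold_map_def vector_3 J power_mult_distrib e by (simp only: mult.assoc mult_minus_right)
qed

text \<open>A kernel vector gives \<open>a + b = 0\<close> and \<open>a / x1 + b / x2 = 0\<close>
  for \<open>a = (x1 - x3) * h$1\<close> and \<open>b = (x2 - x3) * h$2\<close>. As
  \<open>x1\<close> and \<open>x2\<close> differ, \<open>a = b = 0\<close>, and the other two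
  inequalities give \<open>h = 0\<close>.\<close>

lemma fold_map_derivative:
  assumes x: "x1 * x2 * x3 = 1" "x1 \<noteq> x2" "x1 \<noteq> x3" "x2 \<noteq> x3"
  obtains D where "(fold_map x1 x2 x3 has_derivative D) (at (vector [0, 0, w]))" "\<And>h. D h = 0 \<Longrightarrow> h = 0"
proof -
  have ne: "x1 \<noteq> 0" "x2 \<noteq> 0" "x3 \<noteq> 0" using x by auto
  define q :: "complex^3" where "q = vector [0, 0, w]"
  define A where "A = (\<lambda>h::complex^3. x1 * h$1 + x2 * h$2 - x3 * (h$1 + h$2))"
  define B where "B = (\<lambda>h::complex^3. - (h$1 / x1) - h$2 / x2 + (h$1 + h$2) / x3)"
  define z where "z = (\<lambda>s::complex^3. x1 * exp (s$1) + x2 * exp (s$2) + x3 * exp (- (s$1 + s$2)))"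
  define z' where "z' = (\<lambda>s::complex^3. exp (- s$1) / x1 + exp (- s$2) / x2 + exp (s$1 + s$2) / x3)"
  have dz: "(z has_derivative A) (at q)"
    unfolding z_def A_def
    by (rule has_derivative_eq_rhs, (rule derivative_intros has_derivative_exp_complex nth_has_derivative)+)
      (auto simp: q_def fun_eq_iff algebra_simps)
  have dz': "(z' has_derivative B) (at q)"
    unfolding z'_def B_def divide_inverse
    by (rule has_derivative_eq_rhs, (rule derivative_intros has_derivative_exp_complex nth_has_derivative)+)
      (auto simp: q_def fun_eq_iff algebra_simps)
  have f: "fold_map x1 x2 x3 s $ 1 = (z s + z' s) / 2" "fold_map x1 x2 x3 s $ 2 = of_real (sqrt 3) * ((z s - z' s) / (2 * \<i>))" for s
  proof -
    have e: "1 / (x * exp y) = exp (- y) / x" for x y :: complex by (simp add: exp_minus field_simps)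
    show "fold_map x1 x2 x3 s $ 1 = (z s + z' s) / 2" "fold_map x1 x2 x3 s $ 2 = of_real (sqrt 3) * ((z s - z' s) / (2 * \<i>))"
      by (simp_all only: fold_map_def vector_3 dx_def dy_def e z_def z'_def minus_minus)
  qed
  have d1: "((\<lambda>s. fold_map x1 x2 x3 s $ 1) has_derivative (\<lambda>h. (A h + B h) / 2)) (at q)"
    unfolding f divide_inverse
    by (rule has_derivative_eq_rhs, (rule derivative_intros dz dz')+) (auto simp: fun_eq_iff)
  have d2: "((\<lambda>s. fold_map x1 x2 x3 s $ 2) has_derivative (\<lambda>h. of_real (sqrt 3) * ((A h - B h) / (2 * \<i>)))) (at q)"
    unfolding f divide_inverse
    by (rule has_derivative_eq_rhs, (rule derivative_intros dz dz')+) (auto simp: fun_eq_iff)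
  have d3: "((\<lambda>s. fold_map x1 x2 x3 s $ 3) has_derivative (\<lambda>h. h $ 3)) (at q)"
    by (simp add: fold_map_def nth_has_derivative)
  have D: "(fold_map x1 x2 x3 has_derivative
      (\<lambda>h. vector [(A h + B h) / 2, of_real (sqrt 3) * ((A h - B h) / (2 * \<i>)), h $ 3])) (at q)"
    by (rule vec3_derivative[OF d1 d2 d3])
  have "h = 0" if "vector [(A h + B h) / 2, of_real (sqrt 3) * ((A h - B h) / (2 * \<i>)), h $ 3] = (0 :: complex^3)" for h
  proof -
    have "(A h + B h) / 2 = 0" "of_real (sqrt 3) * ((A h - B h) / (2 * \<i>)) = 0" and h3: "h $ 3 = 0"
      using arg_cong[OF that, of "\<lambda>v. v $ 1"] arg_cong[OF that, of "\<lambda>v. v $ 2"] arg_cong[OF that, of "\<lambda>v. v $ 3"]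
      by (simp_all only: vector_3 zero_index)
    then have h: "A h + B h = 0" "A h - B h = 0" by simp_all
    define a where "a = (x1 - x3) * h$1"
    define b where "b = (x2 - x3) * h$2"
    have "2 * A h = (A h + B h) + (A h - B h)" by (simp only: mult_2) simp
    then have "A h = 0" unfolding h by simp
    then have A0: "a + b = 0" by (simp add: A_def a_def b_def algebra_simps)
    have "B h = 0" using h(1) unfolding \<open>A h = 0\<close> by simp
    moreover have "x3 * B h = a / x1 + b / x2" using ne by (simp add: B_def a_def b_def field_simps)
    ultimately have B0: "a / x1 + b / x2 = 0" by simp
    have b: "b = - a" using A0 by (simp add: add_eq_0_iff)
    have "a * (x2 - x1) = 0" using B0 ne unfolding b by (simp add: field_simps)
    then have "a = 0" using x(2) by simp
    then have "h $ 1 = 0" "h $ 2 = 0" using b x(3,4) by (auto simp: a_def b_def)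
    then show ?thesis using h3 by (simp add: vec_eq_iff forall_3)
  qed
  then show thesis using that[OF D[unfolded q_def]] by blast
qed

lemma fold_map_base: "fold_map x1 x2 x3 (vector [0, 0, w]) = vector [dx x1 x2 x3, dy x1 x2 x3, w]"
  by (simp add: fold_map_def)

text \<open>The third coordinate is an \<open>(\<nu>+1)\<close>-st root of \<open>(B - B(w0)) / 2\<close>; the first two are
  supplied by a sum-of-squares form of the folding polynomial.\<close>

lemma singularity_of_type_A_sum_of_squares:
  fixes F :: "complex^3 \<Rightarrow> complex"
  assumes d: "d > 0" and F: "\<And>p. F p = J d (p$1) (p$2) + (poly B (p$3) + 1) / 2"
    and x: "x1 * x2 * x3 = 1" "x1 \<noteq> x2" "x1 \<noteq> x3" "x2 \<noteq> x3"
    and H: "\<And>w. poly B w = poly B w0 + (w - w0) ^ (\<nu> + 1) * poly H w" "poly H w0 \<noteq> 0" and \<nu>: "\<nu> \<ge> 1"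
    and U: "open U" "vector [0, 0, w0] \<in> U"
    and cd: "\<And>s. s \<in> U \<Longrightarrow> cdiff X s" "\<And>s. s \<in> U \<Longrightarrow> cdiff Y s"
    and DX: "(X has_derivative (\<lambda>h. a1 * h$1 + a2 * h$2)) (at (vector [0, 0, w0]))"
    and DY: "(Y has_derivative (\<lambda>h. b1 * h$1 + b2 * h$2)) (at (vector [0, 0, w0]))"
    and det: "a1 * b2 \<noteq> a2 * b1" and zero: "X (vector [0, 0, w0]) = 0" "Y (vector [0, 0, w0]) = 0"
    and eq: "\<And>s. s \<in> U \<Longrightarrow>
      (1 + om ^ 2 * x1 ^ d * exp (of_nat d * s$1)) * (1 + om ^ 2 * x2 ^ d * exp (of_nat d * s$2)) *
      (1 + om ^ 2 * x3 ^ d * exp (- (of_nat d * (s$1 + s$2)))) + (poly B w0 + 1) / 2 = (X s)^2 + (Y s)^2"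
  shows "singularity_of_type_A \<nu> F (vector [dx x1 x2 x3, dy x1 x2 x3, w0])"
proof -
  define q :: "complex^3" where "q = vector [0, 0, w0]"
  have "\<exists>c. c ^ (\<nu> + 1) = poly H w0 / 2" by (rule complex_root_exists) simp
  then obtain c where c: "c ^ (\<nu> + 1) = poly H w0 / 2" by blast
  have c0: "c \<noteq> 0" using c H(2) by (auto simp: zero_power)
  \<comment> \<open>Normalised to 1 at the base point, so that the principal logarithm is
    holomorphic nearby; \<open>c\<close> restores the scale.\<close>
  define r where "r = (\<lambda>s::complex^3. poly H (s$3) / poly H w0)"
  define E where "E = (\<lambda>s. c * exp (Ln (r s) / of_nat (\<nu> + 1)))"
  define Z where "Z = (\<lambda>s::complex^3. (s$3 - w0) * E s)"
  define k :: "complex^3 \<Rightarrow> complex^3" where "k = (\<lambda>s. vector [X s, Y s, Z s])"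
  define V where "V = U \<inter> {s. r s \<notin> \<real>\<^sub>\<le>\<^sub>0}"
  have cdr: "cdiff r s" for s unfolding r_def by (intro cdiff_intros cdiff_divide_const)
  have "continuous_on UNIV r"
    using cdr cdiff_differentiable has_derivative_continuous by (metis continuous_at_imp_continuous_on)
  then have "open (r -` (- \<real>\<^sub>\<le>\<^sub>0))" by (intro open_vimage) (auto simp: open_Compl)
  then have V: "open V" "q \<in> V"
    using U H(2) by (auto simp: V_def vimage_def q_def r_def)
  have cdE: "cdiff E s" if "s \<in> V" for s
    unfolding E_def using that by (intro cdiff_intros cdiff_divide_const cdiff_Ln cdr) (auto simp: V_def)
  have cdZ: "cdiff Z s" if "s \<in> V" for s
    unfolding Z_def using cdE[OF that] by (intro cdiff_intros)
  have Zpow: "(Z s) ^ (\<nu> + 1) = (poly B (s$3) - poly B w0) / 2" if "s \<in> V" for s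
  proof -
    have r0: "r s \<noteq> 0" using that by (auto simp: V_def)
    have "exp (Ln (r s) / of_nat (\<nu> + 1)) ^ (\<nu> + 1) = exp (of_nat (\<nu> + 1) * (Ln (r s) / of_nat (\<nu> + 1)))"
      by (rule exp_of_nat_mult[symmetric])
    also have "\<dots> = exp (Ln (r s))" by (simp del: of_nat_Suc)
    also have "\<dots> = r s" using r0 by simp
    finally have "(Z s) ^ (\<nu> + 1) = (s$3 - w0) ^ (\<nu> + 1) * (c ^ (\<nu> + 1) * r s)"
      unfolding Z_def E_def power_mult_distrib by (simp only: mult_ac)
    also have "\<dots> = (s$3 - w0) ^ (\<nu> + 1) * poly H (s$3) / 2" unfolding c r_def using H(2) by simp
    also have "\<dots> = (poly B (s$3) - poly B w0) / 2" by (subst H(1)[of "s$3"]) simp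
    finally show ?thesis .
  qed
  have "Z q = 0" by (simp add: Z_def q_def)
  then have k0: "k q = 0" using zero by (simp add: k_def vec_eq_iff forall_3 q_def)
  obtain DE where DE: "(E has_derivative DE) (at q)" using cdiff_differentiable[OF cdE[OF V(2)]] by blast
  have Eq: "E q = c" using H(2) by (simp add: E_def r_def q_def)
  \<comment> \<open>\<open>DE\<close> is multiplied by \<open>q$3 - w0 = 0\<close>, so it never has
    to be computed.\<close>
  have "(Z has_derivative (\<lambda>h. (q$3 - w0) * DE h + (h$3 - 0) * E q)) (at q)"
    unfolding Z_def by (intro has_derivative_mult DE has_derivative_diff nth_has_derivative has_derivative_const)
  then have DZ: "(Z has_derivative (\<lambda>h. c * h$3)) (at q)" unfolding Eq by (simp add: q_def mult.commute)
  have Dk: "(k has_derivative (\<lambda>h. vector [a1 * h$1 + a2 * h$2, b1 * h$1 + b2 * h$2, c * h$3])) (at q)"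
    by (rule vec3_derivative) (use DX DY DZ in \<open>simp_all add: k_def q_def\<close>)
  have Dk0: "h = 0" if "vector [a1 * h$1 + a2 * h$2, b1 * h$1 + b2 * h$2, c * h$3] = (0::complex^3)" for h :: "complex^3"
  proof -
    have h: "a1 * h$1 + a2 * h$2 = 0" "b1 * h$1 + b2 * h$2 = 0" "h$3 = 0"
      using that c0 by (auto simp: vec_eq_iff forall_3)
    have "(a1 * b2 - a2 * b1) * h$1 = b2 * (a1 * h$1 + a2 * h$2) - a2 * (b1 * h$1 + b2 * h$2)" by (simp add: algebra_simps)
    then have h1: "h$1 = 0" using h det by simp
    have "(a1 * b2 - a2 * b1) * h$2 = a1 * (b1 * h$1 + b2 * h$2) - b1 * (a1 * h$1 + a2 * h$2)" by (simp add: algebra_simps)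
    then have "h$2 = 0" using h det by simp
    then show ?thesis using h1 h(3) by (simp add: vec_eq_iff forall_3)
  qed
  have hk: "holomorphic3_on k V"
  proof (rule holomorphic3_onI)
    fix p i assume p: "p \<in> V"
    then have "p \<in> U" by (simp add: V_def)
    then show "cdiff (\<lambda>s. k s $ i) p"
      using exhaust_3[of i] cd[of p] cdZ[OF p] by (auto simp: k_def)
  qed
  obtain D\<Phi> where D\<Phi>: "(fold_map x1 x2 x3 has_derivative D\<Phi>) (at q)" "\<And>h. D\<Phi> h = 0 \<Longrightarrow> h = 0"
    by (rule fold_map_derivative[OF x, where w = w0, folded q_def]) (rule that)
  have "cdiff F p" for p
    unfolding F by (intro cdiff_add cdiff_divide_const cdiff_J cdiff_poly cdiff_nth cdiff_const)
  then obtain D where D: "(F has_derivative D) (at (fold_map x1 x2 x3 q))" using cdiff_differentiable by blast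
  have "F (fold_map x1 x2 x3 s) = (k s $ 1)^2 + (k s $ 2)^2 + (k s $ 3)^(\<nu> + 1)" if s: "s \<in> V" for s
  proof -
    have sU: "s \<in> U" using s by (simp add: V_def)
    have f3: "fold_map x1 x2 x3 s $ 3 = s $ 3" by (simp add: fold_map_def)
    have k: "k s $ 1 = X s" "k s $ 2 = Y s" "k s $ 3 = Z s" by (simp_all add: k_def)
    show ?thesis
      unfolding F fold_map_J[OF d x(1)] f3 k Zpow[OF s] eq[OF sU, symmetric] by (simp add: diff_divide_distrib add_divide_distrib)
  qed
  from singularity_of_type_A_from_coordinates[OF V holomorphic3_on_subset[OF fold_map_holomorphic] hk D\<Phi> Dk Dk0 k0 this \<nu> D]
  show ?thesis by (simp add: q_def fold_map_base)
qed

text \<open>Here the folding polynomial is \<open>(1 - e1) * (1 - e2) * (1 + e3)\<close>, and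
  \<open>1 + e3\<close> is 2 at the base point. Absorbed into the first factor it leaves a product
  \<open>P * Q\<close> of two local coordinates, and such a product is a sum of two squares.\<close>

lemma node_singularity:
  fixes F :: "complex^3 \<Rightarrow> complex"
  assumes d: "d > 0" and F: "\<And>p. F p = J d (p$1) (p$2) + (poly B (p$3) + 1) / 2"
    and x: "x1 * x2 * x3 = 1" "x1 \<noteq> x2" "x1 \<noteq> x3" "x2 \<noteq> x3"
    and Y: "om ^ 2 * x1 ^ d = -1" "om ^ 2 * x2 ^ d = -1" "om ^ 2 * x3 ^ d = 1"
    and H: "\<And>w. poly B w = poly B w0 + (w - w0) ^ (\<nu> + 1) * poly H w" "poly H w0 \<noteq> 0" and \<nu>: "\<nu> \<ge> 1"
    and B: "poly B w0 = -1"
  shows "singularity_of_type_A \<nu> F (vector [dx x1 x2 x3, dy x1 x2 x3, w0])"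
proof -
  define e1 where "e1 = (\<lambda>s::complex^3. exp (of_nat d * s$1))"
  define e2 where "e2 = (\<lambda>s::complex^3. exp (of_nat d * s$2))"
  define e3 where "e3 = (\<lambda>s::complex^3. exp (- (of_nat d * (s$1 + s$2))))"
  define P where "P = (\<lambda>s. (1 - e1 s) * (1 + e3 s))"
  define Q where "Q = (\<lambda>s. 1 - e2 s)"
  let ?q = "vector [0, 0, w0] :: complex^3"
  have de: "(e1 has_derivative (\<lambda>h. of_nat d * h$1)) (at ?q)" "(e2 has_derivative (\<lambda>h. of_nat d * h$2)) (at ?q)"
    "(e3 has_derivative (\<lambda>h. - (of_nat d * (h$1 + h$2)))) (at ?q)"
    unfolding e1_def e2_def e3_def
    by (rule has_derivative_eq_rhs, (rule derivative_intros has_derivative_exp_complex nth_has_derivative)+, simp add: fun_eq_iff algebra_simps)+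
  have e0: "e1 ?q = 1" "e2 ?q = 1" "e3 ?q = 1" by (simp_all add: e1_def e2_def e3_def)
  have dP: "(P has_derivative (\<lambda>h. - 2 * of_nat d * h$1)) (at ?q)"
    unfolding P_def
    by (rule has_derivative_eq_rhs, (rule derivative_intros de)+) (simp add: e0 fun_eq_iff algebra_simps)
  have dQ: "(Q has_derivative (\<lambda>h. - of_nat d * h$2)) (at ?q)"
    unfolding Q_def
    by (rule has_derivative_eq_rhs, (rule derivative_intros de)+) (simp add: e0 fun_eq_iff algebra_simps)
  show ?thesis
  proof (rule singularity_of_type_A_sum_of_squares[OF d F x H \<nu> open_UNIV UNIV_I,
        where X = "\<lambda>s. (P s + Q s) / 2" and Y = "\<lambda>s. (P s - Q s) / (2 * \<i>)"])
    show "((\<lambda>s. (P s + Q s) / 2) has_derivative (\<lambda>h. (- of_nat d) * h$1 + (- of_nat d / 2) * h$2)) (at ?q)"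
      unfolding divide_inverse by (rule has_derivative_eq_rhs, (rule derivative_intros dP dQ)+) (simp add: fun_eq_iff algebra_simps)
    show "((\<lambda>s. (P s - Q s) / (2 * \<i>)) has_derivative (\<lambda>h. (- of_nat d / \<i>) * h$1 + (of_nat d / (2 * \<i>)) * h$2)) (at ?q)"
      unfolding divide_inverse by (rule has_derivative_eq_rhs, (rule derivative_intros dP dQ)+) (simp add: fun_eq_iff algebra_simps)
    show "(- of_nat d) * (of_nat d / (2 * \<i>)) \<noteq> (- of_nat d / 2) * (- of_nat d / \<i> :: complex)"
      using d by (simp add: field_simps)
    show "cdiff (\<lambda>s. (P s + Q s) / 2) s" "cdiff (\<lambda>s. (P s - Q s) / (2 * \<i>)) s" for s
      unfolding P_def Q_def e1_def e2_def e3_def by (intro cdiff_intros cdiff_divide_const)+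
    show "(P ?q + Q ?q) / 2 = 0" "(P ?q - Q ?q) / (2 * \<i>) = 0" by (simp_all add: P_def Q_def e0)
    fix s
    have "((P s + Q s) / 2)\<^sup>2 + ((P s - Q s) / (2 * \<i>))\<^sup>2 = P s * Q s"
      by (simp add: power_divide power_mult_distrib) (simp add: field_simps power2_eq_square)
    then show "(1 + om ^ 2 * x1 ^ d * exp (of_nat d * s$1)) * (1 + om ^ 2 * x2 ^ d * exp (of_nat d * s$2)) *
      (1 + om ^ 2 * x3 ^ d * exp (- (of_nat d * (s$1 + s$2)))) + (poly B w0 + 1) / 2
      = ((P s + Q s) / 2)\<^sup>2 + ((P s - Q s) / (2 * \<i>))\<^sup>2"
      by (simp only: Y B) (simp add: P_def Q_def e1_def e2_def e3_def)
  qed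
qed

text \<open>With \<open>r = \<zeta> e\<^sup>d\<^sup>(\<^sup>s\<^sub>1\<^sup>+\<^sup>s\<^sub>2\<^sup>)\<^sup>/\<^sup>2\<close>, \<open>u = e\<^sup>d\<^sup>(\<^sup>s\<^sub>1\<^sup>-\<^sup>s\<^sub>2\<^sup>)\<^sup>/\<^sup>4\<close> and \<open>R = r + 1/r\<close>, the folding polynomial plus 1 equals
  \<open>(R + 1)\<^sup>2 + R (u - 1/u)\<^sup>2\<close>.\<close>

lemma center_singularity:
  fixes F :: "complex^3 \<Rightarrow> complex"
  assumes d: "d > 0" and F: "\<And>p. F p = J d (p$1) (p$2) + (poly B (p$3) + 1) / 2"
    and x: "x1 * x2 * x3 = 1" "x1 \<noteq> x2" "x1 \<noteq> x3" "x2 \<noteq> x3"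
    and Y: "om ^ 2 * x1 ^ d = \<zeta>" "om ^ 2 * x2 ^ d = \<zeta>" "om ^ 2 * x3 ^ d = \<zeta>" "\<zeta>\<^sup>2 + \<zeta> + 1 = 0"
    and H: "\<And>w. poly B w = poly B w0 + (w - w0) ^ (\<nu> + 1) * poly H w" "poly H w0 \<noteq> 0" and \<nu>: "\<nu> \<ge> 1"
    and B: "poly B w0 = 1"
  shows "singularity_of_type_A \<nu> F (vector [dx x1 x2 x3, dy x1 x2 x3, w0])"
proof -
  have z3: "\<zeta> * \<zeta>\<^sup>2 = 1" using Y(4) by algebra
  have z21: "\<zeta> + \<zeta>\<^sup>2 = -1" using Y(4) by algebra
  have zz: "\<zeta> - \<zeta>\<^sup>2 \<noteq> 0"
  proof
    assume "\<zeta> - \<zeta>\<^sup>2 = 0"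
    then have "3 = (0::complex)" using Y(4) by algebra
    then show False by simp
  qed
  let ?q = "vector [0, 0, w0] :: complex^3"
  define p where "p = (\<lambda>s::complex^3. exp (of_nat d / 2 * (s$1 + s$2)))"
  define p' where "p' = (\<lambda>s::complex^3. exp (- (of_nat d / 2 * (s$1 + s$2))))"
  define u where "u = (\<lambda>s::complex^3. exp (of_nat d / 4 * (s$1 - s$2)))"
  define u' where "u' = (\<lambda>s::complex^3. exp (- (of_nat d / 4 * (s$1 - s$2))))"
  define R where "R = (\<lambda>s. \<zeta> * p s + \<zeta>\<^sup>2 * p' s)"
  \<comment> \<open>A square root of \<open>- R\<close>, which is 1 at the base point; it makes
    \<open>R * (u - u')^2\<close> the square of \<open>\<i> * S * (u - u')\<close>.\<close>
  define S where "S = (\<lambda>s. exp (Ln (- R s) / 2))"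
  define U where "U = {s. - R s \<notin> \<real>\<^sub>\<le>\<^sub>0}"
  have base: "p ?q = 1" "p' ?q = 1" "u ?q = 1" "u' ?q = 1" by (simp_all add: p_def p'_def u_def u'_def)
  have R0: "R ?q = -1" by (simp add: R_def base z21)
  have cdR: "cdiff (\<lambda>s. - R s) s" for s
    unfolding R_def p_def p'_def by (intro cdiff_intros)
  have "continuous_on UNIV (\<lambda>s. - R s)"
    using cdR cdiff_differentiable has_derivative_continuous by (metis continuous_at_imp_continuous_on)
  then have "open ((\<lambda>s. - R s) -` (- \<real>\<^sub>\<le>\<^sub>0))" by (intro open_vimage) (auto simp: open_Compl)
  then have U: "open U" "?q \<in> U" by (auto simp: U_def vimage_def R0)
  have cdS: "cdiff S s" if "s \<in> U" for s
    unfolding S_def using that by (intro cdiff_exp cdiff_divide_const cdiff_Ln cdR) (auto simp: U_def)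
  have S2: "(S s)\<^sup>2 = - R s" if "s \<in> U" for s
  proof -
    have "(S s)\<^sup>2 = exp (Ln (- R s))" by (simp add: S_def power2_eq_square exp_add[symmetric])
    also have "\<dots> = - R s" using that by (intro exp_Ln) (auto simp: U_def)
    finally show ?thesis .
  qed
  obtain DS where DS: "(S has_derivative DS) (at ?q)" using cdiff_differentiable[OF cdS[OF U(2)]] by blast
  have S0: "S ?q = 1" by (simp add: S_def R0)
  have dd: "(p has_derivative (\<lambda>h. of_nat d / 2 * (h$1 + h$2))) (at ?q)" "(p' has_derivative (\<lambda>h. - (of_nat d / 2 * (h$1 + h$2)))) (at ?q)"
    "(u has_derivative (\<lambda>h. of_nat d / 4 * (h$1 - h$2))) (at ?q)" "(u' has_derivative (\<lambda>h. - (of_nat d / 4 * (h$1 - h$2)))) (at ?q)"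
    unfolding p_def p'_def u_def u'_def
    by (rule has_derivative_eq_rhs, (rule derivative_intros has_derivative_exp_complex nth_has_derivative)+, simp add: fun_eq_iff)+
  have dR: "((\<lambda>s. 1 + R s) has_derivative (\<lambda>h. (\<zeta> - \<zeta>\<^sup>2) * of_nat d / 2 * h$1 + (\<zeta> - \<zeta>\<^sup>2) * of_nat d / 2 * h$2)) (at ?q)"
    unfolding R_def
    by (rule has_derivative_eq_rhs, (rule derivative_intros dd)+) (simp add: fun_eq_iff field_simps)
  \<comment> \<open>The derivative of \<open>S\<close> is multiplied by \<open>u - u'\<close>, which
    is 0 at the base point.\<close>
  have dY: "((\<lambda>s. \<i> * (S s * (u s - u' s))) has_derivative (\<lambda>h. \<i> * of_nat d / 2 * h$1 + (- \<i> * of_nat d / 2) * h$2)) (at ?q)"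
    by (rule has_derivative_eq_rhs, (rule derivative_intros dd DS)+) (simp add: fun_eq_iff field_simps S0 base)
  show ?thesis
  proof (rule singularity_of_type_A_sum_of_squares[OF d F x H \<nu> U _ _ dR dY])
    show "cdiff (\<lambda>s. 1 + R s) s" for s unfolding R_def p_def p'_def by (intro cdiff_intros)
    show "cdiff (\<lambda>s. \<i> * (S s * (u s - u' s))) s" if "s \<in> U" for s
      unfolding u_def u'_def using cdS[OF that] by (intro cdiff_intros)
    have "A * (- \<i> * b / 2) \<noteq> A * (\<i> * b / 2)" if "A \<noteq> 0" "b \<noteq> 0" for A b
      using that by simp
    then show "(\<zeta> - \<zeta>\<^sup>2) * of_nat d / 2 * (- \<i> * of_nat d / 2) \<noteq> (\<zeta> - \<zeta>\<^sup>2) * of_nat d / 2 * (\<i> * of_nat d / 2)"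
      using zz d by simp
    show "1 + R ?q = 0" "\<i> * (S ?q * (u ?q - u' ?q)) = 0" by (simp_all add: R0 base)
    fix s assume s: "s \<in> U"
    have pp: "p s * p' s = 1" "u s * u' s = 1" by (simp_all add: p_def p'_def u_def u'_def exp_minus)
    have ex: "of_nat d * s$1 = of_nat d / 2 * (s$1 + s$2) + (of_nat d / 4 * (s$1 - s$2) + of_nat d / 4 * (s$1 - s$2))"
      "of_nat d * s$2 = of_nat d / 2 * (s$1 + s$2) + (- (of_nat d / 4 * (s$1 - s$2)) + - (of_nat d / 4 * (s$1 - s$2)))"
      "- (of_nat d * (s$1 + s$2)) = - (of_nat d / 2 * (s$1 + s$2)) + - (of_nat d / 2 * (s$1 + s$2))"
      by (simp_all add: field_simps)
    have e: "exp (of_nat d * s$1) = p s * (u s)\<^sup>2" "exp (of_nat d * s$2) = p s * (u' s)\<^sup>2"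
      "exp (- (of_nat d * (s$1 + s$2))) = (p' s)\<^sup>2"
      unfolding ex exp_add p_def p'_def u_def u'_def power2_eq_square by (rule refl)+
    \<comment> \<open>The summand \<open>+ 1\<close> on the left is the value of
      \<open>(B + 1) / 2\<close> at \<open>w0\<close>.\<close>
    have alg: "(1 + z * (a * b\<^sup>2)) * (1 + z * (a * b'\<^sup>2)) * (1 + z * a'\<^sup>2) + 1 =
       (1 + (z * a + z\<^sup>2 * a'))\<^sup>2 + (z * a + z\<^sup>2 * a') * (b - b')\<^sup>2"
      if "a * a' = 1" "b * b' = 1" "z * z\<^sup>2 = 1" for z a a' b b' :: complex
    proof -
      have "(1 + z * (a * b\<^sup>2)) * (1 + z * (a * b'\<^sup>2)) * (1 + z * a'\<^sup>2) + 1 =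
        2 + z * a * (b\<^sup>2 + b'\<^sup>2) + z\<^sup>2 * a\<^sup>2 * (b * b')\<^sup>2 + z * a'\<^sup>2 + z\<^sup>2 * (a * a') * a' * (b\<^sup>2 + b'\<^sup>2)
        + (z * z\<^sup>2) * (a * a')\<^sup>2 * (b * b')\<^sup>2"
        by (simp add: algebra_simps power2_eq_square)
      moreover have "(1 + (z * a + z\<^sup>2 * a'))\<^sup>2 + (z * a + z\<^sup>2 * a') * (b - b')\<^sup>2 =
        1 + (z * a + z\<^sup>2 * a') * (2 - 2 * (b * b')) + (z * a + z\<^sup>2 * a') * (b\<^sup>2 + b'\<^sup>2)
        + z\<^sup>2 * a\<^sup>2 + 2 * (z * z\<^sup>2) * (a * a') + z * (z * z\<^sup>2) * a'\<^sup>2"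
        by (simp add: algebra_simps power2_eq_square)
      ultimately show ?thesis unfolding that by (simp add: algebra_simps)
    qed
    have "(1 + \<zeta> * exp (of_nat d * s$1)) * (1 + \<zeta> * exp (of_nat d * s$2)) * (1 + \<zeta> * exp (- (of_nat d * (s$1 + s$2)))) + 1
       = (1 + R s)\<^sup>2 + R s * (u s - u' s)\<^sup>2"
      unfolding e R_def by (rule alg[OF pp z3])
    also have "R s * (u s - u' s)\<^sup>2 = (\<i> * (S s * (u s - u' s)))\<^sup>2" by (simp add: power_mult_distrib S2[OF s])
    finally show "(1 + om ^ 2 * x1 ^ d * exp (of_nat d * s$1)) * (1 + om ^ 2 * x2 ^ d * exp (of_nat d * s$2)) *
      (1 + om ^ 2 * x3 ^ d * exp (- (of_nat d * (s$1 + s$2)))) + (poly B w0 + 1) / 2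
      = (1 + R s)\<^sup>2 + (\<i> * (S s * (u s - u' s)))\<^sup>2"
      by (simp only: Y B) simp
  qed
qed

section \<open>The degree of the surface and the final count\<close>

definition simplex3 :: "nat \<Rightarrow> (nat \<times> nat \<times> nat) set" where
  "simplex3 n = {(i, j, k). i + j + k \<le> n}"

lemma finite_simplex3 [simp]: "finite (simplex3 n)"
  by (rule finite_subset[of _ "{..n} \<times> {..n} \<times> {..n}"]) (auto simp: simplex3_def)

text \<open>Coefficients are indexed by three exponents so that they add directly to those of a
  polynomial in \<open>p$3\<close>.\<close>

definition plane_poly :: "nat \<Rightarrow> (complex^3 \<Rightarrow> complex) \<Rightarrow> bool" where
  "plane_poly n f \<longleftrightarrow> (\<exists>c :: nat \<Rightarrow> nat \<Rightarrow> nat \<Rightarrow> complex. (\<forall>i j k. k > 0 \<longrightarrow> c i j k = 0) \<and>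
     (\<forall>p. f p = (\<Sum>(i, j, k) \<in> simplex3 n. c i j k * (p$1)^i * (p$2)^j * (p$3)^k)))"

lemma plane_poly_add:
  assumes "plane_poly n f" "plane_poly n g"
  shows "plane_poly n (\<lambda>p. f p + g p)"
proof -
  obtain a b :: "nat \<Rightarrow> nat \<Rightarrow> nat \<Rightarrow> complex" where
    a: "\<And>i j k. k > 0 \<Longrightarrow> a i j k = 0" "\<And>p. f p = (\<Sum>(i, j, k) \<in> simplex3 n. a i j k * (p$1)^i * (p$2)^j * (p$3)^k)" and
    b: "\<And>i j k. k > 0 \<Longrightarrow> b i j k = 0" "\<And>p. g p = (\<Sum>(i, j, k) \<in> simplex3 n. b i j k * (p$1)^i * (p$2)^j * (p$3)^k)"
    using assms unfolding plane_poly_def by blast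
  show ?thesis
    unfolding plane_poly_def
    by (rule exI[of _ "\<lambda>i j k. a i j k + b i j k"])
      (auto simp: a b sum.distrib[symmetric] algebra_simps intro!: sum.cong)
qed

lemma plane_poly_monom:
  assumes "i + j \<le> n"
  shows "plane_poly n (\<lambda>p. c * (p$1)^i * (p$2)^j)"
proof -
  define a :: "nat \<Rightarrow> nat \<Rightarrow> nat \<Rightarrow> complex" where
    "a = (\<lambda>i' j' k'. if (i', j', k') = (i, j, 0) then c else 0)"
  have "(\<Sum>(i', j', k') \<in> simplex3 n. a i' j' k' * (p$1)^i' * (p$2)^j' * (p$3)^k') = c * (p$1)^i * (p$2)^j" for p :: "complex^3"
  proof -
    have "(\<Sum>(i', j', k') \<in> simplex3 n. a i' j' k' * (p$1)^i' * (p$2)^j' * (p$3)^k')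
      = (\<Sum>t \<in> simplex3 n. if t = (i, j, 0) then c * (p$1)^i * (p$2)^j else 0)"
    proof (intro sum.cong refl)
      fix t :: "nat \<times> nat \<times> nat"
      obtain x y z where t: "t = (x, y, z)" by (cases t)
      show "(case t of (i', j', k') \<Rightarrow> a i' j' k' * (p$1)^i' * (p$2)^j' * (p$3)^k') = (if t = (i, j, 0) then c * (p$1)^i * (p$2)^j else 0)"
        by (cases "t = (i, j, 0)") (auto simp: t a_def)
    qed
    also have "\<dots> = (if (i, j, 0) \<in> simplex3 n then c * (p$1)^i * (p$2)^j else 0)"
      by (rule sum.delta[OF finite_simplex3])
    also have "\<dots> = c * (p$1)^i * (p$2)^j" using assms by (simp add: simplex3_def)
    finally show ?thesis .
  qed
  then show ?thesis unfolding plane_poly_def by (intro exI[of _ a]) (auto simp: a_def)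
qed

lemma plane_poly_sum:
  assumes "\<And>t. t \<in> S \<Longrightarrow> plane_poly n (f t)"
  shows "plane_poly n (\<lambda>p. \<Sum>t\<in>S. f t p)"
  using assms
proof (induction S rule: infinite_finite_induct)
  case (insert t S)
  then show ?case using plane_poly_add[of n "f t" "\<lambda>p. \<Sum>t\<in>S. f t p"] by simp
qed (use plane_poly_monom[of 0 0 n 0] in simp_all)

lemma plane_poly_times_linear:
  assumes "plane_poly n f"
  shows "plane_poly (Suc n) (\<lambda>p. (\<alpha> * p$1 + \<beta> * p$2 + \<gamma>) * f p)"
proof -
  obtain a :: "nat \<Rightarrow> nat \<Rightarrow> nat \<Rightarrow> complex" where
    a: "\<And>i j k. k > 0 \<Longrightarrow> a i j k = 0" "\<And>p. f p = (\<Sum>(i, j, k) \<in> simplex3 n. a i j k * (p$1)^i * (p$2)^j * (p$3)^k)"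
    using assms unfolding plane_poly_def by blast
  have "plane_poly (Suc n) (\<lambda>p. (\<alpha> * p$1 + \<beta> * p$2 + \<gamma>) * (a i j k * (p$1)^i * (p$2)^j * (p$3)^k))"
    if t: "(i, j, k) \<in> simplex3 n" for i j k
  proof (cases "k = 0")
    case True
    have "plane_poly (Suc n) (\<lambda>p. (\<alpha> * a i j k) * (p$1)^(Suc i) * (p$2)^j + (\<beta> * a i j k) * (p$1)^i * (p$2)^(Suc j)
      + (\<gamma> * a i j k) * (p$1)^i * (p$2)^j)"
      using t by (intro plane_poly_add plane_poly_monom) (auto simp: simplex3_def)
    then show ?thesis using True by (simp add: algebra_simps)
  next
    case False
    then show ?thesis using a(1) plane_poly_monom[of 0 0 "Suc n" 0] by simp
  qed
  then have "plane_poly (Suc n) (\<lambda>p. \<Sum>t\<in>simplex3 n. case t of (i, j, k) \<Rightarrow>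
    (\<alpha> * p$1 + \<beta> * p$2 + \<gamma>) * (a i j k * (p$1)^i * (p$2)^j * (p$3)^k))"
    by (intro plane_poly_sum) auto
  then show ?thesis unfolding a(2) sum_distrib_left by (simp add: case_prod_unfold)
qed

lemma plane_poly_prod_linear:
  assumes "finite I"
  shows "plane_poly (card I) (\<lambda>p. \<Prod>\<mu>\<in>I. (\<alpha> \<mu> * p$1 + \<beta> \<mu> * p$2 + \<gamma> \<mu>))"
  using assms
proof (induction I rule: finite_induct)
  case empty
  then show ?case using plane_poly_monom[of 0 0 0 1] by simp
next
  case (insert \<mu> I)
  then show ?case using plane_poly_times_linear[OF insert.IH, of "\<alpha> \<mu>" "\<beta> \<mu>" "\<gamma> \<mu>"] by simp
qed

lemma plane_poly_J:
  assumes "d > 0"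
  shows "plane_poly d (\<lambda>p. J d (p$1) (p$2))"
proof -
  define I where "I = {- \<lfloor>(real d - 2) / 2\<rfloor> .. \<lfloor>(real d + 1) / 2\<rfloor>}"
  have card: "card I = d"
    using bij_betw_same_card[OF theta_roots[OF assms]] card_nth_roots[of om d] om_powers(3) assms by (simp add: I_def)
  define C where "C = complex_of_real (2 * cos (real d * pi / 2 + 2 * pi / 3))"
  define \<alpha> where "\<alpha> = (\<lambda>\<mu>. - complex_of_real (tan (theta d \<mu>)))"
  define \<beta> where "\<beta> = (\<lambda>\<mu>::int. 1 / complex_of_real (sqrt 3))"
  define \<gamma> where "\<gamma> = (\<lambda>\<mu>. complex_of_real (cos (2 * theta d \<mu>)) * complex_of_real (tan (theta d \<mu>)) + complex_of_real (sin (2 * theta d \<mu>)))"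
  have "L d \<mu> x (y / complex_of_real (sqrt 3)) = \<alpha> \<mu> * x + \<beta> \<mu> * y + \<gamma> \<mu>" for \<mu> x y
    by (simp add: L_def \<alpha>_def \<beta>_def \<gamma>_def algebra_simps)
  then have J: "J d x y = C * (\<Prod>\<mu>\<in>I. (\<alpha> \<mu> * x + \<beta> \<mu> * y + \<gamma> \<mu>))" for x y
    by (simp add: J_def J_hat_def I_def C_def)
  obtain c :: "nat \<Rightarrow> nat \<Rightarrow> nat \<Rightarrow> complex" where c: "\<And>i j k. k > 0 \<Longrightarrow> c i j k = 0"
    "\<And>p::complex^3. (\<Prod>\<mu>\<in>I. (\<alpha> \<mu> * p$1 + \<beta> \<mu> * p$2 + \<gamma> \<mu>)) = (\<Sum>(i, j, k) \<in> simplex3 d. c i j k * (p$1)^i * (p$2)^j * (p$3)^k)"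
    using plane_poly_prod_linear[of I \<alpha> \<beta> \<gamma>] unfolding plane_poly_def card by (auto simp: I_def)
  show ?thesis
    unfolding plane_poly_def J c(2) sum_distrib_left
    by (intro exI[of _ "\<lambda>i j k. C * c i j k"]) (auto simp: c(1) case_prod_unfold mult.assoc)
qed

text \<open>The coefficient of \<open>p$3 ^ d\<close> is half the leading coefficient of
  \<open>B\<close>: the folding polynomial does not involve \<open>p$3\<close> and cannot cancel
  it.\<close>

lemma total_degree_surface:
  assumes d: "d > 0" and B: "degree B = d"
    and F: "\<And>p. F p = J d (p$1) (p$2) + (poly B (p$3) + 1) / 2"
  shows "total_degree_eq F d"
proof -
  obtain c :: "nat \<Rightarrow> nat \<Rightarrow> nat \<Rightarrow> complex" where c: "\<And>i j k. k > 0 \<Longrightarrow> c i j k = 0"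
    "\<And>p::complex^3. J d (p$1) (p$2) = (\<Sum>(i, j, k) \<in> simplex3 d. c i j k * (p$1)^i * (p$2)^j * (p$3)^k)"
    using plane_poly_J[OF d] unfolding plane_poly_def by blast
  define Q where "Q = smult (1 / 2) (B + [:1:])"
  have Q: "poly Q w = (poly B w + 1) / 2" for w by (simp add: Q_def)
  have degQ: "degree Q \<le> d" using B d by (simp add: Q_def degree_add_le)
  have "coeff Q d = coeff B d / 2" using d by (simp add: Q_def coeff_pCons split: nat.splits)
  moreover have "coeff B d \<noteq> 0" using B d by (metis degree_0 leading_coeff_0_iff less_numeral_extra(3))
  ultimately have Qd: "coeff Q d \<noteq> 0" by auto
  define a where "a = (\<lambda>i j k. c i j k + (if i = 0 \<and> j = 0 then coeff Q k else 0))"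
  have sumQ: "(\<Sum>(i, j, k) \<in> simplex3 d. (if i = 0 \<and> j = 0 then coeff Q k else 0) * (p$1)^i * (p$2)^j * (p$3)^k) = poly Q (p$3)" for p :: "complex^3"
  proof -
    have "(\<Sum>(i, j, k) \<in> simplex3 d. (if i = 0 \<and> j = 0 then coeff Q k else 0) * (p$1)^i * (p$2)^j * (p$3)^k)
      = (\<Sum>(i, j, k) \<in> (\<lambda>k. (0, 0, k)) ` {..d}. (if i = 0 \<and> j = 0 then coeff Q k else 0) * (p$1)^i * (p$2)^j * (p$3)^k)"
    proof (rule sum.mono_neutral_right[OF finite_simplex3])
      show "(\<lambda>k. (0, 0, k)) ` {..d} \<subseteq> simplex3 d" by (auto simp: simplex3_def)
      show "\<forall>t\<in>simplex3 d - (\<lambda>k. (0, 0, k)) ` {..d}.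
        (case t of (i, j, k) \<Rightarrow> (if i = 0 \<and> j = 0 then coeff Q k else 0) * (p$1)^i * (p$2)^j * (p$3)^k) = 0"
        by (auto simp: simplex3_def image_iff)
    qed
    also have "\<dots> = (\<Sum>k\<le>d. coeff Q k * (p$3)^k)"
      by (subst sum.reindex) (auto simp: inj_on_def)
    also have "\<dots> = poly Q (p$3)"
      unfolding poly_altdef using degQ by (intro sum.mono_neutral_right) (auto simp: coeff_eq_0)
    finally show ?thesis .
  qed
  have Fa: "F p = (\<Sum>(i, j, k) \<in> simplex3 d. a i j k * (p$1)^i * (p$2)^j * (p$3)^k)" for p
    unfolding F c(2) Q[symmetric] sumQ[symmetric] sum.distrib[symmetric]
    by (intro sum.cong) (auto simp: a_def algebra_simps)
  have "a 0 0 d \<noteq> 0" using c(1)[OF d] Qd by (simp add: a_def)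
  then have "\<exists>i j k. i + j + k = d \<and> a i j k \<noteq> 0"
    by (metis add_0)
  then show ?thesis unfolding total_degree_eq_def simplex3_def[symmetric]
    using Fa by blast
qed

text \<open>What the count takes from admissibility: 3 divides \<open>d\<close> for the centers,
  \<open>\<epsilon> < \<nu>\<close> separates the points over \<open>wu\<close>, and
  \<open>s \<ge> 1\<close> provides \<open>w 0\<close>.\<close>

lemma admissible_arith:
  assumes "admissible t d \<nu> \<epsilon> s"
  shows "(\<exists>q>0. d = 3 * q) \<and> \<epsilon> < \<nu> \<and> s \<ge> 1"
proof -
  have ex: "\<exists>q>0. d = 3 * q" if "d = 3 * X" "X > 0" for X using that by blast
  consider "admissible1 d \<nu> \<epsilon> s" | "admissible2 d \<nu> \<epsilon> s" | "admissible3 d \<nu> \<epsilon> s"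
    using assms by (auto simp: admissible_def)
  then show ?thesis
  proof cases
    case 1
    then obtain m n k where *: "m \<ge> 1" "k = 3 * m + 1" "s = k" "\<nu> = 3 * n + k - 2" "d = k * \<nu> + 1" "\<epsilon> = 0"
      unfolding admissible1_def by (elim exE conjE) (rule that)
    \<comment> \<open>Substituting \<open>Suc m'\<close> removes the truncated subtraction in
      \<open>\<nu>\<close> before the factor 3 is exhibited.\<close>
    then obtain m' where m: "m = Suc m'" by (cases m) auto
    have \<nu>: "\<nu> = 3 * n + 3 * m' + 2" and k: "k = 3 * m' + 4" using * m by simp_all
    have "d = 3 * (3 * m' * n + 3 * m' * m' + 6 * m' + 4 * n + 3)"
      unfolding *(5) \<nu> k by (simp add: algebra_simps)
    from ex[OF this] have q: "\<exists>q>0. d = 3 * q" by simp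
    have "\<epsilon> < \<nu>" "s \<ge> 1" unfolding *(3,6) \<nu> k by simp_all
    with q show ?thesis by blast
  next
    case 2
    then obtain j l m n a b where *: "j \<in> {0, 1}" "l \<ge> m" "j = 0 \<longrightarrow> m \<ge> 1" "b = 3 * l + j + 1" "a = 3 * m + j"
      "s = b" "\<nu> = 3 * n + b - 1" "d = b * \<nu> + a" "\<epsilon> = a - 1"
      unfolding admissible2_def by (elim exE conjE) (rule that)
    from *(1) have "j = 0 \<or> j = 1" by simp
    then show ?thesis
    proof
      assume j: "j = 0"
      then have \<nu>: "\<nu> = 3 * n + 3 * l" "b = 3 * l + 1" "a = 3 * m" "m \<ge> 1" using * by simp_all
      have "d = 3 * ((3 * l + 1) * (n + l) + m)" unfolding *(8) \<nu> by (simp add: algebra_simps)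
      from ex[OF this] \<nu>(4) have q: "\<exists>q>0. d = 3 * q" by simp
      have "\<epsilon> < \<nu>" "s \<ge> 1" using *(2) \<nu>(4) unfolding *(6,9) \<nu> by simp_all
      with q show ?thesis by blast
    next
      assume j: "j = 1"
      then have \<nu>: "\<nu> = 3 * n + 3 * l + 1" "b = 3 * l + 2" "a = 3 * m + 1" using * by simp_all
      have "d = 3 * ((3 * l + 2) * (n + l) + l + m + 1)" unfolding *(8) \<nu> by (simp add: algebra_simps)
      from ex[OF this] have q: "\<exists>q>0. d = 3 * q" by simp
      have "\<epsilon> < \<nu>" "s \<ge> 1" using *(2) unfolding *(6,9) \<nu> by simp_all
      with q show ?thesis by blast
    qed
  next
    case 3
    then obtain p m n l where *: "s = p" "p \<ge> 4" "m \<ge> 1" "if m = 1 then l = 0 else l \<le> m - 2"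
      and c: "p = 3*m - 1 \<and> d = 3*(n*p + m*(3*m - 2) + l + 1) \<and> \<nu> = 3*(n + m) - 1 \<and> \<epsilon> = 3*l + 1
       \<or> p = 3*m \<and> d = 3*(n*p + 3*m^2 + l + 1) \<and> \<nu> = 3*(n + m) \<and> \<epsilon> = 3*l + 2
       \<or> p = 3*m + 1 \<and> d = 3*(n*p + m*(3*m + 2) + l + 1) \<and> \<nu> = 3*(n + m) + 1 \<and> \<epsilon> = 3*l + 1
       \<or> p = 3*m - 1 \<and> d = 3*(n*p + m*(3*m - 1) + l + 1) \<and> \<nu> = 3*(n + m) \<and> \<epsilon> = 3*l + 2
       \<or> p = 3*m \<and> d = 3*(n*p + m*(3*m + 1) + l + 1) \<and> \<nu> = 3*(n + m) + 1 \<and> \<epsilon> = 3*l + 2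
       \<or> p = 3*m + 1 \<and> d = 3*(n*p + 3*m*(m + 1) + l + 1) \<and> \<nu> = 3*(n + m) + 2 \<and> \<epsilon> = 3*l
       \<or> p = 3*m - 1 \<and> d = 3*(n*p + 3*m^2 + l) \<and> \<nu> = 3*(n + m) + 1 \<and> \<epsilon> = 3*l
       \<or> p = 3*m \<and> d = 3*(n*p + m*(3*m + 2) + l + 1) \<and> \<nu> = 3*(n + m) + 2 \<and> \<epsilon> = 3*l + 2
       \<or> p = 3*m + 1 \<and> d = 3*(n*p + (3*m + 1)*(m + 1) + l + 1) \<and> \<nu> = 3*(n + m + 1) \<and> \<epsilon> = 3*l + 2"
      unfolding admissible3_def by (elim exE conjE) (rule that)
    \<comment> \<open>In the second alternative \<open>\<epsilon>\<close> is at most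
      \<open>3 * l + 2\<close>, hence at most \<open>3 * m - 4\<close>, while \<open>\<nu>\<close>
      is at least \<open>3 * m - 1\<close>.\<close>
    have l: "m = 1 \<and> l = 0 \<or> m \<ge> 2 \<and> l + 2 \<le> m" using *(3,4) by (auto split: if_splits)
    have q: "\<exists>q>0. d = 3 * q" using c *(3) by (elim disjE conjE) (erule ex, simp)+
    have "\<epsilon> < \<nu>" using c l *(2) by (elim disjE) auto
    then show ?thesis using q * by simp
  qed
qed

text \<open>In characteristic 0 the order of \<open>B - B(a)\<close> at \<open>a\<close> is one more
  than that of its derivative; \<open>H\<close> is the cofactor.\<close>

lemma poly_critical_expansion:
  fixes B :: "complex poly"
  assumes "pderiv B = [:- a, 1:] ^ n * Q" "poly Q a \<noteq> 0"
  obtains H where "\<And>w. poly B w = poly B a + (w - a) ^ (n + 1) * poly H w" "poly H a \<noteq> 0"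
proof -
  define C where "C = B - [:poly B a:]"
  have pC: "pderiv C = [:- a, 1:] ^ n * Q" using assms(1) by (simp add: C_def pderiv_diff)
  have Q0: "Q \<noteq> 0" using assms(2) by auto
  then have p0: "pderiv C \<noteq> 0" unfolding pC by simp
  then have C0: "C \<noteq> 0" by auto
  have "order a (pderiv C) = n"
    unfolding pC using Q0 assms(2) by (simp add: order_mult order_power_n_n order_0I)
  moreover have Ca: "poly C a = 0" by (simp add: C_def)
  then have "order a C \<noteq> 0" using C0 order_root by blast
  ultimately have "order a C = n + 1" using order_pderiv[OF C0 Ca] by simp
  then obtain H where H: "C = [:- a, 1:] ^ (n + 1) * H" "\<not> [:- a, 1:] dvd H"
    using order_decomp[OF C0, of a] by auto
  have "poly B w = poly B a + (w - a) ^ (n + 1) * poly H w" for w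
    using arg_cong[OF H(1), of "\<lambda>p. poly p w"] by (simp add: C_def algebra_simps)
  moreover have "poly H a \<noteq> 0" using H(2) by (simp add: poly_eq_0_iff_dvd)
  ultimately show thesis by (rule that)
qed

text \<open>Both normal forms are equivalent through the germ at \<open>p\<close>, and
  \<open>\<epsilon> \<ge> 1\<close> gives the cones exponents of at least 2.\<close>

lemma A_singularity_index_unique:
  assumes "singularity_of_type_A \<epsilon> F p" "singularity_of_type_A \<nu> F p" "\<epsilon> \<ge> 1"
  shows "\<not> \<epsilon> < \<nu>"
proof
  assume lt: "\<epsilon> < \<nu>"
  let ?T = "\<lambda>n. zero_set (\<lambda>z. (z$1)^2 + (z$2)^2 + (z$3)^n)"
  have "locally_analytically_equivalent (?T (\<epsilon> + 1)) 0 (?T (\<nu> + 1)) 0"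
    using assms(1,2) unfolding singularity_of_type_A_def
    by (blast intro: locally_analytically_equivalent_trans locally_analytically_equivalent_sym)
  then have "locally_analytically_equivalent (A_cone (\<epsilon> + 1)) 0 (A_cone (\<nu> + 1)) 0"
    using A_normal_form_equivalent locally_analytically_equivalent_sym locally_analytically_equivalent_trans by meson
  then show False using A_cone_inequiv[of "\<epsilon> + 1" "\<nu> + 1"] lt assms(3) by simp
qed

theorem proposition3p2:
  fixes t d \<nu> \<epsilon> s :: nat and B :: "complex poly" and F :: "complex^3 \<Rightarrow> complex"
  assumes "t \<in> {1, 2, 3}"
    and "admissible t d \<nu> \<epsilon> s"
    and "of_type d \<nu> \<epsilon> s B"
    and "\<And>p. F p = J d (p$1) (p$2) + (poly B (p$3) + 1) / 2"
  shows "(\<exists>q>0. d = 3 * q) \<and>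
         total_degree_eq F d \<and>
         finite {p. singularity_of_type_A \<nu> F p} \<and>
         real (card {p. singularity_of_type_A \<nu> F p}) =
           real d * (real d - 1) * (real s - 1) / 2 + real d * (real d - 3) / 3 + 1"
proof -
  note F = assms(4)
  obtain q where q: "q > 0" "d = 3 * q" and \<epsilon>\<nu>: "\<epsilon> < \<nu>" and s: "s \<ge> 1"
    using admissible_arith[OF assms(2)] by blast
  have d: "d > 0" using q by simp
  obtain w wu where degB: "degree B = d" and inj: "inj_on w {..<s}" and wu: "\<epsilon> \<noteq> 0 \<Longrightarrow> wu \<notin> w ` {..<s}"
    and pB: "pderiv B = [:- w 0, 1:] ^ \<nu> * [:- wu, 1:] ^ \<epsilon> * (\<Prod>l=1..<s. [:- w l, 1:] ^ \<nu>)"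
    and Bl: "\<And>l. l \<in> {1..<s} \<Longrightarrow> poly B (w l) = -1" and B0: "poly B (w 0) = 1" and Bu: "\<epsilon> \<noteq> 0 \<Longrightarrow> poly B wu = -1"
    using assms(3) unfolding of_type_def by blast
  have set: "{..<s} = insert 0 {1..<s}" using s by auto
  have pB': "pderiv B = [:- wu, 1:] ^ \<epsilon> * (\<Prod>l<s. [:- w l, 1:] ^ \<nu>)"
    unfolding set pB by (simp add: mult_ac)
  have crit: "(\<exists>l<s. x = w l) \<or> \<epsilon> \<noteq> 0 \<and> x = wu" if "poly (pderiv B) x = 0" for x
    using that unfolding pB' by (auto simp: poly_prod poly_power)
  have expand_w: "\<exists>H. (\<forall>x. poly B x = poly B (w l) + (x - w l) ^ (\<nu> + 1) * poly H x) \<and> poly H (w l) \<noteq> 0" if l: "l < s" for l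
  proof -
    define Q where "Q = [:- wu, 1:] ^ \<epsilon> * (\<Prod>i\<in>{..<s} - {l}. [:- w i, 1:] ^ \<nu>)"
    have "(\<Prod>i<s. [:- w i, 1:] ^ \<nu>) = [:- w l, 1:] ^ \<nu> * (\<Prod>i\<in>{..<s} - {l}. [:- w i, 1:] ^ \<nu>)"
      using l by (intro prod.remove) auto
    then have 1: "pderiv B = [:- w l, 1:] ^ \<nu> * Q" by (simp only: pB' Q_def mult_ac)
    have "w l \<noteq> w i" if "i \<in> {..<s} - {l}" for i using that inj l by (auto simp: inj_on_def)
    moreover have "w l \<noteq> wu" if "\<epsilon> \<noteq> 0" using wu[OF that] l by auto
    ultimately have 2: "poly Q (w l) \<noteq> 0" by (auto simp: Q_def poly_prod poly_power)
    show ?thesis by (rule poly_critical_expansion[OF 1 2]) blast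
  qed
  have expand_u: "\<exists>H. (\<forall>x. poly B x = poly B wu + (x - wu) ^ (\<epsilon> + 1) * poly H x) \<and> poly H wu \<noteq> 0" if e: "\<epsilon> \<noteq> 0"
  proof -
    have "poly (\<Prod>l<s. [:- w l, 1:] ^ \<nu>) wu \<noteq> 0"
      using wu[OF e] by (auto simp: poly_prod poly_power)
    from poly_critical_expansion[OF pB' this] show ?thesis by blast
  qed
  let ?A = "{p. singularity_of_type_A \<nu> F p}"
  define f :: "(complex \<times> complex) \<times> complex \<Rightarrow> complex^3" where "f = (\<lambda>((u, v), w). vector [u, v, w])"
  have injf: "inj f" by (auto simp: inj_def f_def vec_eq_iff forall_3)
  define N where "N = nodes d \<times> w ` {1..<s}"
  define C where "C = centers d \<times> {w 0}"
  have Yprod: "om ^ 2 * x1 ^ d * (om ^ 2 * x2 ^ d) * (om ^ 2 * x3 ^ d) = 1" if "x1 * x2 * x3 = 1" for x1 x2 x3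
  proof -
    have "om ^ 2 * x1 ^ d * (om ^ 2 * x2 ^ d) * (om ^ 2 * x3 ^ d) = om ^ 6 * (x1 * x2 * x3) ^ d"
      by (simp add: power_mult_distrib)
    then show ?thesis by (simp add: om_powers that)
  qed
  have om4: "om ^ 4 = - om" using om_powers(1) power_add[of om 3 1] by simp
  have om3: "om ^ 2 * om = -1" using om_powers(1) by (simp add: power3_eq_cube power2_eq_square)
  have sup: "f ` (N \<union> C) \<subseteq> ?A"
  proof -
    have "singularity_of_type_A \<nu> F (vector [u, v, w l])" if uv: "(u, v) \<in> nodes d" and l: "l \<in> {1..<s}" for u v l
    proof -
      obtain x1 x2 x3 where x: "u = dx x1 x2 x3" "v = dy x1 x2 x3" "x1 * x2 * x3 = 1" "x1 \<noteq> x2" "x1 ^ d = om" "x2 ^ d = om"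
        using uv unfolding nodes_def by blast
      have Y: "om ^ 2 * x1 ^ d = -1" "om ^ 2 * x2 ^ d = -1" unfolding x(5,6) by (rule om3)+
      have Y3: "om ^ 2 * x3 ^ d = 1" using Yprod[OF x(3)] unfolding Y by simp
      have ne: "x1 \<noteq> x3" "x2 \<noteq> x3" using Y Y3 by auto
      obtain H where "\<And>x. poly B x = poly B (w l) + (x - w l) ^ (\<nu> + 1) * poly H x" "poly H (w l) \<noteq> 0"
        using expand_w[of l] l by auto
      then show ?thesis unfolding x(1,2)
        by (intro node_singularity[OF d F x(3,4) ne Y Y3]) (use \<epsilon>\<nu> Bl[OF l] in auto)
    qed
    moreover have "singularity_of_type_A \<nu> F (vector [u, v, w 0])" if uv: "(u, v) \<in> centers d" for u v
    proof -
      obtain x1 x2 x3 c where x: "u = dx x1 x2 x3" "v = dy x1 x2 x3" "x1 * x2 * x3 = 1" "x1 \<noteq> x2" "x1 \<noteq> x3" "x2 \<noteq> x3"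
        "c \<in> {1, om ^ 2}" "x1 ^ d = c" "x2 ^ d = c" "x3 ^ d = c"
        using uv unfolding centers_def by blast
      define \<zeta> where "\<zeta> = om ^ 2 * c"
      have Y: "om ^ 2 * x1 ^ d = \<zeta>" "om ^ 2 * x2 ^ d = \<zeta>" "om ^ 2 * x3 ^ d = \<zeta>" by (simp_all add: x \<zeta>_def)
      have "\<zeta>\<^sup>2 + \<zeta> + 1 = 0"
      proof -
        have "\<zeta> = om ^ 2 \<or> \<zeta> = om ^ 4"
          using x(7) by (auto simp: \<zeta>_def simp flip: power_add)
        then have "\<zeta> = om - 1 \<or> \<zeta> = - om" unfolding om_powers(4) om4 .
        then show ?thesis
        proof
          assume "\<zeta> = om - 1"
          then show ?thesis using om_powers(4) by algebra
        next
          assume "\<zeta> = - om"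
          then show ?thesis using om_powers(4) by algebra
        qed
      qed
      note Y = Y this
      obtain H where "\<And>x. poly B x = poly B (w 0) + (x - w 0) ^ (\<nu> + 1) * poly H x" "poly H (w 0) \<noteq> 0"
        using expand_w[of 0] s by auto
      then show ?thesis unfolding x(1,2)
        by (intro center_singularity[OF d F x(3-6) Y]) (use \<epsilon>\<nu> B0 in auto)
    qed
    ultimately show ?thesis by (auto simp: N_def C_def f_def)
  qed
  have sub: "?A \<subseteq> f ` (N \<union> C)"
  proof
    fix p assume "p \<in> ?A"
    then have A: "singularity_of_type_A \<nu> F p" by simp
    then have Fp: "F p = 0" and der: "(F has_derivative (\<lambda>_. 0)) (at p)"
      by (auto simp: singularity_of_type_A_def singular_point_def)
    obtain x1 x2 x3 where x: "x1 * x2 * x3 = 1" "p $ 1 = dx x1 x2 x3" "p $ 2 = dy x1 x2 x3"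
      "x1 \<noteq> x2" "x1 \<noteq> x3" "x2 \<noteq> x3" and
      Y: "(om ^ 2 * x1 ^ d = om ^ 2 * x2 ^ d \<and> om ^ 2 * x2 ^ d = om ^ 2 * x3 ^ d \<and> (om ^ 2 * x1 ^ d) ^ 3 = 1) \<or>
      (om ^ 2 * x1 ^ d = -1 \<and> om ^ 2 * x2 ^ d = -1 \<and> om ^ 2 * x3 ^ d = 1)"
      by (rule singular_point_triple[OF d F der])
    have J: "J d (p$1) (p$2) = (1 + om ^ 2 * x1 ^ d) * (1 + om ^ 2 * x2 ^ d) * (1 + om ^ 2 * x3 ^ d)"
      unfolding x(2,3) by (rule J_deltoid[OF d x(1)])
    have pf: "p = f ((p$1, p$2), p$3)" by (simp add: f_def vec_eq_iff forall_3)
    have cr: "(\<exists>l\<in>{1..<s}. p$3 = w l) \<or> p$3 = w 0 \<or> \<epsilon> \<noteq> 0 \<and> p$3 = wu"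
      using crit[OF singular_point_fibre[OF F der]] unfolding set[symmetric] using s by (metis atLeastLessThan_iff less_one linorder_not_le)
    from Y show "p \<in> f ` (N \<union> C)"
    proof
      assume Y: "om ^ 2 * x1 ^ d = om ^ 2 * x2 ^ d \<and> om ^ 2 * x2 ^ d = om ^ 2 * x3 ^ d \<and> (om ^ 2 * x1 ^ d) ^ 3 = 1"
      define \<zeta> where "\<zeta> = om ^ 2 * x1 ^ d"
      have \<zeta>3: "\<zeta> ^ 3 = 1" and Yz: "om ^ 2 * x1 ^ d = \<zeta>" "om ^ 2 * x2 ^ d = \<zeta>" "om ^ 2 * x3 ^ d = \<zeta>"
        using Y by (auto simp: \<zeta>_def)
      have J3: "J d (p$1) (p$2) = (1 + \<zeta>) ^ 3" unfolding J Yz by (simp add: power3_eq_cube)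
      \<comment> \<open>Over every other critical point \<open>B\<close> is -1, which would force
        \<open>(1 + \<zeta>)^3 = 0\<close>, impossible for a cube root of unity.\<close>
      have p3: "p$3 = w 0"
      proof (rule ccontr)
        assume "p$3 \<noteq> w 0"
        then have "poly B (p$3) = -1" using cr Bl Bu by auto
        then have "(1 + \<zeta>) ^ 3 = 0" using Fp unfolding F J3 by simp
        then have "\<zeta> = -1" by (simp add: add_eq_0_iff)
        then show False using \<zeta>3 by simp
      qed
      have "(1 + \<zeta>) ^ 3 + 1 = 0" using Fp B0 p3 unfolding F J3 by simp
      have "(\<zeta> - om ^ 2) * (\<zeta> - om ^ 4) = 0"
      proof -
        \<comment> \<open>Subtracting the two equations leaves that of the primitive cube roots and
          so discards \<open>\<zeta> = 1\<close>, where the folding polynomial is 8.\<close>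
        have "3 * (\<zeta>\<^sup>2 + \<zeta> + 1) = (1 + \<zeta>) ^ 3 + 1 - (\<zeta> ^ 3 - 1)"
          by (simp add: power3_eq_cube power2_eq_square algebra_simps)
        also have "\<dots> = 0" using \<zeta>3 \<open>(1 + \<zeta>) ^ 3 + 1 = 0\<close> by simp
        finally have z: "\<zeta>\<^sup>2 + \<zeta> + 1 = 0" by (metis mult_eq_0_iff zero_neq_numeral)
        have "(\<zeta> - om ^ 2) * (\<zeta> - om ^ 4) = \<zeta>\<^sup>2 + \<zeta> + (om - om ^ 2)"
          unfolding om4 using om_powers(4) by algebra
        also have "\<dots> = 0" using z om_powers(4) by simp
        finally show ?thesis .
      qed
      then have "\<zeta> = om ^ 2 \<or> \<zeta> = om ^ 4" by simp
      then obtain c where c: "c \<in> {1, om ^ 2}" "\<zeta> = om ^ 2 * c"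
      proof
        assume "\<zeta> = om ^ 2"
        then show thesis using that[of 1] by simp
      next
        assume z: "\<zeta> = om ^ 4"
        have "\<zeta> = om ^ 2 * om ^ 2" unfolding z by (simp flip: power_add)
        then show thesis using that[of "om ^ 2"] by blast
      qed
      have xc: "x1 ^ d = c" "x2 ^ d = c" "x3 ^ d = c" using Yz om_powers(3) unfolding c(2) by auto
      have "(p$1, p$2) \<in> centers d" unfolding centers_def x(2,3)
        by (rule CollectI, rule exI[of _ x1], rule exI[of _ x2], rule exI[of _ x3], rule exI[of _ c])
          (intro conjI refl x(1,4-6) xc c(1))
      then show ?thesis using p3 by (subst pf) (auto simp: C_def)
    next
      assume Y: "om ^ 2 * x1 ^ d = -1 \<and> om ^ 2 * x2 ^ d = -1 \<and> om ^ 2 * x3 ^ d = 1"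
      have J0: "J d (p$1) (p$2) = 0" unfolding J using Y by simp
      have "p$3 \<noteq> w 0" using Fp B0 unfolding F J0 by auto
      moreover have "p$3 \<noteq> wu" if e: "\<epsilon> \<noteq> 0"
      proof
        assume u: "p$3 = wu"
        obtain H where H: "\<And>x. poly B x = poly B wu + (x - wu) ^ (\<epsilon> + 1) * poly H x" "poly H wu \<noteq> 0"
          using expand_u[OF e] by blast
        \<comment> \<open>Over \<open>wu\<close> the same normal form holds with exponent
          \<open>\<epsilon> + 1\<close>, so \<open>p\<close> would be of two different
          types.\<close>
        have "singularity_of_type_A \<epsilon> F (vector [dx x1 x2 x3, dy x1 x2 x3, wu])"
          by (rule node_singularity[OF d F x(1,4-6) _ _ _ H]) (use Y e Bu[OF e] in auto)
        moreover have "p = vector [dx x1 x2 x3, dy x1 x2 x3, wu]" using x u by (simp add: vec_eq_iff forall_3)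
        ultimately have "singularity_of_type_A \<epsilon> F p" by simp
        from A_singularity_index_unique[OF this A] e \<epsilon>\<nu> show False by simp
      qed
      ultimately obtain l where l: "l \<in> {1..<s}" "p$3 = w l" using cr by blast
      have "x1 ^ d = om" "x2 ^ d = om"
      proof -
        have "om ^ 2 * x1 ^ d = om ^ 2 * om" "om ^ 2 * x2 ^ d = om ^ 2 * om" using Y om3 by simp_all
        then show "x1 ^ d = om" "x2 ^ d = om" using om_powers(3) by auto
      qed
      then have "(p$1, p$2) \<in> nodes d" unfolding nodes_def x(2,3)
        by (intro CollectI exI[of _ x1] exI[of _ x2] exI[of _ x3] conjI refl x(1,4))
      then show ?thesis using l by (subst pf) (auto simp: N_def)
    qed
  qed
  have A: "?A = f ` (N \<union> C)" using sub sup by (rule equalityI)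
  have fin: "finite N" "finite C" using card_nodes(1)[OF d] card_centers(1)[OF q(2,1)] by (auto simp: N_def C_def)
  have "w 0 \<notin> w ` {1..<s}"
  proof
    assume "w 0 \<in> w ` {1..<s}"
    then obtain l where l: "l \<in> {1..<s}" "w l = w 0" by force
    then have "l = 0" using inj s by (auto dest!: inj_onD)
    then show False using l by simp
  qed
  then have "w ` {1..<s} \<inter> {w 0} = {}" by (metis Int_insert_right_if0 Int_empty_right)
  then have disj: "N \<inter> C = {}" unfolding N_def C_def Times_Int_Times by (simp only: Times_empty simp_thms)
  have "inj_on w {1..<s}" by (rule inj_on_subset[OF inj]) auto
  then have "card (w ` {1..<s}) = s - 1" by (simp add: card_image)
  then have cN: "card N = card (nodes d) * (s - 1)" by (simp add: N_def card_cartesian_product)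
  have cC: "card C = card (centers d)" by (simp add: C_def card_cartesian_product)
  have card: "card ?A = card (nodes d) * (s - 1) + card (centers d)"
    unfolding A using card_image[of f "N \<union> C"] injf card_Un_disjoint[OF fin disj] cN cC by (simp add: inj_on_subset)
  have n: "real (card (nodes d)) = real d * (real d - 1) / 2"
    using arg_cong[OF card_nodes(2)[OF d], of real] d by (simp add: of_nat_diff)
  have c: "real (card (centers d)) = real d * (real d - 3) / 3 + 1"
    using arg_cong[OF card_centers(2)[OF q(2,1)], of real] by (simp add: field_simps)
  have "real (card ?A) = real d * (real d - 1) * (real s - 1) / 2 + real d * (real d - 3) / 3 + 1"
    unfolding card using s by (simp add: n c of_nat_diff)
  moreover have "finite ?A" unfolding A using fin by simp
  moreover have "total_degree_eq F d" by (rule total_degree_surface[OF d degB F])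
  ultimately show ?thesis using q by blast
qed

end
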